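(* Let $\alpha \colon G \to \mathrm{Aut}(A)$ be a minimal (continuous) action of a Hausdorff topological group $G$ on a separable prime C*-algebra $A$. Set $H = \{ g \in G \colon \mathrm{Prim}(\alpha_g) = \mathrm{id}_{\mathrm{Prim}(A)} \}$. If $G / H$ is compact, then $A$ is simple.
   Context: $\mathrm{Prim}(A)$ is the primitive ideal space of $A$, and for an automorphism $\varphi$ of $A$, $\mathrm{Prim}(\varphi) \colon \mathrm{Prim}(A) \to \mathrm{Prim}(A)$ is the map $J \mapsto \varphi(J)$. An action of a topological group $G$ on $A$ is a homomorphism $\alpha \colon G \to \mathrm{Aut}(A)$ such that $g \mapsto \alpha_g(a)$ is norm continuous for all $a \in A$. The action is minimal if the only $\alpha$-invariant closed two-sided ideals of $A$ are $0$ and $A$. "Compact" does not include the Hausdorff property for spaces. *)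

theory Defs
  imports "HOL-Analysis.Analysis"
begin

section \<open>C*-algebras\<close>

text \<open>Algebras are not assumed unital. The real scalar multiplication and the topology of the
  underlying real Banach algebra are those of the library classes.\<close>

class cstar_algebra = real_normed_algebra + banach +
  fixes scaleC :: "complex \<Rightarrow> 'a \<Rightarrow> 'a"
    and star :: "'a \<Rightarrow> 'a"
  assumes scaleC_add_right: "scaleC c (x + y) = scaleC c x + scaleC c y"
    and scaleC_add_left: "scaleC (c + d) x = scaleC c x + scaleC d x"
    and scaleC_scaleC: "scaleC c (scaleC d x) = scaleC (c * d) x"
    and scaleC_of_real: "scaleC (complex_of_real r) x = scaleR r x"
    and norm_scaleC: "norm (scaleC c x) = cmod c * norm x"
    and mult_scaleC_left: "scaleC c x * y = scaleC c (x * y)"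
    and mult_scaleC_right: "x * scaleC c y = scaleC c (x * y)"
    and star_star: "star (star x) = x"
    and star_add: "star (x + y) = star x + star y"
    and star_scaleC: "star (scaleC c x) = scaleC (cnj c) (star x)"
    and star_mult: "star (x * y) = star y * star x"
    and cstar_identity: "norm (star x * x) = (norm x)\<^sup>2"

definition closed_ideal :: "'a::cstar_algebra set \<Rightarrow> bool" where
  "closed_ideal I \<longleftrightarrow> closed I \<and> 0 \<in> I
     \<and> (\<forall>x\<in>I. \<forall>y\<in>I. x + y \<in> I) \<and> (\<forall>c. \<forall>x\<in>I. scaleC c x \<in> I)
     \<and> (\<forall>a. \<forall>x\<in>I. a * x \<in> I \<and> x * a \<in> I)"

text \<open>As usual for rings, the zero algebra counts neither as simple nor as prime.\<close>

definition simple_cstar :: "'a::cstar_algebra itself \<Rightarrow> bool" where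
  "simple_cstar _ \<longleftrightarrow> (UNIV :: 'a set) \<noteq> {0}
     \<and> (\<forall>I :: 'a set. closed_ideal I \<longrightarrow> I = {0} \<or> I = UNIV)"

definition prime_cstar :: "'a::cstar_algebra itself \<Rightarrow> bool" where
  "prime_cstar _ \<longleftrightarrow> (UNIV :: 'a set) \<noteq> {0}
     \<and> (\<forall>I J :: 'a set. closed_ideal I \<longrightarrow> closed_ideal J \<longrightarrow>
          (\<forall>x\<in>I. \<forall>y\<in>J. x * y = 0) \<longrightarrow> I = {0} \<or> J = {0})"

definition star_automorphism :: "('a::cstar_algebra \<Rightarrow> 'a) \<Rightarrow> bool" where
  "star_automorphism \<phi> \<longleftrightarrow> bij \<phi>
     \<and> (\<forall>x y. \<phi> (x + y) = \<phi> x + \<phi> y) \<and> (\<forall>c x. \<phi> (scaleC c x) = scaleC c (\<phi> x))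
     \<and> (\<forall>x y. \<phi> (x * y) = \<phi> x * \<phi> y) \<and> (\<forall>x. \<phi> (star x) = star (\<phi> x))"


section \<open>Irreducible representations and primitive ideals\<close>

text \<open>Hilbert spaces are given by a carrier set with explicit operations, so that one can
  quantify over them inside a definition. The inner product is linear in its first argument.\<close>

locale complex_hilbert_space =
  fixes V :: "'h set"
    and zeroH :: "'h"
    and addH :: "'h \<Rightarrow> 'h \<Rightarrow> 'h"
    and scaleH :: "complex \<Rightarrow> 'h \<Rightarrow> 'h"
    and ip :: "'h \<Rightarrow> 'h \<Rightarrow> complex"
  assumes zero_closed: "zeroH \<in> V"
    and add_closed: "x \<in> V \<Longrightarrow> y \<in> V \<Longrightarrow> addH x y \<in> V"
    and scale_closed: "x \<in> V \<Longrightarrow> scaleH c x \<in> V"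
    and add_assoc: "x \<in> V \<Longrightarrow> y \<in> V \<Longrightarrow> z \<in> V \<Longrightarrow> addH (addH x y) z = addH x (addH y z)"
    and add_commute: "x \<in> V \<Longrightarrow> y \<in> V \<Longrightarrow> addH x y = addH y x"
    and add_zero: "x \<in> V \<Longrightarrow> addH zeroH x = x"
    and add_neg: "x \<in> V \<Longrightarrow> addH x (scaleH (- 1) x) = zeroH"
    and scale_one: "x \<in> V \<Longrightarrow> scaleH 1 x = x"
    and scale_scale: "x \<in> V \<Longrightarrow> scaleH c (scaleH d x) = scaleH (c * d) x"
    and scale_add_right: "x \<in> V \<Longrightarrow> y \<in> V \<Longrightarrow> scaleH c (addH x y) = addH (scaleH c x) (scaleH c y)"
    and scale_add_left: "x \<in> V \<Longrightarrow> scaleH (c + d) x = addH (scaleH c x) (scaleH d x)"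
    and ip_add: "x \<in> V \<Longrightarrow> y \<in> V \<Longrightarrow> z \<in> V \<Longrightarrow> ip (addH x y) z = ip x z + ip y z"
    and ip_scale: "x \<in> V \<Longrightarrow> y \<in> V \<Longrightarrow> ip (scaleH c x) y = c * ip x y"
    and ip_commute: "x \<in> V \<Longrightarrow> y \<in> V \<Longrightarrow> ip x y = cnj (ip y x)"
    and ip_nonneg: "x \<in> V \<Longrightarrow> 0 \<le> Re (ip x x)"
    and ip_eq_zero: "x \<in> V \<Longrightarrow> ip x x = 0 \<Longrightarrow> x = zeroH"
    and complete: "Metric_space.mcomplete V
      (\<lambda>x y. sqrt (Re (ip (addH x (scaleH (- 1) y)) (addH x (scaleH (- 1) y)))))"
begin

definition normH :: "'h \<Rightarrow> real" where
  "normH x = sqrt (Re (ip x x))"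

definition distH :: "'h \<Rightarrow> 'h \<Rightarrow> real" where
  "distH x y = normH (addH x (scaleH (- 1) y))"

definition closed_subspace :: "'h set \<Rightarrow> bool" where
  "closed_subspace W \<longleftrightarrow> W \<subseteq> V \<and> closedin (Metric_space.mtopology V distH) W \<and> zeroH \<in> W
     \<and> (\<forall>x\<in>W. \<forall>y\<in>W. addH x y \<in> W) \<and> (\<forall>c. \<forall>x\<in>W. scaleH c x \<in> W)"

definition bounded_operator :: "('h \<Rightarrow> 'h) \<Rightarrow> bool" where
  "bounded_operator T \<longleftrightarrow> (\<forall>x\<in>V. T x \<in> V)
     \<and> (\<forall>x\<in>V. \<forall>y\<in>V. T (addH x y) = addH (T x) (T y))
     \<and> (\<forall>c. \<forall>x\<in>V. T (scaleH c x) = scaleH c (T x))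
     \<and> (\<exists>K. \<forall>x\<in>V. normH (T x) \<le> K * normH x)"

definition representation :: "('a::cstar_algebra \<Rightarrow> 'h \<Rightarrow> 'h) \<Rightarrow> bool" where
  "representation \<pi> \<longleftrightarrow> (\<forall>a. bounded_operator (\<pi> a))
     \<and> (\<forall>a b. \<forall>x\<in>V. \<pi> (a + b) x = addH (\<pi> a x) (\<pi> b x))
     \<and> (\<forall>c a. \<forall>x\<in>V. \<pi> (scaleC c a) x = scaleH c (\<pi> a x))
     \<and> (\<forall>a b. \<forall>x\<in>V. \<pi> (a * b) x = \<pi> a (\<pi> b x))
     \<and> (\<forall>a. \<forall>x\<in>V. \<forall>y\<in>V. ip (\<pi> a x) y = ip x (\<pi> (star a) y))"

definition kernel :: "('a::cstar_algebra \<Rightarrow> 'h \<Rightarrow> 'h) \<Rightarrow> 'a set" where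
  "kernel \<pi> = {a. \<forall>x\<in>V. \<pi> a x = zeroH}"

text \<open>The condition on the kernel excludes the zero representations on spaces of dimension
  at most one.\<close>

definition irreducible_representation :: "('a::cstar_algebra \<Rightarrow> 'h \<Rightarrow> 'h) \<Rightarrow> bool" where
  "irreducible_representation \<pi> \<longleftrightarrow> representation \<pi> \<and> kernel \<pi> \<noteq> UNIV
     \<and> (\<forall>W. closed_subspace W \<longrightarrow> (\<forall>a. \<forall>x\<in>W. \<pi> a x \<in> W) \<longrightarrow> W = {zeroH} \<or> W = V)"

end

text \<open>The primitive ideals are the kernels of the irreducible representations. Restricting to
  Hilbert spaces whose vectors have type \<^typ>\<open>'a \<Rightarrow> complex\<close> (with arbitrary operations) loses
  nothing: if \<open>\<pi>\<close> is irreducible on \<open>H\<close> and \<open>\<xi> \<in> H\<close> is nonzero, then \<open>\<pi>(A)\<xi>\<close> is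
  dense, so that \<open>\<eta> \<mapsto> (\<lambda>a. \<langle>\<pi>(a)\<xi>, \<eta>\<rangle>)\<close> is an injection from \<open>H\<close> into
  \<^typ>\<open>'a \<Rightarrow> complex\<close>, along which the structure of \<open>H\<close> can be transported.\<close>

definition Prim :: "'a::cstar_algebra set set" where
  "Prim = {J. \<exists>(V :: ('a \<Rightarrow> complex) set) zeroH addH scaleH ip \<pi>.
     complex_hilbert_space V zeroH addH scaleH ip
     \<and> complex_hilbert_space.irreducible_representation V zeroH addH scaleH ip \<pi>
     \<and> J = complex_hilbert_space.kernel V zeroH \<pi>}"

definition Prim_map :: "('a::cstar_algebra \<Rightarrow> 'a) \<Rightarrow> 'a set \<Rightarrow> 'a set" where
  "Prim_map \<phi> J = \<phi> ` J"


section \<open>Group actions\<close>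

text \<open>Topological groups are those of the library class, which is written additively but not
  assumed commutative.\<close>

definition cstar_action :: "('g::topological_group_add \<Rightarrow> 'a::cstar_algebra \<Rightarrow> 'a) \<Rightarrow> bool" where
  "cstar_action \<alpha> \<longleftrightarrow> (\<forall>g. star_automorphism (\<alpha> g))
     \<and> (\<forall>g h. \<alpha> (g + h) = \<alpha> g \<circ> \<alpha> h)
     \<and> (\<forall>a. continuous_on UNIV (\<lambda>g. \<alpha> g a))"

definition minimal_action :: "('g::topological_group_add \<Rightarrow> 'a::cstar_algebra \<Rightarrow> 'a) \<Rightarrow> bool" where
  "minimal_action \<alpha> \<longleftrightarrow>
     (\<forall>I. closed_ideal I \<longrightarrow> (\<forall>g. \<alpha> g ` I \<subseteq> I) \<longrightarrow> I = {0} \<or> I = UNIV)"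

definition Prim_kernel :: "('g::topological_group_add \<Rightarrow> 'a::cstar_algebra \<Rightarrow> 'a) \<Rightarrow> 'g set" where
  "Prim_kernel \<alpha> = {g. \<forall>J\<in>Prim. Prim_map (\<alpha> g) J = J}"

definition left_coset :: "'g::topological_group_add set \<Rightarrow> 'g \<Rightarrow> 'g set" where
  "left_coset H g = (\<lambda>h. g + h) ` H"

definition coset_space :: "'g::topological_group_add set \<Rightarrow> 'g set topology" where
  "coset_space H = topology (\<lambda>\<U>. \<U> \<subseteq> range (left_coset H) \<and> open (left_coset H -` \<U>))"

lemma openin_coset_space:
  "openin (coset_space H) \<U> \<longleftrightarrow> \<U> \<subseteq> range (left_coset H) \<and> open (left_coset H -` \<U>)"
proof -
  have "istopology (\<lambda>\<U>. \<U> \<subseteq> range (left_coset H) \<and> open (left_coset H -` \<U>))"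
    unfolding istopology_def by (auto simp: vimage_Union)
  then show ?thesis
    by (simp add: coset_space_def)
qed

lemma topspace_coset_space: "topspace (coset_space H) = range (left_coset H)"
proof -
  have "left_coset H -` range (left_coset H) = UNIV"
    by auto
  then have "openin (coset_space H) (range (left_coset H))"
    by (simp add: openin_coset_space)
  then show ?thesis
    by (meson openin_coset_space openin_subset openin_topspace subset_antisym)
qed

lemma quotient_map_coset_space: "quotient_map euclidean (coset_space H) (left_coset H)"
  by (auto simp: quotient_map_def topspace_coset_space openin_coset_space vimage_def)

end

theory Submission
  imports Defs
begin

text \<open>Suppose that \<open>A\<close> has a closed ideal \<open>J\<close> other than \<open>0\<close> and \<open>A\<close>. It lies in a primitive ideal
  \<open>P\<close> (\<open>exists_primitive_ideal\<close>), and \<open>P\<close> is not zero. Consider the intersection \<open>K\<close> of all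
  translates \<open>\<alpha>\<^sub>g(P)\<close>. It is an invariant closed ideal contained in \<open>P\<close>, hence not \<open>A\<close>, so by
  minimality \<open>K = 0\<close>. The contradiction is that \<open>K\<close> is an intersection of only finitely many nonzero
  ideals, and those meet because \<open>A\<close> is prime.

  The finiteness comes from two facts. First, translates by group elements near \<open>0\<close> have a common
  nonzero element (\<open>nearby_translates_meet\<close>): if \<open>a \<in> P\<close> is self-adjoint of norm one and
  \<open>\<alpha>\<^sub>u(a\<^sup>2)\<close> is within \<open>1/2\<close> of \<open>a\<^sup>2\<close>, then a nonzero element built from the part of \<open>a\<^sup>2\<close> above the
  level \<open>1/2\<close> belongs to \<open>\<alpha>\<^sub>u(P)\<close>. So \<open>M = \<Inter>\<^sub>u \<alpha>\<^sub>u(P)\<close>, over \<open>u\<close> in some neighbourhood \<open>U\<close> of \<open>0\<close>, is not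
  zero. Second, \<open>H\<close> fixes \<open>P\<close> because \<open>P\<close> is primitive, and by compactness of \<open>G/H\<close> the group is
  a finite union of sets \<open>g + U + H\<close> (\<open>finite_cover_by_translates\<close>); hence \<open>K\<close> contains the
  intersection of the finitely many ideals \<open>\<alpha>\<^sub>g(M)\<close>.

  Most of the text supplies the C*-algebra theory behind this. The order structure is developed in the
  unitization without spectra: square roots come from an iteration, and everything else, up to the
  positivity of \<open>x\<^sup>* x\<close> (\<open>pos_star_mult_self\<close>), from algebra with square roots. Its main consequence
  is that closed ideals are hereditary (\<open>closed_ideal_hereditary\<close>). To find \<open>P\<close>, a Hahn-Banach argument
  gives a positive functional that vanishes on \<open>J\<close>, compactness gives an extreme one, and the
  representation attached to an extreme functional is irreducible
  (\<open>invariant_subspace_of_extreme\<close>). Its Hilbert space is realised as the space of bounded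
  conjugate-linear functionals on the algebra with the semi-inner product
  \<open>\<langle>x, y\<rangle> = f(y\<^sup>* x)\<close>, so that completeness is a matter of pointwise limits and no quotient
  or completion has to be formed.\<close>

section \<open>Elementary identities\<close>

lemma scaleC_zero_left [simp]: "scaleC 0 (x::'a::cstar_algebra) = 0"
  using scaleC_of_real[of 0 x] by simp

lemma scaleC_one [simp]: "scaleC 1 (x::'a::cstar_algebra) = x"
  using scaleC_of_real[of 1 x] by simp

lemma scaleC_zero_right [simp]: "scaleC c (0::'a::cstar_algebra) = 0"
  using scaleC_add_right[of c 0 "0::'a"] by simp

lemma scaleC_minus_right: "scaleC c (- x) = - scaleC c (x::'a::cstar_algebra)"
  using scaleC_add_right[of c x "-x"] by (simp add: minus_unique)

lemma scaleC_minus_left: "scaleC (- c) x = - scaleC c (x::'a::cstar_algebra)"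
  using scaleC_add_left[of c "-c" x] by (simp add: minus_unique)

lemma scaleC_diff_right: "scaleC c (x - y) = scaleC c x - scaleC c (y::'a::cstar_algebra)"
  using scaleC_add_right[of c x "-y"] by (simp add: scaleC_minus_right)

lemma scaleC_scaleR: "scaleC c (r *\<^sub>R x) = r *\<^sub>R scaleC c (x::'a::cstar_algebra)"
  by (metis scaleC_of_real scaleC_scaleC mult.commute)

lemma scaleC_scaleR_left: "scaleC (r *\<^sub>R c) x = r *\<^sub>R scaleC c (x::'a::cstar_algebra)"
  by (metis scaleC_of_real scaleC_scaleC scaleR_conv_of_real)

lemma star_zero [simp]: "star (0::'a::cstar_algebra) = 0"
  using star_add[of 0 "0::'a"] by simp

lemma star_minus: "star (- x) = - star (x::'a::cstar_algebra)"
  using star_add[of x "-x"] by (simp add: minus_unique)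

lemma star_diff: "star (x - y) = star x - star (y::'a::cstar_algebra)"
  using star_add[of x "-y"] by (simp add: star_minus)

lemma star_scaleR: "star (r *\<^sub>R x) = r *\<^sub>R star (x::'a::cstar_algebra)"
  by (metis scaleC_of_real star_scaleC complex_cnj_complex_of_real)

lemma norm_star [simp]: "norm (star x) = norm (x::'a::cstar_algebra)"
proof -
  have le: "norm y \<le> norm (star y)" for y :: 'a
  proof (cases "y = 0")
    case False
    have "norm y * norm y = norm (star y * y)"
      by (simp add: cstar_identity power2_eq_square)
    also have "\<dots> \<le> norm (star y) * norm y"
      by (rule norm_mult_ineq)
    finally show ?thesis
      using False by simp
  qed simp
  show ?thesis
    using le[of x] le[of "star x"] by (simp add: star_star)
qed

lemma cstar_identity': "norm (x * star x) = (norm (x::'a::cstar_algebra))\<^sup>2"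
  using cstar_identity[of "star x"] by (simp add: star_star)

lemma bounded_linear_star: "bounded_linear (star :: 'a::cstar_algebra \<Rightarrow> 'a)"
  by (rule bounded_linear_intro[where K=1]) (auto simp: star_add star_scaleR)

lemma bounded_linear_scaleC: "bounded_linear (scaleC c :: 'a::cstar_algebra \<Rightarrow> 'a)"
  by (rule bounded_linear_intro[where K="cmod c"])
    (auto simp: scaleC_add_right scaleC_scaleR norm_scaleC)

section \<open>The unitization\<close>

datatype 'a unitization = Unitized (algebra_part: 'a) (scalar_part: complex)

definition left_action :: "'a::cstar_algebra unitization \<Rightarrow> 'a \<Rightarrow> 'a" where
  "left_action u = (\<lambda>x. algebra_part u * x + scaleC (scalar_part u) x)"

lemma bounded_linear_left_action: "bounded_linear (left_action u)"
  unfolding left_action_def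
  by (intro bounded_linear_add bounded_linear_mult_right bounded_linear_scaleC)

instantiation unitization :: (cstar_algebra) real_vector
begin
definition "0 = Unitized 0 0"
definition "u + v = Unitized (algebra_part u + algebra_part v) (scalar_part u + scalar_part v)"
definition "- u = Unitized (- algebra_part u) (- scalar_part u)"
definition "u - v = Unitized (algebra_part u - algebra_part v) (scalar_part u - scalar_part v)"
definition "scaleR r u = Unitized (r *\<^sub>R algebra_part u) (r *\<^sub>R scalar_part u)"
instance
  by standard
    (auto simp: zero_unitization_def plus_unitization_def uminus_unitization_def
      minus_unitization_def scaleR_unitization_def scaleR_add_right scaleR_add_left)
end

lemma unitization_parts [simp]:
  "algebra_part 0 = 0" "scalar_part 0 = 0"
  "algebra_part (u + v) = algebra_part u + algebra_part v"
  "scalar_part (u + v) = scalar_part u + scalar_part v"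
  "algebra_part (- u) = - algebra_part u" "scalar_part (- u) = - scalar_part u"
  "algebra_part (u - v) = algebra_part u - algebra_part v"
  "scalar_part (u - v) = scalar_part u - scalar_part v"
  "algebra_part (r *\<^sub>R u) = r *\<^sub>R algebra_part u" "scalar_part (r *\<^sub>R u) = r *\<^sub>R scalar_part u"
  by (auto simp: zero_unitization_def plus_unitization_def uminus_unitization_def
      minus_unitization_def scaleR_unitization_def)

instantiation unitization :: (cstar_algebra) ring_1
begin
definition "1 = Unitized 0 1"
definition "u * v = Unitized
  (algebra_part u * algebra_part v + scaleC (scalar_part u) (algebra_part v)
     + scaleC (scalar_part v) (algebra_part u)) (scalar_part u * scalar_part v)"
instance
proof
  fix u v w :: "'a unitization"
  show "u * v * w = u * (v * w)"
    by (auto simp: times_unitization_def algebra_simps scaleC_add_right scaleC_scaleC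
        mult_scaleC_left mult_scaleC_right)
  show "1 * u = u" "u * 1 = u"
    by (auto simp: times_unitization_def one_unitization_def)
  show "(u + v) * w = u * w + v * w" "u * (v + w) = u * v + u * w"
    by (auto simp: times_unitization_def plus_unitization_def algebra_simps scaleC_add_right
        scaleC_add_left)
  show "(0::'a unitization) \<noteq> 1"
    by (simp add: zero_unitization_def one_unitization_def)
qed
end

lemma unitization_mult_parts [simp]:
  "algebra_part 1 = 0" "scalar_part 1 = 1"
  "algebra_part (u * v) = algebra_part u * algebra_part v
     + scaleC (scalar_part u) (algebra_part v) + scaleC (scalar_part v) (algebra_part u)"
  "scalar_part (u * v) = scalar_part u * scalar_part v"
  by (auto simp: one_unitization_def times_unitization_def)

lemma left_action_add: "left_action (u + v) = (\<lambda>x. left_action u x + left_action v x)"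
  by (simp add: left_action_def algebra_simps scaleC_add_left)

lemma left_action_scaleR: "left_action (r *\<^sub>R u) = (\<lambda>x. r *\<^sub>R left_action u x)"
  by (simp only: left_action_def unitization_parts scaleC_scaleR_left scaleR_add_right
      mult_scaleR_left)

lemma left_action_mult: "left_action (u * v) = (\<lambda>x. left_action u (left_action v x))"
  by (simp add: left_action_def algebra_simps scaleC_add_right scaleC_scaleC
      mult_scaleC_left mult_scaleC_right)

lemma algebra_part_eq_zeroI:
  assumes "\<And>x. a * x = 0"
  shows "a = (0::'a::cstar_algebra)"
  using cstar_identity'[of a] assms[of "star a"] by simp

text \<open>Multiplication by \<open>a\<^sup>*\<close> already attains the norm.\<close>

lemma le_onorm_left_mult: "norm a \<le> onorm (\<lambda>x. a * x)" for a :: "'a::cstar_algebra"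
proof (cases "a = 0")
  case False
  have "norm a * norm a = norm (a * star a)"
    by (simp add: cstar_identity' power2_eq_square)
  also have "\<dots> \<le> onorm (\<lambda>x. a * x) * norm (star a)"
    by (rule onorm[OF bounded_linear_mult_right])
  finally show ?thesis
    using False by simp
qed (simp add: onorm_pos_le)

lemma onorm_left_mult: "onorm (\<lambda>x. a * x) = norm a" for a :: "'a::cstar_algebra"
  by (rule antisym[OF onorm_bound le_onorm_left_mult]) (auto simp: norm_mult_ineq)

text \<open>The operator norm of left multiplication alone is not definite on \<open>A \<oplus> \<complex>\<close>: if \<open>A\<close> has a unit \<open>e\<close>, then
  \<open>(- e, 1)\<close> acts as zero. Taking the maximum with the norm of the scalar part, which is again a
  C*-seminorm, repairs this, and gives \<open>1\<close> norm one even when \<open>A\<close> is zero.\<close>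

instantiation unitization :: (cstar_algebra) real_normed_algebra_1
begin
definition "norm u = max (onorm (left_action u)) (cmod (scalar_part u))"
definition "dist u v = norm (u - v :: 'a unitization)"
definition "sgn u = u /\<^sub>R norm (u :: 'a unitization)"
definition
  "uniformity = (INF e\<in>{0<..}. principal {(u, v :: 'a unitization). dist u v < e})"
definition
  "open (X :: 'a unitization set) \<longleftrightarrow>
     (\<forall>u\<in>X. eventually (\<lambda>(u', v). u' = u \<longrightarrow> v \<in> X) uniformity)"
instance
proof
  fix u v :: "'a unitization" and r :: real and X :: "'a unitization set"
  show "dist u v = norm (u - v)"
    by (rule dist_unitization_def)
  show "sgn u = u /\<^sub>R norm u"
    by (rule sgn_unitization_def)
  show "uniformity = (INF e\<in>{0<..}. principal {(u, v :: 'a unitization). dist u v < e})"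
    by (rule uniformity_unitization_def)
  show "open X \<longleftrightarrow> (\<forall>u\<in>X. eventually (\<lambda>(u', v). u' = u \<longrightarrow> v \<in> X) uniformity)"
    by (rule open_unitization_def)
  show "norm u = 0 \<longleftrightarrow> u = 0"
  proof
    assume "norm u = 0"
    then have s: "scalar_part u = 0" and o: "onorm (left_action u) = 0"
      using onorm_pos_le[OF bounded_linear_left_action, of u]
      by (auto simp: norm_unitization_def max_def split: if_splits)
    have "left_action u x = 0" for x
      using o onorm_eq_0[OF bounded_linear_left_action, of u] by blast
    then have "algebra_part u * x = 0" for x
      using s by (simp add: left_action_def)
    then have "algebra_part u = 0"
      by (rule algebra_part_eq_zeroI)
    with s show "u = 0"
      by (simp add: zero_unitization_def unitization.expand)
  next
    show "norm u = 0" if "u = 0"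
      using that by (simp add: norm_unitization_def left_action_def onorm_zero)
  qed
  show "norm (u + v) \<le> norm u + norm v"
  proof -
    have "onorm (left_action (u + v)) \<le> onorm (left_action u) + onorm (left_action v)"
      unfolding left_action_add
      by (intro onorm_triangle bounded_linear_left_action)
    then show ?thesis
      using norm_triangle_ineq[of "scalar_part u" "scalar_part v"]
      unfolding norm_unitization_def unitization_parts by linarith
  qed
  show "norm (r *\<^sub>R u) = \<bar>r\<bar> * norm u"
    unfolding norm_unitization_def left_action_scaleR
      onorm_scaleR[OF bounded_linear_left_action]
    by (simp add: max_mult_distrib_left)
  show "norm (u * v) \<le> norm u * norm v"
  proof -
    have "onorm (left_action (u * v)) \<le> onorm (left_action u) * onorm (left_action v)"
      using onorm_compose[OF bounded_linear_left_action bounded_linear_left_action]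
      by (simp add: left_action_mult comp_def)
    also have "\<dots> \<le> norm u * norm v"
      unfolding norm_unitization_def
      by (intro mult_mono onorm_pos_le bounded_linear_left_action) (auto simp: le_max_iff_disj)
    moreover have "cmod (scalar_part (u * v)) \<le> norm u * norm v"
      unfolding norm_unitization_def
      by (auto simp: norm_mult le_max_iff_disj intro!: mult_mono)
    ultimately show ?thesis
      by (simp add: norm_unitization_def)
  qed
  show "norm (1::'a unitization) = 1"
  proof -
    have "onorm (left_action (1::'a unitization)) \<le> 1"
      by (rule onorm_bound) (auto simp: left_action_def)
    then show ?thesis
      by (simp add: norm_unitization_def)
  qed
  show "r *\<^sub>R u * v = r *\<^sub>R (u * v)" "u * r *\<^sub>R v = r *\<^sub>R (u * v)"
    by (auto intro!: unitization.expand
        simp: algebra_simps scaleC_scaleR scaleC_scaleR_left simp flip: scaleR_conv_of_real)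
qed
end

definition embed :: "'a::cstar_algebra \<Rightarrow> 'a unitization" where
  "embed a = Unitized a 0"

lemma embed_parts [simp]: "algebra_part (embed a) = a" "scalar_part (embed a) = 0"
  by (auto simp: embed_def)

lemma norm_embed [simp]: "norm (embed a) = norm a"
  by (simp add: norm_unitization_def left_action_def onorm_left_mult)

lemma embed_simps:
  "embed 0 = 0" "embed (a + b) = embed a + embed b" "embed (a - b) = embed a - embed b"
  "embed (- a) = - embed a" "embed (r *\<^sub>R a) = r *\<^sub>R embed a" "embed (a * b) = embed a * embed b"
  by (auto intro!: unitization.expand)

lemma norm_scalar_part_le: "cmod (scalar_part u) \<le> norm u"
  by (simp add: norm_unitization_def)

lemma unitization_decompose: "u = embed (algebra_part u) + Unitized 0 (scalar_part u)"
  by (auto intro!: unitization.expand)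

lemma norm_scalar_unitized [simp]: "norm (Unitized (0::'a::cstar_algebra) c) = cmod c"
proof -
  have "onorm (left_action (Unitized (0::'a) c)) \<le> cmod c"
    by (rule onorm_bound) (auto simp: left_action_def norm_scaleC)
  then show ?thesis
    by (simp add: norm_unitization_def)
qed

lemma norm_algebra_part_le: "norm (algebra_part u) \<le> norm u * 2"
proof -
  have "embed (algebra_part u) = u - Unitized 0 (scalar_part u)"
    by (auto intro!: unitization.expand)
  then have "norm (algebra_part u) = norm (u - Unitized 0 (scalar_part u))"
    by (metis norm_embed)
  also have "\<dots> \<le> norm u + cmod (scalar_part u)"
    using norm_triangle_ineq4[of u "Unitized 0 (scalar_part u)"] by simp
  finally show ?thesis
    using norm_scalar_part_le[of u] by simp
qed

lemma norm_unitization_le: "norm u \<le> norm (algebra_part u) + cmod (scalar_part u)"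
  using norm_triangle_ineq[of "embed (algebra_part u)" "Unitized 0 (scalar_part u)"]
  using unitization_decompose[of u] by simp

lemma bounded_linear_algebra_part: "bounded_linear algebra_part"
  by (rule bounded_linear_intro[where K=2]) (auto simp: norm_algebra_part_le)

lemma bounded_linear_scalar_part: "bounded_linear scalar_part"
  by (rule bounded_linear_intro[where K=1]) (auto simp: norm_scalar_part_le)

instance unitization :: (cstar_algebra) banach
proof
  fix X :: "nat \<Rightarrow> 'a unitization"
  assume C: "Cauchy X"
  obtain a where a: "(\<lambda>n. algebra_part (X n)) \<longlonglongrightarrow> a"
    using bounded_linear.Cauchy[OF bounded_linear_algebra_part C] Cauchy_convergent convergent_def by blast
  obtain s where s: "(\<lambda>n. scalar_part (X n)) \<longlonglongrightarrow> s"
    using bounded_linear.Cauchy[OF bounded_linear_scalar_part C] Cauchy_convergent convergent_def by blast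
  have "(\<lambda>n. norm (algebra_part (X n) - a) + cmod (scalar_part (X n) - s)) \<longlonglongrightarrow> 0"
    using tendsto_add[OF tendsto_norm[OF LIM_zero[OF a]] tendsto_norm[OF LIM_zero[OF s]]] by simp
  then have "(\<lambda>n. X n - Unitized a s) \<longlonglongrightarrow> 0"
    by (rule Lim_null_comparison[rotated])
      (use norm_unitization_le[of "X _ - Unitized a s"] in \<open>auto intro!: always_eventually\<close>)
  then show "convergent X"
    using LIM_zero_cancel convergent_def by blast
qed

instantiation unitization :: (cstar_algebra) cstar_algebra
begin
definition "scaleC c u = Unitized (scaleC c (algebra_part u)) (c * scalar_part u)"
definition "star u = Unitized (star (algebra_part u)) (cnj (scalar_part u))"
instance
proof
  fix u v :: "'a unitization" and c d :: complex and r :: real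
  note defs = scaleC_unitization_def star_unitization_def
  note [intro!] = unitization.expand
  show "scaleC c (u + v) = scaleC c u + scaleC c v"
    by (auto simp: defs scaleC_add_right algebra_simps)
  show "scaleC (c + d) u = scaleC c u + scaleC d u"
    by (auto simp: defs scaleC_add_left algebra_simps)
  show "scaleC c (scaleC d u) = scaleC (c * d) u"
    by (auto simp: defs scaleC_scaleC)
  show "scaleC (complex_of_real r) u = r *\<^sub>R u"
    by (auto simp: defs scaleC_of_real scaleR_conv_of_real[where 'a=complex])
  show "norm (scaleC c u) = cmod c * norm u"
  proof -
    have act: "left_action (scaleC c u) x = scaleC c (left_action u x)" for x
      by (simp add: left_action_def defs scaleC_add_right scaleC_scaleC mult_scaleC_left)
    have "onorm (left_action (scaleC c u)) = onorm (\<lambda>x. cmod c *\<^sub>R left_action u x)"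
      by (simp add: onorm_def act norm_scaleC)
    also have "\<dots> = cmod c * onorm (left_action u)"
      by (simp add: onorm_scaleR[OF bounded_linear_left_action])
    finally show ?thesis
      by (simp add: norm_unitization_def max_mult_distrib_left norm_mult)
        (simp add: defs norm_mult)
  qed
  show "scaleC c u * v = scaleC c (u * v)" "u * scaleC c v = scaleC c (u * v)"
    by (auto simp: defs scaleC_add_right scaleC_scaleC mult_scaleC_left mult_scaleC_right
        algebra_simps)
  show "star (star u) = u" "star (u + v) = star u + star v"
    "star (scaleC c u) = scaleC (cnj c) (star u)" "star (u * v) = star v * star u"
    by (auto simp: defs star_star star_add star_scaleC star_mult algebra_simps)
  show "norm (star u * u) = (norm u)\<^sup>2"
  proof -
    \<comment> \<open>Because \<open>(w x)\<^sup>* (w x) = x\<^sup>* (w\<^sup>* w x)\<close>, the C*-identity of the algebra bounds \<open>w x\<close> by \<open>w\<^sup>* w\<close>.\<close>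
    have sq: "(onorm (left_action w))\<^sup>2 \<le> onorm (left_action (star w * w))" for w :: "'a unitization"
    proof -
      let ?o = "onorm (left_action (star w * w))"
      have "norm (left_action w x) \<le> sqrt ?o * norm x" for x
      proof -
        have "star (left_action w x) * left_action w x
            = star x * left_action (star w * w) x"
          by (simp add: left_action_def defs algebra_simps star_add star_mult star_scaleC
              scaleC_add_right scaleC_scaleC mult_scaleC_left mult_scaleC_right)
        then have "(norm (left_action w x))\<^sup>2 = norm (star x * left_action (star w * w) x)"
          by (simp flip: cstar_identity)
        also have "\<dots> \<le> norm (star x) * norm (left_action (star w * w) x)"
          by (rule norm_mult_ineq)
        also have "\<dots> \<le> norm x * (?o * norm x)"
          using onorm[OF bounded_linear_left_action, of "star w * w" x]
          by (simp add: mult_left_mono)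
        finally have "(norm (left_action w x))\<^sup>2 \<le> ?o * (norm x)\<^sup>2"
          by (simp add: power2_eq_square mult_ac)
        then have "norm (left_action w x) \<le> sqrt (?o * (norm x)\<^sup>2)"
          by (rule real_le_rsqrt)
        then show ?thesis
          by (simp add: real_sqrt_mult)
      qed
      then have "onorm (left_action w) \<le> sqrt ?o"
        by (intro onorm_bound) (auto intro: onorm_pos_le bounded_linear_left_action)
      then show ?thesis
        using power_mono[OF _ onorm_pos_le[OF bounded_linear_left_action], of w "sqrt ?o" 2]
        by (simp add: onorm_pos_le[OF bounded_linear_left_action])
    qed
    have mul: "onorm (left_action (star w * w)) \<le> onorm (left_action (star w)) * onorm (left_action w)"
      for w :: "'a unitization"
      using onorm_compose[OF bounded_linear_left_action bounded_linear_left_action]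
      by (simp add: left_action_mult comp_def)
    have ss: "star (star w) = w" for w :: "'a unitization"
      by (auto simp: defs star_star)
    have le: "onorm (left_action w) \<le> onorm (left_action (star w))" for w :: "'a unitization"
    proof (cases "onorm (left_action w) = 0")
      case False
      then have "onorm (left_action w) > 0"
        using onorm_pos_le[OF bounded_linear_left_action, of w] by linarith
      then show ?thesis
        using order_trans[OF sq mul, of w] by (simp add: power2_eq_square)
    qed (simp add: onorm_pos_le[OF bounded_linear_left_action])
    have "onorm (left_action (star u)) = onorm (left_action u)"
      using le[of u] le[of "star u"] by (simp add: ss)
    then have "onorm (left_action (star u * u)) = (onorm (left_action u))\<^sup>2"
      using sq[of u] mul[of u] by (simp add: power2_eq_square)
    moreover have "cmod (scalar_part (star u * u)) = (cmod (scalar_part u))\<^sup>2"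
      by (simp add: defs norm_mult power2_eq_square)
    moreover have "max (p\<^sup>2) (q\<^sup>2) = (max p q)\<^sup>2" if "0 \<le> p" "0 \<le> q" for p q :: real
      using that by (auto simp: max_def power_mono dest: power2_le_imp_le)
    ultimately show ?thesis
      by (simp add: norm_unitization_def onorm_pos_le[OF bounded_linear_left_action])
  qed
qed
end

lemma embed_star: "embed (star a) = star (embed a)"
  by (auto intro!: unitization.expand simp: star_unitization_def)

section \<open>Positive elements\<close>

text \<open>For self-adjoint \<open>b\<close> the bound says that the spectrum lies in \<open>[0, 2 t]\<close>. In this form positivity is
  visibly stable under sums and needs no spectral theory.\<close>

definition pos :: "'u::{cstar_algebra, real_normed_algebra_1} \<Rightarrow> bool" where
  "pos b \<longleftrightarrow> star b = b \<and> (\<exists>t. norm (of_real t - b) \<le> t)"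

lemma star_one [simp]: "star (1 :: 'u::{cstar_algebra, real_normed_algebra_1}) = 1"
  by (metis mult_1_left mult_1_right star_mult star_star)

lemma star_of_real [simp]: "star (of_real t :: 'u::{cstar_algebra, real_normed_algebra_1}) = of_real t"
  by (simp add: of_real_def star_scaleR)

lemma posI: "star b = b \<Longrightarrow> norm (of_real t - b) \<le> t \<Longrightarrow> pos b"
  by (auto simp: pos_def)

lemma pos_star: "pos b \<Longrightarrow> star b = b"
  by (simp add: pos_def)

lemma pos_of_real: "0 \<le> t \<Longrightarrow> pos (of_real t)"
  by (rule posI[where t=t]) auto

lemma pos_zero [simp]: "pos 0"
  using pos_of_real[of 0] by simp

lemma pos_add:
  assumes "pos a" "pos b"
  shows "pos (a + b)"
proof -
  obtain s t where "norm (of_real s - a) \<le> s" "norm (of_real t - b) \<le> t"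
    using assms by (auto simp: pos_def)
  then have "norm (of_real (s + t) - (a + b)) \<le> s + t"
    using norm_triangle_ineq[of "of_real s - a" "of_real t - b"]
    by (simp add: algebra_simps)
  then show ?thesis
    using assms by (intro posI[where t="s + t"]) (auto simp: star_add pos_star)
qed

lemma pos_scaleR:
  assumes "pos b" "0 \<le> r"
  shows "pos (r *\<^sub>R b)"
proof -
  obtain t where "norm (of_real t - b) \<le> t"
    using assms by (auto simp: pos_def)
  then have "r * norm (of_real t - b) \<le> r * t"
    using assms(2) by (rule mult_left_mono)
  moreover have "of_real (r * t) - r *\<^sub>R b = r *\<^sub>R (of_real t - b)"
    by (simp add: of_real_def scaleR_diff_right)
  ultimately have "norm (of_real (r * t) - r *\<^sub>R b) \<le> r * t"
    using assms(2) by (metis abs_of_nonneg norm_scaleR)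
  then show ?thesis
    using assms by (intro posI[where t="r * t"]) (auto simp: star_scaleR pos_star)
qed

lemma pos_norm_minus: "star b = b \<Longrightarrow> norm b \<le> t \<Longrightarrow> pos (of_real t - b)"
  by (rule posI[where t=t]) (auto simp: star_diff)

text \<open>The element \<open>y = 1 - \<surd>(1 - x)\<close> is the fixed point of \<open>y \<mapsto> (x + y\<^sup>2) / 2\<close>. Started at \<open>0\<close>, the
  iteration has increments bounded in norm by those of the scalar iteration for \<open>x = 1\<close>, which is
  increasing and bounded by \<open>1\<close>; so it converges even when \<open>x\<close> has norm exactly one.\<close>

lemma exists_sqrt_one_minus:
  fixes x :: "'u::{cstar_algebra, real_normed_algebra_1}"
  assumes sa: "star x = x" and nx: "norm x \<le> 1"
  shows "\<exists>y. star y = y \<and> norm y \<le> 1 \<and> (1 - y) * (1 - y) = 1 - x \<and>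
    (\<forall>z. z * x = x * z \<longrightarrow> z * y = y * z)"
proof -
  define Y where "Y = rec_nat 0 (\<lambda>n y. (1/2) *\<^sub>R (x + y * y))"
  define T where "T = rec_nat (0::real) (\<lambda>n t. (1 + t * t) / 2)"
  have Y0: "Y 0 = 0" and YS: "Y (Suc n) = (1/2) *\<^sub>R (x + Y n * Y n)" for n
    by (simp_all add: Y_def)
  have T0: "T 0 = 0" and TS: "T (Suc n) = (1 + T n * T n) / 2" for n
    by (simp_all add: T_def)
  have T01: "0 \<le> T n \<and> T n \<le> 1" for n
  proof (induction n)
    case (Suc n)
    then show ?case
      using mult_le_one[of "T n" "T n"] by (simp add: TS)
  qed (simp add: T0)
  have Yn: "norm (Y n) \<le> T n" for n
  proof (induction n)
    case (Suc n)
    have "norm (Y n * Y n) \<le> T n * T n"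
      using norm_mult_ineq[of "Y n" "Y n"] mult_mono[OF Suc Suc] T01[of n] by simp
    then show ?case
      using norm_triangle_ineq[of x "Y n * Y n"] nx by (simp add: YS TS)
  qed (simp add: Y0 T0)
  have step: "norm (Y (Suc n) - Y n) \<le> T (Suc n) - T n" for n
  proof (induction n)
    case 0
    then show ?case
      using nx by (simp add: YS TS Y0 T0)
  next
    case (Suc n)
    let ?d = "Y (Suc n) - Y n"
    have "Y (Suc (Suc n)) - Y (Suc n)
        = (1/2) *\<^sub>R (x + Y (Suc n) * Y (Suc n)) - (1/2) *\<^sub>R (x + Y n * Y n)"
      by (rule arg_cong2[where f=minus, OF YS YS])
    also have "\<dots> = (1/2) *\<^sub>R (Y (Suc n) * ?d + ?d * Y n)"
      by (simp add: algebra_simps)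
    finally have eq: "Y (Suc (Suc n)) - Y (Suc n) = (1/2) *\<^sub>R (Y (Suc n) * ?d + ?d * Y n)" .
    have "norm (Y (Suc n) * ?d + ?d * Y n) \<le> norm (Y (Suc n)) * norm ?d + norm ?d * norm (Y n)"
      by (meson add_mono norm_mult_ineq norm_triangle_le)
    also have "\<dots> \<le> T (Suc n) * (T (Suc n) - T n) + (T (Suc n) - T n) * T n"
      using Yn T01 Suc order_trans[OF norm_ge_zero Suc] by (intro add_mono mult_mono) auto
    finally have le: "norm (Y (Suc n) * ?d + ?d * Y n)
        \<le> T (Suc n) * (T (Suc n) - T n) + (T (Suc n) - T n) * T n" .
    have "T (Suc (Suc n)) - T (Suc n) = (1 + T (Suc n) * T (Suc n)) / 2 - (1 + T n * T n) / 2"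
      by (rule arg_cong2[where f=minus, OF TS TS])
    also have "\<dots> = (1/2) * (T (Suc n) * (T (Suc n) - T n) + (T (Suc n) - T n) * T n)"
      by (simp add: field_simps)
    finally show ?case
      using le unfolding eq norm_scaleR by simp
  qed
  have "incseq T"
    by (rule incseq_SucI) (use order_trans[OF norm_ge_zero step] in simp)
  then obtain L where "T \<longlonglongrightarrow> L"
    using incseq_convergent[OF \<open>incseq T\<close>, of 1] T01 by blast
  have "summable (\<lambda>n. Y (Suc n) - Y n)"
  proof (rule summable_comparison_test)
    show "\<exists>N. \<forall>n\<ge>N. norm (Y (Suc n) - Y n) \<le> T (Suc n) - T n"
      using step by blast
    show "summable (\<lambda>n. T (Suc n) - T n)"
      using telescope_summable[OF \<open>T \<longlonglongrightarrow> L\<close>] .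
  qed
  then have "convergent (\<lambda>n. \<Sum>i<n. Y (Suc i) - Y i)"
    by (simp add: summable_iff_convergent)
  then obtain y where y: "Y \<longlonglongrightarrow> y"
    by (auto simp: sum_lessThan_telescope Y0 convergent_def)
  have "star (Y n) = Y n" for n
    by (induction n) (simp_all add: Y0 YS star_add star_scaleR star_mult sa)
  then have "star y = y"
    using bounded_linear.tendsto[OF bounded_linear_star y] y LIMSEQ_unique by simp
  moreover have "norm y \<le> 1"
    using tendsto_norm[OF y] Yn T01 by (meson LIMSEQ_le_const2 order_trans)
  moreover have "(1 - y) * (1 - y) = 1 - x"
  proof -
    have "(\<lambda>n. Y (Suc n)) \<longlonglongrightarrow> (1/2) *\<^sub>R (x + y * y)"
      unfolding YS by (intro tendsto_intros y)
    then have "y = (1/2) *\<^sub>R (x + y * y)"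
      using LIMSEQ_unique LIMSEQ_Suc[OF y] by blast
    then have "2 *\<^sub>R y = x + y * y"
      by (metis scaleR_scaleR field_sum_of_halves mult_2 scaleR_one nonzero_mult_div_cancel_left
          zero_neq_numeral times_divide_eq_right mult.right_neutral)
    then show ?thesis
      by (simp add: algebra_simps scaleR_2)
  qed
  moreover have "z * y = y * z" if "z * x = x * z" for z
  proof -
    have "z * Y n = Y n * z" for n
    proof (induction n)
      case (Suc n)
      have "z * (Y n * Y n) = Y n * Y n * z"
        by (metis Suc mult.assoc)
      then show ?case
        by (simp add: YS distrib_left distrib_right that)
    qed (simp add: Y0)
    then have "(\<lambda>n. Y n * z) \<longlonglongrightarrow> z * y"
      using tendsto_mult[OF tendsto_const[of z] y] by simp
    then show ?thesis
      using tendsto_mult[OF y tendsto_const[of z]] LIMSEQ_unique by blast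
  qed
  ultimately show ?thesis
    by blast
qed

lemma pos_sqrt:
  fixes b :: "'u::{cstar_algebra, real_normed_algebra_1}"
  assumes "pos b"
  obtains s where "pos s" "s * s = b" "\<And>z. z * b = b * z \<Longrightarrow> z * s = s * z"
proof -
  obtain t0 where "norm (of_real t0 - b) \<le> t0"
    using assms by (auto simp: pos_def)
  define t where "t = t0 + 1"
  have "of_real t - b = (of_real t0 - b) + 1"
    by (simp add: t_def)
  then have "norm (of_real t - b) \<le> norm (of_real t0 - b) + 1"
    by (metis norm_one norm_triangle_ineq)
  then have nt: "norm (of_real t - b) \<le> t"
    using \<open>norm (of_real t0 - b) \<le> t0\<close> by (simp add: t_def)
  have t: "t > 0"
    using order_trans[OF norm_ge_zero \<open>norm (of_real t0 - b) \<le> t0\<close>] by (simp add: t_def)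
  define x where "x = (1/t) *\<^sub>R (of_real t - b)"
  have x: "star x = x" "norm x \<le> 1"
    using t nt assms by (auto simp: x_def star_scaleR star_diff pos_star)
  obtain y where y: "star y = y" "norm y \<le> 1" "(1 - y) * (1 - y) = 1 - x"
      and comm: "\<And>z. z * x = x * z \<Longrightarrow> z * y = y * z"
    using exists_sqrt_one_minus[OF x] by auto
  have bx: "b = t *\<^sub>R (1 - x)"
    using t by (simp add: x_def algebra_simps of_real_def)
  define s where "s = sqrt t *\<^sub>R (1 - y)"
  have "pos (1 - y)"
    using y by (intro posI[where t=1]) (auto simp: star_diff)
  then have "pos s"
    unfolding s_def using t by (intro pos_scaleR) auto
  moreover have "s * s = b"
    using t y(3) by (simp add: s_def bx)
  moreover have "z * s = s * z" if "z * b = b * z" for z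
  proof -
    have "z * x = x * z"
      using that by (simp add: x_def algebra_simps of_real_def)
    then have "z * y = y * z"
      by (rule comm)
    then show ?thesis
      by (simp add: s_def algebra_simps)
  qed
  ultimately show ?thesis
    using that by blast
qed

text \<open>With \<open>u = s + \<i> r\<close> the hypothesis reads \<open>u\<^sup>* u = M\<close>, and \<open>s\<close> is the real part of \<open>u\<close>.\<close>

lemma norm_le_of_sum_squares:
  fixes s r :: "'u::{cstar_algebra, real_normed_algebra_1}"
  assumes "star s = s" "star r = r" "s * r = r * s" and sum: "s * s + r * r = of_real M"
  shows "(norm s)\<^sup>2 \<le> \<bar>M\<bar>"
proof -
  define u where "u = s + scaleC \<i> r"
  have su: "star u = s - scaleC \<i> r"
    using assms by (simp add: u_def star_add star_scaleC scaleC_minus_left)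
  have "star u * u = s * s + r * r"
    unfolding su unfolding u_def using assms(3)
    by (simp add: algebra_simps mult_scaleC_left mult_scaleC_right scaleC_scaleC scaleC_minus_left
        scaleC_diff_right)
  then have "(norm u)\<^sup>2 = \<bar>M\<bar>"
    using cstar_identity[of u] sum by simp
  moreover have "u + star u = 2 *\<^sub>R s"
    unfolding su unfolding u_def by (simp add: scaleR_2)
  then have "s = (1/2) *\<^sub>R (u + star u)"
    by simp
  then have "norm s \<le> norm u"
    using norm_triangle_ineq[of u "star u"] by simp
  ultimately show ?thesis
    by (metis norm_ge_zero power_mono)
qed

lemma norm_self_square: "star s = s \<Longrightarrow> norm (s * s) = (norm (s::'a::cstar_algebra))\<^sup>2"
  using cstar_identity[of s] by simp

text \<open>If \<open>v\<close> is self-adjoint of norm at most one, then \<open>1 - v\<^sup>2\<close> has a square root \<open>1 - y\<close>, and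
  \<open>v\<close>, \<open>1 - y\<close> are the imaginary and real part of a unitary. So \<open>1 - y\<close> has norm at most one, whence
  the norm of \<open>1 - v\<^sup>2 = (1 - y)\<^sup>2\<close> is at most one.\<close>

lemma pos_square:
  fixes s :: "'u::{cstar_algebra, real_normed_algebra_1}"
  assumes sa: "star s = s"
  shows "pos (s * s)"
proof -
  define e where "e = 1 / (1 + norm s)"
  have e: "e > 0" and "e * norm s \<le> 1"
    by (auto simp: e_def add_nonneg_pos add_pos_nonneg field_simps)
  define v where "v = e *\<^sub>R s"
  have v: "star v = v" "norm v \<le> 1"
    using e \<open>e * norm s \<le> 1\<close> sa by (auto simp: v_def star_scaleR)
  have nv: "norm (v * v) \<le> 1"
    using v by (simp add: norm_self_square power_le_one)
  obtain y where y: "star y = y" "norm y \<le> 1" "(1 - y) * (1 - y) = 1 - v * v"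
      "\<And>z. z * (v * v) = (v * v) * z \<Longrightarrow> z * y = y * z"
    using exists_sqrt_one_minus[of "v * v"] nv v by (auto simp: star_mult)
  have "v * y = y * v"
    by (rule y(4)) (simp add: mult.assoc)
  then have "(norm (1 - y))\<^sup>2 \<le> \<bar>1\<bar>"
    using v y by (intro norm_le_of_sum_squares[where r=v]) (auto simp: star_diff algebra_simps)
  then have "norm (1 - v * v) \<le> 1"
    using y(1) norm_self_square[of "1 - y"] by (simp add: star_diff flip: y(3))
  then have "pos (v * v)"
    using v by (intro posI[where t=1]) (auto simp: star_mult)
  then have "pos ((1 / e\<^sup>2) *\<^sub>R (v * v))"
    by (rule pos_scaleR) simp
  then show ?thesis
    using e by (simp add: v_def power2_eq_square)
qed

lemma pos_mult:
  assumes "pos a" "pos b" "a * b = b * a"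
  shows "pos (a * b)"
proof -
  obtain s where s: "pos s" "s * s = a" "\<And>z. z * a = a * z \<Longrightarrow> z * s = s * z"
    using pos_sqrt[OF assms(1)] by blast
  obtain r where r: "pos r" "r * r = b" "\<And>z. z * b = b * z \<Longrightarrow> z * r = r * z"
    using pos_sqrt[OF assms(2)] by blast
  have "b * s = s * b"
    using assms(3) by (intro s(3)) simp
  then have sr: "s * r = r * s"
    by (intro r(3)) simp
  then have "(s * r) * (s * r) = a * b"
    by (metis mult.assoc r(2) s(2))
  moreover have "star (s * r) = s * r"
    by (simp add: star_mult pos_star r(1) s(1) sr)
  ultimately show ?thesis
    by (metis pos_square)
qed

text \<open>Write \<open>p = s\<^sup>2\<close> and \<open>M - p = r\<^sup>2\<close> with commuting \<open>s\<close> and \<open>r\<close>.\<close>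

lemma norm_le_of_pos:
  assumes "pos p" "pos (of_real M - p)" "0 \<le> M"
  shows "norm p \<le> M"
proof -
  obtain s where s: "pos s" "s * s = p" "\<And>z. z * p = p * z \<Longrightarrow> z * s = s * z"
    using pos_sqrt[OF assms(1)] by blast
  obtain r where r: "pos r" "r * r = of_real M - p"
      "\<And>z. z * (of_real M - p) = (of_real M - p) * z \<Longrightarrow> z * r = r * z"
    using pos_sqrt[OF assms(2)] by blast
  have "s * (of_real M - p) = (of_real M - p) * s"
    by (simp add: algebra_simps of_real_def flip: s(2))
  then have "s * r = r * s"
    by (rule r(3))
  then have "(norm s)\<^sup>2 \<le> \<bar>M\<bar>"
    by (intro norm_le_of_sum_squares[where r=r]) (use s(1,2) r(1,2) in \<open>auto simp: pos_star\<close>)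
  then show ?thesis
    using assms(3) s(1) by (simp add: norm_self_square pos_star flip: s(2))
qed

lemma norm_le_mono:
  assumes "pos p" "pos (q - p)"
  shows "norm p \<le> norm q"
proof (rule norm_le_of_pos)
  have "star q = q"
    using pos_star[OF pos_add[OF assms]] by simp
  then have "pos (of_real (norm q) - q)"
    by (rule pos_norm_minus) simp
  from pos_add[OF this assms(2)] show "pos (of_real (norm q) - p)"
    by simp
qed (use assms in auto)

lemma abs_decomposition:
  fixes b :: "'u::{cstar_algebra, real_normed_algebra_1}"
  assumes "star b = b"
  obtains m where "pos m" "m * m = b * b" "\<And>z. z * b = b * z \<Longrightarrow> z * m = m * z"
proof -
  obtain m where m: "pos m" "m * m = b * b" "\<And>z. z * (b * b) = (b * b) * z \<Longrightarrow> z * m = m * z"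
    using pos_sqrt[OF pos_square[OF assms]] by blast
  have "z * m = m * z" if "z * b = b * z" for z
    by (rule m(3)) (metis that mult.assoc)
  then show ?thesis
    using m that by blast
qed

lemma norm_power_le: "norm x \<le> 1 \<Longrightarrow> norm (x ^ n) \<le> (1::real)"
  for x :: "'u::real_normed_algebra_1"
  by (metis norm_ge_zero norm_power_ineq order_trans power_le_one)

lemma pos_power_bernoulli:
  assumes w: "pos w"
  shows "pos ((1 + w) ^ n - 1 - of_nat n * w)"
proof (induction n)
  case (Suc n)
  let ?p = "(1 + w) ^ n - 1 - of_nat n * w"
  have c: "w * of_nat n = of_nat n * w"
    by (simp add: mult_of_nat_commute)
  have c2: "w * (1 + w) ^ n = (1 + w) ^ n * w"
    by (rule power_commuting_commutes[symmetric]) (simp add: algebra_simps)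
  have "?p * w = w * ?p"
    by (simp add: algebra_simps c c2) (metis c mult.assoc)
  then have "pos (?p + ?p * w + of_nat n *\<^sub>R (w * w))"
    by (intro pos_add pos_mult pos_scaleR Suc w pos_square pos_star) auto
  moreover have "?p + ?p * w + of_nat n *\<^sub>R (w * w) = (1 + w) ^ Suc n - 1 - of_nat (Suc n) * w"
    unfolding power_Suc2
    by (simp add: algebra_simps scaleR_conv_of_real)
  ultimately show ?case
    by simp
qed simp

text \<open>Both \<open>w = y y\<^sup>*\<close> and \<open>- y\<^sup>* y\<close> are positive: the sum \<open>y\<^sup>* y + y y\<^sup>*\<close> is a sum of squares of
  self-adjoint elements. As \<open>y\<^sup>* y\<close> and \<open>y y\<^sup>*\<close> have the same nonzero spectrum, they should vanish.
  In place of the spectrum, use \<open>w (1 + w)\<^sup>n = y (1 + y\<^sup>* y)\<^sup>n y\<^sup>*\<close>. The right-hand side is bounded in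
  \<open>n\<close> because \<open>1 + y\<^sup>* y = 1 - c\<^sup>2\<close> is a contraction, while the left-hand side dominates \<open>n w\<^sup>2\<close>.\<close>

lemma negative_star_square_eq_zero:
  fixes y c :: "'u::{cstar_algebra, real_normed_algebra_1}"
  assumes c: "star c = c" and y: "star y * y = - (c * c)" and nc: "norm c \<le> 1"
  shows "y = 0"
proof -
  define w where "w = y * star y"
  have "pos w"
  proof -
    \<comment> \<open>twice the real part of \<open>y\<close> and, up to sign, twice its imaginary part\<close>
    define h where "h = y + star y"
    define k where "k = scaleC \<i> (y - star y)"
    have "star h = h" "star k = k"
      by (auto simp: h_def k_def star_add star_star star_scaleC star_diff scaleC_minus_left
          scaleC_diff_right)
    moreover have "k * k = - ((y - star y) * (y - star y))"
      by (simp add: k_def mult_scaleC_left mult_scaleC_right scaleC_scaleC scaleC_minus_left)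
    then have "h * h + k * k = 2 *\<^sub>R (w + star y * y)"
      by (simp add: h_def w_def algebra_simps scaleR_2)
    then have "(1/2) *\<^sub>R (h * h + k * k) = w - c * c"
      by (simp add: y)
    then have "w = (1/2) *\<^sub>R (h * h) + (1/2) *\<^sub>R (k * k) + c * c"
      by (simp add: scaleR_add_right)
    ultimately show ?thesis
      using c by (auto intro!: pos_add pos_scaleR pos_square)
  qed
  have pw: "w * (1 + w) ^ n = y * (1 + star y * y) ^ n * star y" for n
  proof (induction n)
    case (Suc n)
    have "w * (1 + w) ^ Suc n = y * (1 + star y * y) ^ n * star y * (1 + w)"
      by (simp only: power_Suc2 mult.assoc[symmetric] Suc)
    also have "star y * (1 + w) = (1 + star y * y) * star y"
      by (simp add: w_def algebra_simps)
    then have "y * (1 + star y * y) ^ n * star y * (1 + w) = y * (1 + star y * y) ^ Suc n * star y"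
      by (simp only: power_Suc2 mult.assoc)
    finally show ?case .
  qed (simp add: w_def)
  have "norm (1 - c * c) \<le> 1"
  proof (rule norm_le_of_pos)
    have "norm (c * c) \<le> 1"
      using c nc by (simp add: norm_self_square power_le_one)
    then show "pos (1 - c * c)"
      using pos_norm_minus[of "c * c" 1] c by (simp add: star_mult)
    show "pos (of_real 1 - (1 - c * c))"
      using pos_square[OF c] by simp
  qed simp
  then have bound: "norm (w * (1 + w) ^ n) \<le> (norm y)\<^sup>2" for n
  proof -
    have "norm (w * (1 + w) ^ n) \<le> norm y * norm ((1 - c * c) ^ n) * norm (star y)"
      unfolding pw y
      by (rule order_trans[OF norm_mult_ineq mult_right_mono[OF _ norm_ge_zero]])
        (simp add: norm_mult_ineq)
    also have "\<dots> \<le> norm y * 1 * norm (star y)"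
      using norm_power_le[OF \<open>norm (1 - c * c) \<le> 1\<close>] by (intro mult_right_mono mult_left_mono) auto
    finally show ?thesis
      by (simp add: power2_eq_square)
  qed
  have "real n * norm (w * w) \<le> (norm y)\<^sup>2" for n
  proof -
    have cw: "of_nat n * (w * w) = w * (of_nat n * w)"
      by (metis mult_of_nat_commute mult.assoc)
    have c2: "w * (1 + w) ^ n = (1 + w) ^ n * w"
      by (rule power_commuting_commutes[symmetric]) (simp add: algebra_simps)
    have "pos (w * ((1 + w) ^ n - 1 - of_nat n * w) + w)"
      using \<open>pos w\<close> by (intro pos_add pos_mult pos_power_bernoulli)
        (auto simp: algebra_simps c2 cw)
    then have "pos (w * (1 + w) ^ n - real n *\<^sub>R (w * w))"
      by (simp add: algebra_simps scaleR_conv_of_real cw)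
    moreover have "pos (real n *\<^sub>R (w * w))"
      by (intro pos_scaleR pos_square pos_star \<open>pos w\<close>) auto
    ultimately have "norm (real n *\<^sub>R (w * w)) \<le> norm (w * (1 + w) ^ n)"
      by (rule norm_le_mono[rotated])
    then show ?thesis
      using bound[of n] by simp
  qed
  then have "norm (w * w) \<le> 0"
    by (metis ex_less_of_nat_mult leD not_le_imp_less)
  then have "w = 0"
    using norm_self_square[OF pos_star[OF \<open>pos w\<close>]] by simp
  then show "y = 0"
    using cstar_identity'[of y] by (simp add: w_def)
qed

text \<open>Kaplansky's argument. Let \<open>b = x\<^sup>* x\<close>, \<open>m = |b|\<close> and \<open>q = m - b\<close>, twice the negative part of \<open>b\<close>.
  Then \<open>y = x q\<close> satisfies \<open>y\<^sup>* y = q b q = - m q\<^sup>2\<close>, which is minus a square, so \<open>y\<close> vanishes, and with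
  it \<open>q\<close>.\<close>

theorem pos_star_mult_self:
  fixes x :: "'u::{cstar_algebra, real_normed_algebra_1}"
  shows "pos (star x * x)"
proof -
  define b where "b = star x * x"
  have sb: "star b = b"
    by (simp add: b_def star_mult star_star)
  obtain m where m: "pos m" "m * m = b * b" "\<And>z. z * b = b * z \<Longrightarrow> z * m = m * z"
    using abs_decomposition[OF sb] by blast
  obtain r where r: "pos r" "r * r = m" "\<And>z. z * m = m * z \<Longrightarrow> z * r = r * z"
    using pos_sqrt[OF m(1)] by blast
  have bm: "b * m = m * b"
    by (rule m(3)) simp
  have br: "b * r = r * b"
    by (rule r(3)) (rule bm)
  define q where "q = m - b"
  have sq: "star q = q"
    using m(1) by (simp add: q_def star_diff sb pos_star)
  have bq: "b * q = - (m * q)"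
    by (simp add: q_def algebra_simps bm m(2))
  have rq: "r * q = q * r"
    using br by (simp add: q_def algebra_simps flip: r(2))
  \<comment> \<open>a scaling that makes \<open>c\<close> a contraction\<close>
  define e where "e = 1 / (1 + norm (r * q))"
  have e: "e > 0" and en: "e * norm (r * q) \<le> 1"
    by (auto simp: e_def add_pos_nonneg field_simps)
  define c where "c = e *\<^sub>R (r * q)"
  define y where "y = e *\<^sub>R (x * q)"
  have sc: "star c = c"
    using r(1) by (simp add: c_def star_scaleR star_mult pos_star sq rq)
  have "star y * y = (e * e) *\<^sub>R (q * (b * q))"
    by (simp add: y_def star_scaleR star_mult sq b_def mult.assoc)
  also have "q * (b * q) = - (r * q * (r * q))"
    unfolding bq by (metis mult.assoc mult_minus_right r(2) rq)
  finally have "star y * y = - (c * c)"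
    by (simp add: c_def)
  moreover have "norm c \<le> 1"
    using e en by (simp add: c_def)
  ultimately have "y = 0"
    using negative_star_square_eq_zero[OF sc] by blast
  with \<open>star y * y = - (c * c)\<close> have "c * c = 0"
    by simp
  then have "r * q = 0"
    using norm_self_square[OF sc] e by (simp add: c_def)
  then have "m * q = 0"
    by (metis mult.assoc mult_zero_right r(2))
  then have "q * q = 0"
    using bq by (simp add: q_def algebra_simps)
  then have "q = 0"
    using norm_self_square[OF sq] by simp
  then show ?thesis
    using m(1) by (simp add: q_def b_def)
qed

lemma pos_star_conj:
  assumes "pos c"
  shows "pos (star x * c * x)"
proof -
  obtain s where "pos s" "s * s = c"
    using pos_sqrt[OF assms] by blast
  then have "star x * c * x = star (s * x) * (s * x)"
    by (metis mult.assoc pos_star star_mult)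
  then show ?thesis
    by (simp add: pos_star_mult_self)
qed

section \<open>Closed ideals\<close>

lemma closed_ideal_simps:
  assumes "closed_ideal L"
  shows "0 \<in> L" "x \<in> L \<Longrightarrow> y \<in> L \<Longrightarrow> x + y \<in> L" "x \<in> L \<Longrightarrow> scaleC c x \<in> L"
    "x \<in> L \<Longrightarrow> a * x \<in> L" "x \<in> L \<Longrightarrow> x * a \<in> L" "closed L"
  using assms by (auto simp: closed_ideal_def)

lemma closed_ideal_scaleR: "closed_ideal L \<Longrightarrow> x \<in> L \<Longrightarrow> r *\<^sub>R x \<in> L"
  by (metis closed_ideal_simps(3) scaleC_of_real)

lemma closed_ideal_uminus: "closed_ideal L \<Longrightarrow> x \<in> L \<Longrightarrow> - x \<in> L"
  using closed_ideal_scaleR[of L x "-1"] by simp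

lemma pos_one [simp]: "pos 1"
  using pos_of_real[of 1] by simp

lemma pos_power:
  assumes "pos b"
  shows "pos (b ^ n)"
proof (induction n)
  case (Suc n)
  then show ?case
    using assms pos_mult[of b "b ^ n"] by (simp add: power_commutes)
qed simp

text \<open>The function \<open>s (1 - s)\<^sup>N\<close> is at most \<open>1 / (N + 1)\<close> on \<open>[0, 1]\<close>; the elements \<open>1 - (1 - k)\<^sup>N\<close> will
  play the role of an approximate unit. The difference \<open>1 - (1 - s)\<^bsup>N+1\<^esup> - (N + 1) s (1 - s)\<^sup>N\<close> grows with \<open>N\<close> by
  \<open>(N + 1) s\<^sup>2 (1 - s)\<^sup>N\<close>, so it stays positive.\<close>

lemma norm_mult_one_minus_power:
  assumes k: "pos k" "norm k \<le> 1"
  shows "real (Suc N) * norm (k * (1 - k) ^ N) \<le> 1"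
proof -
  have p: "pos (1 - k)"
    using pos_norm_minus[of k 1] k by (simp add: pos_star)
  have kc: "k * (1 - k) ^ n = (1 - k) ^ n * k" for n
    by (rule power_commuting_commutes[symmetric]) (simp add: algebra_simps)
  have pk: "pos (k * (1 - k) ^ n)" for n
    by (intro pos_mult k pos_power p kc)
  have "pos (1 - (1 - k) ^ Suc N - real (Suc N) *\<^sub>R (k * (1 - k) ^ N))"
  proof (induction N)
    case (Suc N)
    let ?q = "(1 - k) ^ N"
    have "pos (k * (k * ?q))"
      by (rule pos_mult[OF k(1) pk]) (metis mult.assoc kc)
    then have "pos ((1 - (1 - k) ^ Suc N - real (Suc N) *\<^sub>R (k * ?q))
        + real (Suc N) *\<^sub>R (k * (k * ?q)))"
      by (intro pos_add Suc pos_scaleR) auto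
    also have "(1 - (1 - k) ^ Suc N - real (Suc N) *\<^sub>R (k * ?q))
        + real (Suc N) *\<^sub>R (k * (k * ?q))
      = 1 - (1 - k) ^ Suc (Suc N) - real (Suc (Suc N)) *\<^sub>R (k * (1 - k) ^ Suc N)"
      by (simp add: algebra_simps scaleR_2)
    finally show ?case .
  qed simp
  from pos_add[OF this pos_power[OF p, of "Suc N"]]
  have "pos (1 - real (Suc N) *\<^sub>R (k * (1 - k) ^ N))"
    by simp
  then have "norm (real (Suc N) *\<^sub>R (k * (1 - k) ^ N)) \<le> 1"
    by (intro norm_le_of_pos pos_scaleR pk) auto
  then show ?thesis
    by simp
qed

text \<open>Given \<open>x\<^sup>* x \<le> t + j\<close>, let \<open>k\<close> be a multiple of \<open>j\<^sup>2\<close> with norm at most one and \<open>v = (1 - k)\<^sup>n\<close>.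
  Then \<open>x - x v\<close> is in the ideal, and \<open>\<parallel>x v\<parallel>\<^sup>2 \<le> \<parallel>v (t + j) v\<parallel> \<le> t + \<parallel>j v\<parallel>\<close> is small for large \<open>n\<close>,
  because \<open>v\<close> is small where \<open>j\<close> is not. So \<open>x\<close> is a limit of elements of the ideal.\<close>

lemma closed_ideal_hereditary_unital:
  fixes x :: "'u::{cstar_algebra, real_normed_algebra_1}"
  assumes L: "closed_ideal L"
    and le: "\<And>t. 0 < t \<Longrightarrow> \<exists>j\<in>L. star j = j \<and> pos (of_real t + j - star x * x)"
  shows "x \<in> L"
proof -
  have "\<exists>y\<in>L. dist y x < \<epsilon>" if "0 < \<epsilon>" for \<epsilon>
  proof -
    define t where "t = \<epsilon>\<^sup>2 / 3"
    have t: "t > 0"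
      using that by (simp add: t_def)
    obtain j where j: "j \<in> L" "star j = j" "pos (of_real t + j - star x * x)"
      using le[OF t] by blast
    define M where "M = 1 + norm j"
    have M: "M > 0" "norm j \<le> M"
      by (auto simp: M_def add_pos_nonneg)
    define i where "i = (1/M) *\<^sub>R j"
    define k where "k = i * i"
    have si: "star i = i" and ni: "norm i \<le> 1"
      using M j by (auto simp: i_def star_scaleR)
    have "i \<in> L"
      unfolding i_def by (rule closed_ideal_scaleR[OF L j(1)])
    then have k: "pos k" "norm k \<le> 1" "k \<in> L"
      using si ni unfolding k_def
      by (auto simp: pos_square norm_self_square power_le_one closed_ideal_simps[OF L])
    obtain n where n: "M\<^sup>2 / t\<^sup>2 < real n"
      using reals_Archimedean2 by blast
    define v where "v = (1 - k) ^ n"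
    have p1k: "pos (1 - k)"
      using pos_norm_minus[of k 1] k by (simp add: pos_star)
    then have sv: "star v = v"
      unfolding v_def using pos_power pos_star by blast
    have "norm (1 - k) \<le> 1"
      by (rule norm_le_of_pos) (use k p1k in auto)
    then have nv: "norm v \<le> 1"
      unfolding v_def by (rule norm_power_le)
    have ik: "i * (1 - k) = (1 - k) * i"
      by (simp add: k_def algebra_simps)
    have iv: "i * v = v * i"
      unfolding v_def by (rule power_commuting_commutes[symmetric]) (rule ik[symmetric])
    have "star (i * v) = i * v"
      by (simp add: star_mult si sv iv)
    then have "(norm (i * v))\<^sup>2 = norm ((i * v) * (i * v))"
      by (simp add: norm_self_square)
    also have "(i * v) * (i * v) = k * (v * v)"
      by (metis iv k_def mult.assoc)
    also have "v * v = (1 - k) ^ (2 * n)"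
      by (simp add: v_def power_add mult_2)
    also have "norm (k * (1 - k) ^ (2 * n)) \<le> 1 / real (Suc (2 * n))"
      using norm_mult_one_minus_power[OF k(1,2), of "2 * n"] by (simp add: field_simps)
    finally have "(norm (j * v))\<^sup>2 \<le> M\<^sup>2 / real (Suc (2 * n))"
      using M by (simp add: i_def field_simps)
    also have "\<dots> \<le> t\<^sup>2"
    proof -
      have "M\<^sup>2 \<le> real n * t\<^sup>2"
        using n t by (simp add: field_simps)
      also have "\<dots> \<le> real (Suc (2 * n)) * t\<^sup>2"
        by (intro mult_right_mono) auto
      finally show ?thesis
        by (simp add: field_simps)
    qed
    finally have jv: "norm (j * v) \<le> t"
      using t by (simp add: power2_le_iff_abs_le)
    have "(norm (x * v))\<^sup>2 = norm (star (x * v) * (x * v))"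
      by (rule cstar_identity[symmetric])
    also have "\<dots> \<le> norm (v * (of_real t + j) * v)"
    proof (rule norm_le_mono[OF pos_star_mult_self])
      have "pos (star v * (of_real t + j - star x * x) * v)"
        by (rule pos_star_conj[OF j(3)])
      then show "pos (v * (of_real t + j) * v - star (x * v) * (x * v))"
        by (simp add: sv star_mult algebra_simps)
    qed
    also have "\<dots> \<le> norm v * norm ((of_real t + j) * v)"
      by (simp add: mult.assoc norm_mult_ineq)
    also have "\<dots> \<le> 1 * norm ((of_real t + j) * v)"
      by (intro mult_right_mono nv) auto
    also have "\<dots> \<le> norm (of_real t * v) + norm (j * v)"
      by (simp add: distrib_right norm_triangle_ineq)
    also have "norm (of_real t * v) \<le> t"
      using nv t by (simp add: of_real_def)
    finally have "(norm (x * v))\<^sup>2 \<le> 2 * t"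
      using jv by simp
    moreover have "2 * t < \<epsilon>\<^sup>2"
      using that by (simp add: t_def)
    ultimately have "(norm (x * v))\<^sup>2 < \<epsilon>\<^sup>2"
      by simp
    then have "norm (x * v) < \<epsilon>"
      using that by (simp add: power_less_imp_less_base)
    moreover have "1 - (1 - k) ^ N \<in> L" for N
    proof (induction N)
      case (Suc N)
      have "1 - (1 - k) ^ Suc N = (1 - (1 - k) ^ N) + (1 - k) ^ N * k"
        by (simp add: power_Suc2 algebra_simps del: power_Suc)
      moreover have "(1 - (1 - k) ^ N) + (1 - k) ^ N * k \<in> L"
        by (intro closed_ideal_simps(2,4)[OF L] Suc k(3))
      ultimately show ?case
        by (simp only:)
    qed (simp add: closed_ideal_simps[OF L])
    then have "x * (1 - v) \<in> L"
      unfolding v_def by (simp add: closed_ideal_simps[OF L])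
    moreover have "dist (x * (1 - v)) x = norm (x * v)"
      by (simp add: dist_norm algebra_simps)
    ultimately show ?thesis
      by metis
  qed
  then have "x \<in> closure L"
    by (simp add: closure_approachable)
  then show ?thesis
    using closed_ideal_simps(6)[OF L] by simp
qed

text \<open>Let \<open>m = a\<^sup>2 - 1/2\<close> and let \<open>e = |m| + m\<close> be twice its positive part, which is not zero as
  \<open>a\<^sup>2\<close> has norm one. If \<open>c\<close> is within \<open>1/2\<close> of \<open>a\<^sup>2\<close>, then \<open>m \<le> c\<close> and so \<open>e m e \<le> e c e\<close>. The left-hand
  side is \<open>d\<^sup>* d\<close> for \<open>d = |m|\<^bsup>1/2\<^esup> e\<close>, and the right-hand side is in every ideal that contains \<open>c\<close>; as
  closed ideals are hereditary, \<open>d\<close> is in the ideal.\<close>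

lemma common_element_of_nearby_ideals_unital:
  fixes a :: "'u::{cstar_algebra, real_normed_algebra_1}"
  assumes a: "star a = a" "norm a = 1"
  obtains d where "d \<noteq> 0"
    "\<And>L c. closed_ideal L \<Longrightarrow> c \<in> L \<Longrightarrow> star c = c \<Longrightarrow> norm (a * a - c) \<le> 1/2 \<Longrightarrow> d \<in> L"
proof -
  define b where "b = a * a"
  have b: "star b = b" "norm b = 1" "pos b"
    using a by (auto simp: b_def star_mult norm_self_square pos_square)
  define m where "m = b - of_real (1/2)"
  have sm: "star m = m"
    by (simp add: m_def star_diff b)
  obtain n where n: "pos n" "n * n = m * m" "\<And>z. z * m = m * z \<Longrightarrow> z * n = n * z"
    using abs_decomposition[OF sm] by blast
  obtain r where r: "pos r" "r * r = n" "\<And>z. z * n = n * z \<Longrightarrow> z * r = r * z"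
    using pos_sqrt[OF n(1)] by blast
  have mn: "m * n = n * m"
    by (rule n(3)) simp
  have mr: "m * r = r * m"
    by (rule r(3)) (rule mn)
  define e where "e = n + m"
  have se: "star e = e"
    by (simp add: e_def star_add sm pos_star n)
  have me: "m * e = n * e"
    by (simp add: e_def algebra_simps n(2) mn)
  have re: "r * e = e * r"
    by (simp add: e_def algebra_simps mr flip: r(2))
  define d where "d = r * e"
  have dd: "star d * d = e * m * e"
  proof -
    have "star d * d = e * (r * r) * e"
      by (simp add: d_def star_mult se pos_star r(1) mult.assoc)
    then show ?thesis
      by (simp add: r(2) me mult.assoc)
  qed
  have "d \<noteq> 0"
  proof
    assume "d = 0"
    then have "n * e = 0"
      by (metis d_def mult.assoc mult_zero_right r(2))
    then have "e * e = 0"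
      using me by (simp add: e_def algebra_simps)
    then have "e = 0"
      using norm_self_square[OF se] by simp
    then have "n = - m"
      by (simp add: e_def eq_neg_iff_add_eq_0)
    then have "n = of_real (1/2) - b"
      by (simp add: m_def)
    then have "pos (of_real (1/2) - b)"
      using n(1) by simp
    then have "norm b \<le> 1/2"
      by (intro norm_le_of_pos b) auto
    then show False
      using b by simp
  qed
  moreover have "d \<in> L" if L: "closed_ideal L" and c: "c \<in> L" "star c = c" "norm (a * a - c) \<le> 1/2" for L c
  proof (rule closed_ideal_hereditary_unital[OF L])
    fix t :: real
    assume "0 < t"
    have "pos (of_real (1/2) - (b - c))"
      by (rule pos_norm_minus) (use c b in \<open>auto simp: star_diff b_def star_mult\<close>)
    then have "pos (c - m)"
      by (simp add: m_def algebra_simps)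
    then have "pos (star e * (c - m) * e)"
      by (rule pos_star_conj)
    then have "pos (of_real t + e * c * e - star d * d)"
      using pos_add[OF pos_of_real[of t], of "star e * (c - m) * e"] \<open>0 < t\<close>
      unfolding dd by (simp add: se algebra_simps)
    moreover have "star (e * c * e) = e * c * e"
      by (simp add: star_mult se c mult.assoc)
    ultimately show "\<exists>j\<in>L. star j = j \<and> pos (of_real t + j - star d * d)"
      using c(1) by (intro bexI[of _ "e * c * e"]) (auto simp: closed_ideal_simps[OF L])
  qed
  ultimately show ?thesis
    using that by blast
qed

lemma inj_embed: "inj embed"
  by (rule injI) (metis embed_parts(1))

lemma closed_ideal_embed:
  assumes J: "closed_ideal J"
  shows "closed_ideal (embed ` J)"
proof -
  have mem: "u \<in> embed ` J \<longleftrightarrow> algebra_part u \<in> J \<and> scalar_part u = 0" for u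
    by (metis embed_def embed_parts image_iff unitization.collapse)
  have "closed (embed ` J)"
  proof -
    have "embed ` J = algebra_part -` J \<inter> scalar_part -` {0}"
      using mem by auto
    then show ?thesis
      by (simp add: closed_Int closed_vimage closed_ideal_simps(6)[OF J]
          linear_continuous_on[OF bounded_linear_algebra_part] linear_continuous_on[OF bounded_linear_scalar_part])
  qed
  then show ?thesis
    unfolding closed_ideal_def mem
    by (auto simp: closed_ideal_simps[OF J] scaleC_unitization_def)
qed

lemma closed_ideal_hereditary:
  assumes "closed_ideal J"
    and "\<And>t. 0 < t \<Longrightarrow> \<exists>j\<in>J. star j = j \<and> pos (of_real t + embed j - embed (star x * x))"
  shows "x \<in> J"
proof -
  have "embed x \<in> embed ` J"
  proof (rule closed_ideal_hereditary_unital[OF closed_ideal_embed[OF assms(1)]])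
    fix t :: real
    assume "0 < t"
    then obtain j where "j \<in> J" "star j = j" "pos (of_real t + embed j - embed (star x * x))"
      using assms(2) by blast
    then show "\<exists>j\<in>embed ` J. star j = j \<and> pos (of_real t + j - star (embed x) * embed x)"
      by (metis embed_simps(6) embed_star image_eqI)
  qed
  then show ?thesis
    by (simp add: inj_image_mem_iff[OF inj_embed])
qed

lemma common_element_of_nearby_ideals:
  fixes a :: "'a::cstar_algebra"
  assumes a: "star a = a" "norm a = 1"
  obtains d where "d \<noteq> 0"
    "\<And>L c. closed_ideal L \<Longrightarrow> c \<in> L \<Longrightarrow> star c = c \<Longrightarrow> norm (a * a - c) \<le> 1/2 \<Longrightarrow> d \<in> L"
proof -
  have "star (embed a) = embed a" "norm (embed a) = 1"
    using a by (auto simp flip: embed_star)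
  then obtain u where u: "u \<noteq> 0" and common: "\<And>L c. closed_ideal L \<Longrightarrow> c \<in> L \<Longrightarrow> star c = c \<Longrightarrow>
      norm (embed a * embed a - c) \<le> 1/2 \<Longrightarrow> u \<in> L"
    using common_element_of_nearby_ideals_unital[of "embed a"] by blast
  have mem: "u \<in> embed ` L"
    if "closed_ideal L" "c \<in> L" "star c = c" "norm (a * a - c) \<le> 1/2" for L c
    using that
    by (intro common[of _ "embed c"] closed_ideal_embed)
      (auto simp flip: embed_simps embed_star)
  \<comment> \<open>The element lives in the unitization; the ideal \<open>A\<close> itself, with \<open>c = a\<^sup>2\<close>, shows that it is in \<open>A\<close>.\<close>
  have "closed_ideal (UNIV :: 'a set)"
    by (simp add: closed_ideal_def)
  then have "u \<in> embed ` UNIV"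
    by (rule mem[of _ "a * a"]) (use a in \<open>auto simp: star_mult\<close>)
  then obtain d where d: "u = embed d"
    by blast
  show ?thesis
  proof (rule that)
    show "d \<noteq> 0"
      using u d by (auto simp: embed_simps)
    show "d \<in> L" if "closed_ideal L" "c \<in> L" "star c = c" "norm (a * a - c) \<le> 1/2" for L c
      using mem[OF that] by (simp add: d inj_image_mem_iff[OF inj_embed])
  qed
qed

section \<open>Automorphisms are contractive\<close>

text \<open>That is, \<open>1 - c = (1 - d)\<^sup>2\<close> with \<open>d\<close> in the algebra itself. A square root of \<open>1 - c\<close> in the unitization
  has scalar part \<open>1\<close> or \<open>- 1\<close>, and its sign can be chosen. The identity \<open>c = 2 d - d\<^sup>2\<close> does not mention
  the unit, so homomorphisms of \<open>A\<close> preserve it.\<close>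

lemma contraction_as_square_defect:
  fixes c :: "'a::cstar_algebra"
  assumes c: "star c = c" "norm c \<le> 1"
  obtains d where "star d = d" "c = 2 *\<^sub>R d - d * d"
proof -
  have "star (embed c) = embed c" "norm (embed c) \<le> 1"
    using c by (auto simp flip: embed_star)
  then obtain y where y: "star y = y" "(1 - y) * (1 - y) = 1 - embed c"
    using exists_sqrt_one_minus by blast
  have "(1 - scalar_part y) * (1 - scalar_part y) = 1"
    using arg_cong[OF y(2), of scalar_part] by simp
  then have "scalar_part y = 0 \<or> scalar_part y = 2"
    by algebra
  then obtain z where z: "star z = z" "(1 - z) * (1 - z) = 1 - embed c" "scalar_part z = 0"
  proof
    assume s: "scalar_part y = 2"
    have two: "scalar_part (2 :: 'a unitization) = 2"
      using unitization_parts(4)[of 1 "1::'a unitization"] by simp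
    have "star (2 :: 'a unitization) = 2"
      using star_of_real[of 2, where 'u="'a unitization"] by simp
    then have "star (2 - y) = 2 - y"
      using y by (simp add: star_diff)
    moreover have "(1 - (2 - y)) * (1 - (2 - y)) = 1 - embed c"
    proof -
      have "1 - (2 - y) = - (1 - y)"
        by simp
      then show ?thesis
        by (metis minus_mult_minus y(2))
    qed
    ultimately show ?thesis
      using s two that by auto
  qed (use y that in auto)
  define d where "d = algebra_part z"
  have zd: "z = embed d"
    by (auto intro!: unitization.expand simp: d_def z(3))
  have "embed c = 2 *\<^sub>R z - z * z"
    using z(2) by (simp add: algebra_simps scaleR_2)
  then have "embed c = embed (2 *\<^sub>R d - d * d)"
    by (simp add: zd embed_simps)
  moreover have "embed (star d) = embed d"
    using z(1) by (simp add: zd embed_star)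
  ultimately show ?thesis
    using that inj_embed by (metis injD)
qed

lemma star_automorphism_scaleR: "star_automorphism \<phi> \<Longrightarrow> \<phi> (r *\<^sub>R x) = r *\<^sub>R \<phi> x"
  by (metis scaleC_of_real star_automorphism_def)

lemma star_automorphism_diff: "star_automorphism \<phi> \<Longrightarrow> \<phi> (x - y) = \<phi> x - \<phi> y"
  using star_automorphism_scaleR[of \<phi> "-1" y] unfolding star_automorphism_def
  by (metis diff_conv_add_uminus scaleR_minus1_left)

text \<open>For a contraction \<open>x\<close>, the inequality \<open>x\<^sup>* x \<le> 1\<close> is expressed by \<open>x\<^sup>* x = 2 d - d\<^sup>2\<close>, and so it passes to
  the image.\<close>

lemma star_automorphism_norm_le:
  fixes \<phi> :: "'a::cstar_algebra \<Rightarrow> 'a"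
  assumes \<phi>: "star_automorphism \<phi>"
  shows "norm (\<phi> a) \<le> norm a"
proof -
  have mult: "\<phi> (x * y) = \<phi> x * \<phi> y" and star: "\<phi> (star x) = star (\<phi> x)" for x y
    using \<phi> by (auto simp: star_automorphism_def)
  have unit: "norm (\<phi> x) \<le> 1" if "norm x \<le> 1" for x
  proof -
    have "star (star x * x) = star x * x" "norm (star x * x) \<le> 1"
      using that by (auto simp: star_mult star_star cstar_identity power_le_one)
    then obtain d where d: "star d = d" "star x * x = 2 *\<^sub>R d - d * d"
      using contraction_as_square_defect by blast
    have "star (\<phi> x) * \<phi> x = \<phi> (star x * x)"
      by (simp add: mult star)
    also have "\<dots> = 2 *\<^sub>R \<phi> d - \<phi> d * \<phi> d"
      unfolding d(2) by (simp only: star_automorphism_diff[OF \<phi>] star_automorphism_scaleR[OF \<phi>] mult)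
    finally have "1 - star (embed (\<phi> x)) * embed (\<phi> x)
        = (1 - embed (\<phi> d)) * (1 - embed (\<phi> d))"
      by (simp add: algebra_simps scaleR_2 embed_simps(2-5) flip: embed_star embed_simps(6))
        (metis add.commute embed_simps(2))
    moreover have "star (1 - embed (\<phi> d)) = 1 - embed (\<phi> d)"
      by (simp add: star_diff d flip: embed_star star)
    ultimately have "pos (of_real 1 - star (embed (\<phi> x)) * embed (\<phi> x))"
      by (metis of_real_1 pos_square)
    then have "norm (star (embed (\<phi> x)) * embed (\<phi> x)) \<le> 1"
      by (intro norm_le_of_pos pos_star_mult_self) auto
    then show ?thesis
      by (simp add: cstar_identity power_le_one_iff abs_square_le_1)
  qed
  show ?thesis
  proof (cases "a = 0")
    case False
    have "norm (\<phi> ((1 / norm a) *\<^sub>R a)) \<le> 1"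
      using False by (intro unit) simp
    then show ?thesis
      using False by (simp add: star_automorphism_scaleR[OF \<phi>] field_simps)
  qed (use star_automorphism_scaleR[OF \<phi>, of 0 0] in simp)
qed

section \<open>Linear functionals below sublinear ones\<close>

definition sublinear :: "('v::real_vector \<Rightarrow> real) \<Rightarrow> bool" where
  "sublinear p \<longleftrightarrow> (\<forall>x y. p (x + y) \<le> p x + p y) \<and> (\<forall>r x. 0 < r \<longrightarrow> p (r *\<^sub>R x) \<le> r * p x)"

lemma sublinear_add: "sublinear p \<Longrightarrow> p (x + y) \<le> p x + p y"
  and sublinear_scaleR_le: "sublinear p \<Longrightarrow> 0 < r \<Longrightarrow> p (r *\<^sub>R x) \<le> r * p x"
  by (auto simp: sublinear_def)

lemma sublinear_zero: "sublinear p \<Longrightarrow> p 0 = 0"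
  using sublinear_scaleR_le[of p 2 0] sublinear_scaleR_le[of p "1/2" 0] by simp

lemma sublinear_scaleR:
  assumes p: "sublinear p" and "0 \<le> r"
  shows "p (r *\<^sub>R x) = r * p x"
proof (cases "r = 0")
  case False
  then have r: "r > 0"
    using assms by simp
  have "p ((1/r) *\<^sub>R (r *\<^sub>R x)) \<le> (1/r) * p (r *\<^sub>R x)"
    using r by (intro sublinear_scaleR_le p) simp
  then have "r * p x \<le> p (r *\<^sub>R x)"
    using r by (simp add: field_simps)
  then show ?thesis
    using sublinear_scaleR_le[OF p r, of x] by simp
qed (simp add: sublinear_zero p)

lemma sublinear_lower: "sublinear p \<Longrightarrow> - p (- x) \<le> p x"
  using sublinear_add[of p x "- x"] by (simp add: sublinear_zero)

text \<open>The largest sublinear function below \<open>p\<close> that has slope at most \<open>- p y\<close> in direction \<open>- y\<close>; a linear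
  function below it agrees with \<open>p\<close> at \<open>y\<close>.\<close>

definition slope_reduction :: "('v::real_vector \<Rightarrow> real) \<Rightarrow> 'v \<Rightarrow> 'v \<Rightarrow> real" where
  "slope_reduction p y x = (INF t\<in>{0..}. p (x + t *\<^sub>R y) - t * p y)"

lemma slope_reduction_le:
  assumes p: "sublinear p" and "0 \<le> t"
  shows "slope_reduction p y x \<le> p (x + t *\<^sub>R y) - t * p y"
proof -
  have "- p (- x) \<le> p (x + s *\<^sub>R y) - s * p y" if "0 \<le> s" for s
    using sublinear_add[OF p, of "x + s *\<^sub>R y" "- x"] sublinear_scaleR[OF p that, of y] by simp
  then have "bdd_below ((\<lambda>t. p (x + t *\<^sub>R y) - t * p y) ` {0..})"
    by (intro bdd_belowI2[where m="- p (- x)"]) auto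
  then show ?thesis
    unfolding slope_reduction_def using assms(2) by (intro cINF_lower) auto
qed

lemma slope_reduction_greatest:
  "(\<And>t. 0 \<le> t \<Longrightarrow> c \<le> p (x + t *\<^sub>R y) - t * p y) \<Longrightarrow> c \<le> slope_reduction p y x"
  unfolding slope_reduction_def by (intro cINF_greatest) auto

lemma sublinear_slope_reduction:
  assumes p: "sublinear p"
  shows "sublinear (slope_reduction p y)"
  unfolding sublinear_def
proof (intro conjI allI impI)
  fix x x'
  have "slope_reduction p y (x + x') - (p (x + t *\<^sub>R y) - t * p y) \<le> slope_reduction p y x'"
    if "0 \<le> t" for t
  proof (rule slope_reduction_greatest)
    fix s :: real
    assume "0 \<le> s"
    then have "slope_reduction p y (x + x') \<le> p (x + x' + (t + s) *\<^sub>R y) - (t + s) * p y"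
      using that by (intro slope_reduction_le p) simp
    also have "x + x' + (t + s) *\<^sub>R y = (x + t *\<^sub>R y) + (x' + s *\<^sub>R y)"
      by (simp add: algebra_simps)
    also have "p \<dots> \<le> p (x + t *\<^sub>R y) + p (x' + s *\<^sub>R y)"
      by (rule sublinear_add[OF p])
    finally show "slope_reduction p y (x + x') - (p (x + t *\<^sub>R y) - t * p y)
        \<le> p (x' + s *\<^sub>R y) - s * p y"
      by (simp add: algebra_simps)
  qed
  then have "slope_reduction p y (x + x') - slope_reduction p y x' \<le> slope_reduction p y x"
    by (intro slope_reduction_greatest) (simp add: algebra_simps)
  then show "slope_reduction p y (x + x') \<le> slope_reduction p y x + slope_reduction p y x'"
    by simp
next
  fix r :: real and x
  assume r: "0 < r"
  have "slope_reduction p y (r *\<^sub>R x) / r \<le> slope_reduction p y x"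
  proof (rule slope_reduction_greatest)
    fix t :: real
    assume t: "0 \<le> t"
    have "slope_reduction p y (r *\<^sub>R x) \<le> p (r *\<^sub>R x + (r * t) *\<^sub>R y) - (r * t) * p y"
      using r t by (intro slope_reduction_le p) simp
    also have "r *\<^sub>R x + (r * t) *\<^sub>R y = r *\<^sub>R (x + t *\<^sub>R y)"
      by (simp add: algebra_simps)
    also have "p \<dots> = r * p (x + t *\<^sub>R y)"
      using r by (simp add: sublinear_scaleR[OF p])
    finally show "slope_reduction p y (r *\<^sub>R x) / r \<le> p (x + t *\<^sub>R y) - t * p y"
      using r by (simp add: field_simps)
  qed
  then show "slope_reduction p y (r *\<^sub>R x) \<le> r * slope_reduction p y x"
    using r by (simp add: field_simps)
qed

lemma slope_reduction_le_self: "sublinear p \<Longrightarrow> slope_reduction p y x \<le> p x"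
  using slope_reduction_le[of p 0 y x] by simp

lemma exists_minimal_sublinear:
  fixes p :: "'v::real_vector \<Rightarrow> real"
  assumes p: "sublinear p"
  obtains q where "sublinear q" "q \<le> p" "\<And>q'. sublinear q' \<Longrightarrow> q' \<le> q \<Longrightarrow> q' = q"
proof -
  define A where "A = {q. sublinear q \<and> q \<le> p}"
  have "\<exists>m\<in>A. \<forall>a\<in>A. a \<le> m \<longrightarrow> a = m"
  proof (rule predicate_Zorn)
    show "partial_order_on A (relation_of (\<lambda>q q'. q' \<le> q) A)"
      by (auto simp: partial_order_on_def preorder_on_def refl_on_def trans_def antisym_def
          relation_of_def)
  next
    fix C
    assume "C \<in> Chains (relation_of (\<lambda>q q'. q' \<le> q) A)"
    then have CA: "C \<subseteq> A" and chain: "\<And>q q'. q \<in> C \<Longrightarrow> q' \<in> C \<Longrightarrow> q \<le> q' \<or> q' \<le> q"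
      by (auto simp: Chains_def relation_of_def)
    show "\<exists>u\<in>A. \<forall>a\<in>C. u \<le> a"
    proof (cases "C = {}")
      case True
      then show ?thesis
        using p by (intro bexI[of _ p]) (auto simp: A_def)
    next
      case False
      define u where "u x = (INF q\<in>C. q x)" for x
      have lower: "u x \<le> q x" if "q \<in> C" for q x
      proof -
        have "- p (- x) \<le> q x" if "q \<in> C" for q
        proof -
          have "sublinear q" "q (- x) \<le> p (- x)"
            using that CA by (auto simp: A_def le_fun_def)
          then show ?thesis
            using sublinear_lower[of q x] by simp
        qed
        then have "bdd_below ((\<lambda>q. q x) ` C)"
          by (intro bdd_belowI2[where m="- p (- x)"]) auto
        then show ?thesis
          unfolding u_def using that by (intro cINF_lower) auto
      qed
      have greatest: "c \<le> u x" if "\<And>q. q \<in> C \<Longrightarrow> c \<le> q x" for c x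
        unfolding u_def using that False by (intro cINF_greatest) auto
      have "sublinear u"
        unfolding sublinear_def
      proof (intro conjI allI impI)
        fix x y
        have pair: "u (x + y) \<le> q x + q' y" if "q \<in> C" "q' \<in> C" for q q'
          using chain[OF that]
        proof
          have sub: "sublinear q" "sublinear q'"
            using that CA by (auto simp: A_def)
          show ?thesis if "q \<le> q'"
            using order_trans[OF lower[OF \<open>q \<in> C\<close>] sublinear_add[OF sub(1), of x y]]
              le_funD[OF that, of y] by simp
          show ?thesis if "q' \<le> q"
            using order_trans[OF lower[OF \<open>q' \<in> C\<close>] sublinear_add[OF sub(2), of x y]]
              le_funD[OF that, of x] by simp
        qed
        have "u (x + y) - q x \<le> u y" if "q \<in> C" for q
        proof (rule greatest)
          show "u (x + y) - q x \<le> q' y" if "q' \<in> C" for q'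
            using pair[OF \<open>q \<in> C\<close> that] by simp
        qed
        then have "u (x + y) - u y \<le> u x"
          by (intro greatest) (simp add: algebra_simps)
        then show "u (x + y) \<le> u x + u y"
          by simp
      next
        fix r :: real and x
        assume r: "0 < r"
        have "u (r *\<^sub>R x) / r \<le> u x"
        proof (rule greatest)
          fix q
          assume q: "q \<in> C"
          then have "u (r *\<^sub>R x) \<le> r * q x"
            using lower[OF q, of "r *\<^sub>R x"] CA sublinear_scaleR_le[OF _ r, of q x]
            by (auto simp: A_def)
          then show "u (r *\<^sub>R x) / r \<le> q x"
            using r by (simp add: field_simps)
        qed
        then show "u (r *\<^sub>R x) \<le> r * u x"
          using r by (simp add: field_simps)
      qed
      moreover have "u \<le> p"
      proof -
        obtain q where "q \<in> C"
          using False by blast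
        then show ?thesis
          using lower[of q] CA by (force simp: A_def le_fun_def intro: order_trans)
      qed
      ultimately show ?thesis
        using lower by (intro bexI[of _ u]) (auto simp: A_def le_fun_def)
    qed
  qed
  then obtain m where "m \<in> A" "\<And>a. a \<in> A \<Longrightarrow> a \<le> m \<Longrightarrow> a = m"
    by blast
  then show ?thesis
    by (intro that[of m]) (auto simp: A_def)
qed

text \<open>A minimal sublinear function equals all its slope reductions, and hence is additive. Starting from the
  slope reduction of \<open>p\<close> at \<open>b\<close> gives the prescribed value at \<open>b\<close>.\<close>

theorem exists_linear_below_sublinear:
  fixes p :: "'v::real_vector \<Rightarrow> real"
  assumes p: "sublinear p"
  obtains f where "linear f" "\<And>x. f x \<le> p x" "f b = p b"
proof -
  obtain q where q: "sublinear q" "q \<le> slope_reduction p b"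
      and minimal: "\<And>q'. sublinear q' \<Longrightarrow> q' \<le> q \<Longrightarrow> q' = q"
    using exists_minimal_sublinear[OF sublinear_slope_reduction[OF p]] by blast
  have add: "q (x + y) = q x + q y" for x y
  proof -
    have "slope_reduction q y = q"
      by (intro minimal sublinear_slope_reduction q) (auto simp: le_fun_def slope_reduction_le_self q)
    then have "q x \<le> q (x + y) - q y"
      using slope_reduction_le[OF q(1), of 1 y x] by simp
    then show ?thesis
      using sublinear_add[OF q(1), of x y] by simp
  qed
  have minus: "q (- x) = - q x" for x
    using add[of x "- x"] by (simp add: sublinear_zero q)
  have "q (r *\<^sub>R x) = r * q x" for r x
  proof (cases "0 \<le> r")
    case False
    then have "q (- ((- r) *\<^sub>R x)) = - ((- r) * q x)"
      unfolding minus by (subst sublinear_scaleR[OF q(1)]) auto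
    then show ?thesis
      by simp
  qed (simp add: sublinear_scaleR q)
  then have "linear q"
    by (intro linearI) (auto simp: add)
  moreover have le: "q x \<le> p x" for x
    using q(2) slope_reduction_le_self[OF p, of b x] by (auto simp: le_fun_def intro: order_trans)
  moreover have "q (- b) \<le> - p b"
    using q(2) slope_reduction_le[OF p, of 1 b "- b"]
    by (auto simp: le_fun_def sublinear_zero p intro: order_trans)
  then have "q b = p b"
    using le[of b] by (simp add: minus)
  ultimately show ?thesis
    using that by blast
qed

section \<open>Extreme points\<close>

definition extreme_in :: "('x \<Rightarrow> real) set \<Rightarrow> ('x \<Rightarrow> real) \<Rightarrow> bool" where
  "extreme_in S F \<longleftrightarrow> F \<in> S \<and>
     (\<forall>G\<in>S. \<forall>H\<in>S. \<forall>t. 0 < t \<longrightarrow> t < 1 \<longrightarrow> F = (\<lambda>x. t * G x + (1 - t) * H x) \<longrightarrow> G = F)"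

definition closed_face :: "('x \<Rightarrow> real) set \<Rightarrow> ('x \<Rightarrow> real) set \<Rightarrow> bool" where
  "closed_face S T \<longleftrightarrow> T \<subseteq> S \<and> closed T \<and> T \<noteq> {} \<and>
     (\<forall>G\<in>S. \<forall>H\<in>S. \<forall>t. 0 < t \<longrightarrow> t < 1 \<longrightarrow> (\<lambda>x. t * G x + (1 - t) * H x) \<in> T \<longrightarrow> G \<in> T \<and> H \<in> T)"

lemma closed_face_maximizers:
  assumes S: "compact S" and T: "closed_face S T"
  shows "closed_face S {F \<in> T. \<forall>G\<in>T. G x \<le> F x}"
proof -
  have cT: "compact T"
    using compact_Int_closed[OF S, of T] T by (simp add: closed_face_def Int_absorb1)
  have "continuous_on T (\<lambda>F. F x)"
    by (rule continuous_on_subset[OF continuous_on_product_coordinates]) simp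
  moreover have "T \<noteq> {}"
    using T by (simp add: closed_face_def)
  ultimately obtain F where F: "F \<in> T" "\<And>G. G \<in> T \<Longrightarrow> G x \<le> F x"
    using continuous_attains_sup[OF cT] by metis
  then have eq: "{F \<in> T. \<forall>G\<in>T. G x \<le> F x} = T \<inter> {G. F x \<le> G x}" (is "?M = _")
    by (auto intro: order_trans)
  have "closed {G :: 'a \<Rightarrow> real. F x \<le> G x}"
    by (intro closed_Collect_le continuous_on_const continuous_on_product_coordinates)
  then have "closed ?M"
    unfolding eq using T by (intro closed_Int) (auto simp: closed_face_def)
  moreover have "G \<in> ?M \<and> H \<in> ?M"
    if GH: "G \<in> S" "H \<in> S" and t: "0 < t" "t < 1" and c: "(\<lambda>x. t * G x + (1 - t) * H x) \<in> ?M"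
    for G H t
  proof -
    have "G \<in> T" "H \<in> T"
      using T GH t c unfolding closed_face_def by blast+
    then have le: "G x \<le> F x" "H x \<le> F x"
      using F by auto
    have "F x \<le> t * G x + (1 - t) * H x"
      using c F(1) by auto
    moreover have "t * G x \<le> t * F x" "(1 - t) * H x \<le> (1 - t) * F x"
      using le t by auto
    moreover have "t * F x + (1 - t) * F x = F x"
      by (simp add: algebra_simps)
    ultimately have "t * F x \<le> t * G x" "(1 - t) * F x \<le> (1 - t) * H x"
      by linarith+
    then show ?thesis
      unfolding eq using t \<open>G \<in> T\<close> \<open>H \<in> T\<close> by simp
  qed
  ultimately show ?thesis
    using T F unfolding closed_face_def by auto
qed

lemma exists_minimal_closed_face:
  assumes S: "compact S" and T0: "closed_face S T0"
  obtains T where "closed_face S T" "T \<subseteq> T0" "\<And>T'. closed_face S T' \<Longrightarrow> T' \<subseteq> T \<Longrightarrow> T' = T"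
proof -
  define A where "A = {T. closed_face S T \<and> T \<subseteq> T0}"
  have "\<exists>m\<in>A. \<forall>a\<in>A. a \<subseteq> m \<longrightarrow> a = m"
  proof (rule predicate_Zorn)
    show "partial_order_on A (relation_of (\<lambda>q q'. q' \<subseteq> q) A)"
      by (auto simp: partial_order_on_def preorder_on_def refl_on_def trans_def antisym_def
          relation_of_def)
  next
    fix C
    assume "C \<in> Chains (relation_of (\<lambda>q q'. q' \<subseteq> q) A)"
    then have CA: "C \<subseteq> A" and chain: "\<And>q q'. q \<in> C \<Longrightarrow> q' \<in> C \<Longrightarrow> q \<subseteq> q' \<or> q' \<subseteq> q"
      by (auto simp: Chains_def relation_of_def)
    show "\<exists>u\<in>A. \<forall>a\<in>C. u \<subseteq> a"
    proof (cases "C = {}")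
      case True
      then show ?thesis
        using T0 by (intro bexI[of _ T0]) (auto simp: A_def)
    next
      case False
      then obtain T1 where T1: "T1 \<in> C"
        by blast
      then have "T1 \<subseteq> S" "T1 \<subseteq> T0"
        using CA by (auto simp: A_def closed_face_def)
      then have sub: "\<Inter>C \<subseteq> S" "\<Inter>C \<subseteq> T0"
        using T1 by blast+
      have "S \<inter> \<Inter>C \<noteq> {}"
      proof (rule compact_imp_fip[OF S])
        fix F'
        assume F': "finite F'" "F' \<subseteq> C"
        show "S \<inter> \<Inter>F' \<noteq> {}"
        proof (cases "F' = {}")
          case True
          then show ?thesis
            using T0 by (auto simp: closed_face_def)
        next
          case False
          have "\<Inter>F' \<in> F'"
            using F'(1) False
          proof (rule Inter_in_chain)
            show "subset.chain A F'"
              unfolding subset_chain_def using F'(2) CA chain by blast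
          qed
          then have "closed_face S (\<Inter>F')"
            using F' CA by (auto simp: A_def)
          then have "\<Inter>F' \<subseteq> S" "\<Inter>F' \<noteq> {}"
            unfolding closed_face_def by blast+
          then show ?thesis
            by blast
        qed
      qed (use CA in \<open>auto simp: A_def closed_face_def\<close>)
      moreover have "closed (\<Inter>C)"
        using CA by (intro closed_Inter) (auto simp: A_def closed_face_def)
      moreover have "G \<in> \<Inter>C \<and> H \<in> \<Inter>C"
        if "G \<in> S" "H \<in> S" "0 < t" "t < 1" "(\<lambda>x. t * G x + (1 - t) * H x) \<in> \<Inter>C" for G H t
        using that CA unfolding A_def closed_face_def by blast
      ultimately have "closed_face S (\<Inter>C)"
        using sub unfolding closed_face_def by (intro conjI) blast+
      then show ?thesis
        using sub by (intro bexI[of _ "\<Inter>C"]) (auto simp: A_def)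
    qed
  qed
  then obtain m where "m \<in> A" "\<And>a. a \<in> A \<Longrightarrow> a \<subseteq> m \<Longrightarrow> a = m"
    by blast
  then show ?thesis
    by (intro that[of m]) (auto simp: A_def)
qed

text \<open>The maximizers of an evaluation on a closed face form a closed face. So evaluations are
  constant on a minimal closed face, which is therefore a single point.\<close>

theorem exists_extreme_maximizer:
  fixes S :: "('x \<Rightarrow> real) set"
  assumes S: "compact S" "closed S" "S \<noteq> {}"
  obtains F where "extreme_in S F" "\<And>G. G \<in> S \<Longrightarrow> G b \<le> F b"
proof -
  have "closed_face S S"
    using S by (auto simp: closed_face_def)
  from closed_face_maximizers[OF S(1) this]
  obtain T where T: "closed_face S T" "T \<subseteq> {F \<in> S. \<forall>G\<in>S. G b \<le> F b}"
      and minimal: "\<And>T'. closed_face S T' \<Longrightarrow> T' \<subseteq> T \<Longrightarrow> T' = T"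
    using exists_minimal_closed_face[OF S(1)] by blast
  have "{F \<in> T. \<forall>G\<in>T. G x \<le> F x} = T" for x
    by (intro minimal closed_face_maximizers S T) auto
  then have "G x \<le> F x" if "F \<in> T" "G \<in> T" for F G x
    using that by blast
  then have single: "G = F" if "F \<in> T" "G \<in> T" for F G
    using that by (intro ext antisym)
  obtain F where F: "F \<in> T"
    using T by (auto simp: closed_face_def)
  have "extreme_in S F"
    unfolding extreme_in_def
  proof (intro conjI ballI allI impI)
    show "F \<in> S"
      using F T by (auto simp: closed_face_def)
  next
    fix G H t
    assume "G \<in> S" "H \<in> S" "0 < t" "t < 1" "F = (\<lambda>x. t * G x + (1 - t) * H x)"
    then have "G \<in> T"
      using T(1) F unfolding closed_face_def by blast
    then show "G = F"
      using single F by blast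
  qed
  then show ?thesis
    using that F T(2) by blast
qed

section \<open>Quasi-states\<close>

text \<open>The real parts of the positive functionals of norm at most one that vanish on the self-adjoint elements
  of \<open>J\<close>. The inequality \<open>(F x)\<^sup>2 \<le> F (x\<^sup>* x)\<close> is the Cauchy-Schwarz inequality against the unit and is what
  positivity of the extension to the unitization amounts to. All conditions are closed in the topology of
  pointwise convergence.\<close>

definition quasi_states :: "'a::cstar_algebra set \<Rightarrow> ('a \<Rightarrow> real) set" where
  "quasi_states J = {F. (\<forall>x y. F (x + y) = F x + F y) \<and> (\<forall>r x. F (r *\<^sub>R x) = r * F x) \<and>
     (\<forall>x. F (star x) = F x) \<and> (\<forall>x. (F x)\<^sup>2 \<le> F (star x * x)) \<and> (\<forall>x. \<bar>F x\<bar> \<le> norm x) \<and>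
     (\<forall>j\<in>J. star j = j \<longrightarrow> F j = 0)}"

lemma closed_quasi_states: "closed (quasi_states J)"
proof -
  have eq: "quasi_states J = (\<Inter>x. \<Inter>y. {F. F (x + y) = F x + F y}) \<inter>
      (\<Inter>r. \<Inter>x. {F. F (r *\<^sub>R x) = r * F x}) \<inter> (\<Inter>x. {F. F (star x) = F x}) \<inter>
      (\<Inter>x. {F. (F x)\<^sup>2 \<le> F (star x * x)}) \<inter> (\<Inter>x. {F. \<bar>F x\<bar> \<le> norm x}) \<inter>
      (\<Inter>j\<in>{j\<in>J. star j = j}. {F. F j = 0})"
    by (auto simp: quasi_states_def)
  show ?thesis
    unfolding eq
    by (intro closed_Int closed_INT ballI closed_Collect_eq closed_Collect_le continuous_intros
        continuous_on_product_coordinates)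
qed

lemma compact_quasi_states: "compact (quasi_states J)"
proof -
  have "compactin (product_topology (\<lambda>x::'a. euclidean :: real topology) UNIV)
      (PiE UNIV (\<lambda>x. {- norm x..norm x}))"
    by (simp add: compactin_PiE)
  then have "compact (PiE UNIV (\<lambda>x::'a. {- norm x..norm x}))"
    by (simp add: euclidean_product_topology)
  then have "compact (PiE UNIV (\<lambda>x::'a. {- norm x..norm x}) \<inter> quasi_states J)"
    using closed_quasi_states by (rule compact_Int_closed)
  moreover have "quasi_states J \<subseteq> PiE UNIV (\<lambda>x. {- norm x..norm x})"
    by (auto simp: quasi_states_def abs_le_iff minus_le_iff)
  ultimately show ?thesis
    by (simp add: Int_absorb1)
qed

text \<open>Let \<open>p y\<close> be the infimum of the \<open>t \<ge> 0\<close> with \<open>Re y \<le> t\<close> modulo the self-adjoint elements of \<open>J\<close>, which is the norm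
  of the positive part of \<open>Re y\<close> in \<open>A/J\<close>. A linear functional below \<open>p\<close> that agrees with \<open>p\<close>
  at \<open>x\<^sup>* x\<close> is a quasi-state, and its value there is positive because the ideal \<open>J\<close> is hereditary.\<close>

lemma exists_quasi_state:
  fixes x :: "'a::cstar_algebra"
  assumes J: "closed_ideal J" and x: "x \<notin> J"
  obtains F where "F \<in> quasi_states J" "0 < F (star x * x)"
proof -
  define R where "R y = (1/2) *\<^sub>R (y + star y)" for y :: 'a
  define D where "D y = {t. 0 \<le> t \<and> (\<exists>j\<in>J. star j = j \<and>
    pos (of_real t - embed (R y) + embed j))}" for y
  define p where "p y = Inf (D y)" for y
  note Jsimps = closed_ideal_simps[OF J]
  have R_add: "R (y + z) = R y + R z" and R_scaleR: "R (r *\<^sub>R y) = r *\<^sub>R R y"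
      and R_sa: "star (R y) = R y" and norm_R: "norm (R y) \<le> norm y" for y z r
  proof -
    show "R (y + z) = R y + R z" "R (r *\<^sub>R y) = r *\<^sub>R R y" "star (R y) = R y"
      by (auto simp: R_def star_add star_scaleR star_star algebra_simps)
    show "norm (R y) \<le> norm y"
      using norm_triangle_ineq[of y "star y"] by (simp add: R_def)
  qed
  have R_of_sa: "R y = y" if "star y = y" for y
    using that by (simp add: R_def flip: scaleR_2)
  have norm_in: "norm y \<in> D y" for y
  proof -
    have "pos (of_real (norm y) - embed (R y))"
      by (rule pos_norm_minus) (auto simp: norm_R R_sa simp flip: embed_star)
    then show ?thesis
      unfolding D_def using Jsimps(1) by (auto intro!: bexI[of _ 0] simp: embed_simps)
  qed
  have p_le: "p y \<le> t" if "t \<in> D y" for y t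
    unfolding p_def using that by (intro cInf_lower bdd_belowI[where m=0]) (auto simp: D_def)
  have p_ge: "c \<le> p y" if "\<And>t. t \<in> D y \<Longrightarrow> c \<le> t" for c y
    unfolding p_def using that norm_in[of y] by (intro cInf_greatest) auto
  have "sublinear p"
    unfolding sublinear_def
  proof (intro conjI allI impI)
    fix y z
    have D_add: "s + t \<in> D (y + z)" if s: "s \<in> D y" and t: "t \<in> D z" for s t
    proof -
      obtain j where j: "0 \<le> s" "j \<in> J" "star j = j" "pos (of_real s - embed (R y) + embed j)"
        using s by (auto simp: D_def)
      obtain i where i: "0 \<le> t" "i \<in> J" "star i = i" "pos (of_real t - embed (R z) + embed i)"
        using t by (auto simp: D_def)
      have "pos (of_real (s + t) - embed (R (y + z)) + embed (j + i))"
        using pos_add[OF j(4) i(4)] by (simp add: R_add embed_simps algebra_simps)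
      then show ?thesis
        unfolding D_def using i j by (auto intro!: bexI[of _ "j + i"] simp: Jsimps star_add)
    qed
    have "p (y + z) - s \<le> p z" if "s \<in> D y" for s
    proof (rule p_ge)
      fix t
      assume "t \<in> D z"
      then show "p (y + z) - s \<le> t"
        using p_le[OF D_add[OF that]] by fastforce
    qed
    then have "p (y + z) - p z \<le> p y"
      by (intro p_ge) (simp add: algebra_simps)
    then show "p (y + z) \<le> p y + p z"
      by simp
  next
    fix r :: real and y
    assume r: "0 < r"
    have "p (r *\<^sub>R y) / r \<le> p y"
    proof (rule p_ge)
      fix t
      assume "t \<in> D y"
      then obtain j where j: "0 \<le> t" "j \<in> J" "star j = j" "pos (of_real t - embed (R y) + embed j)"
        by (auto simp: D_def)
      have "r *\<^sub>R (of_real t - embed (R y) + embed j)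
          = of_real (r * t) - embed (R (r *\<^sub>R y)) + embed (r *\<^sub>R j)"
        by (simp add: R_scaleR embed_simps algebra_simps of_real_def)
      then have "pos (of_real (r * t) - embed (R (r *\<^sub>R y)) + embed (r *\<^sub>R j))"
        using pos_scaleR[OF j(4), of r] r by simp
      then have "r * t \<in> D (r *\<^sub>R y)"
        unfolding D_def mem_Collect_eq
        using j r by (intro conjI bexI[of _ "r *\<^sub>R j"]) (auto simp: closed_ideal_scaleR J star_scaleR)
      then show "p (r *\<^sub>R y) / r \<le> t"
        using p_le r by (simp add: field_simps)
    qed
    then show "p (r *\<^sub>R y) \<le> r * p y"
      using r by (simp add: field_simps)
  qed
  then obtain F where F: "linear F" "\<And>y. F y \<le> p y" "F (star x * x) = p (star x * x)"
    using exists_linear_below_sublinear by blast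
  have Fle: "F y \<le> t" if "t \<in> D y" for y t
    using F(2) p_le[OF that] order_trans by blast
  have minus: "F (- y) = - F y" for y
    by (rule linear_neg[OF F(1)])
  have Fdiff: "F (y - z) = F y - F z" for y z
    by (rule linear_diff[OF F(1)])
  have add: "F (y + z) = F y + F z" for y z
    by (rule linear_add[OF F(1)])
  have scale: "F (r *\<^sub>R y) = r * F y" for r y
    using linear_scale[OF F(1)] by simp
  have "0 < p (star x * x)"
  proof -
    have sa: "star (star x * x) = star x * x"
      by (simp add: star_mult star_star)
    obtain t0 where t0: "0 < t0"
        "\<And>j. j \<in> J \<Longrightarrow> star j = j \<Longrightarrow> \<not> pos (of_real t0 + embed j - embed (star x * x))"
      using closed_ideal_hereditary[OF J, of x] x by blast
    have "t0 \<le> p (star x * x)"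
    proof (rule p_ge)
      fix t
      assume "t \<in> D (star x * x)"
      then obtain j where j: "j \<in> J" "star j = j" "pos (of_real t - embed (star x * x) + embed j)"
        by (auto simp: D_def R_of_sa[OF sa])
      show "t0 \<le> t"
      proof (rule ccontr)
        assume "\<not> t0 \<le> t"
        then have "pos (of_real (t0 - t))"
          by (intro pos_of_real) simp
        from pos_add[OF this j(3)] have "pos (of_real t0 + embed j - embed (star x * x))"
          by (simp add: algebra_simps)
        then show False
          using t0(2) j by blast
      qed
    qed
    then show ?thesis
      using t0 by simp
  qed
  moreover have "F \<in> quasi_states J"
    unfolding quasi_states_def mem_Collect_eq
  proof (intro conjI allI ballI impI)
    show "F (star y) = F y" for y
    proof -
      have "0 \<in> D (z - star z)" for z
        unfolding D_def using Jsimps(1)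
        by (auto intro!: bexI[of _ 0] simp: R_def star_diff star_star embed_simps)
      then have "F (z - star z) \<le> 0" for z
        by (rule Fle)
      from this[of y] this[of "star y"] show ?thesis
        by (simp add: Fdiff star_star)
    qed
    show "(F y)\<^sup>2 \<le> F (star y * y)" for y
    proof -
      \<comment> \<open>The square \<open>(s - y)\<^sup>* (s - y)\<close> is positive for every real \<open>s\<close>; the best choice is \<open>s = F y\<close>.\<close>
      define s where "s = F y"
      define z where "z = of_real s - embed y"
      have Req: "R ((2 * s) *\<^sub>R y - star y * y) = s *\<^sub>R (y + star y) - star y * y"
        by (simp add: R_def star_diff star_scaleR star_mult star_star algebra_simps
            flip: scaleR_2)
      then have "of_real (s\<^sup>2) - embed (R ((2 * s) *\<^sub>R y - star y * y)) = star z * z"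
        unfolding Req embed_simps embed_star
        by (simp add: z_def star_diff algebra_simps of_real_def star_scaleR power2_eq_square)
      then have "s\<^sup>2 \<in> D ((2 * s) *\<^sub>R y - star y * y)"
        unfolding D_def using Jsimps(1) pos_star_mult_self[of z]
        by (auto intro!: bexI[of _ 0] simp: embed_simps)
      then have "2 * s * F y - F (star y * y) \<le> s\<^sup>2"
        using Fle by (fastforce simp: Fdiff scale)
      then show ?thesis
        by (simp add: s_def power2_eq_square)
    qed
    show "\<bar>F y\<bar> \<le> norm y" for y
      using Fle[OF norm_in, of y] Fle[OF norm_in, of "- y"] by (simp add: minus abs_le_iff)
    show "F j = 0" if "j \<in> J" "star j = j" for j
    proof -
      have "0 \<in> D i" if "i \<in> J" "star i = i" for i
        unfolding D_def using that by (auto intro!: bexI[of _ i] simp: R_of_sa)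
      then have "F j \<le> 0" "F (- j) \<le> 0"
        using that by (auto intro!: Fle simp: closed_ideal_uminus J star_minus)
      then show ?thesis
        by (simp add: minus)
    qed
  qed (auto simp: add scale)
  ultimately show ?thesis
    using that F(3) by simp
qed

theorem exists_extreme_quasi_state:
  fixes x :: "'a::cstar_algebra"
  assumes J: "closed_ideal J" and x: "x \<notin> J"
  obtains F where "extreme_in (quasi_states J) F" "0 < F (star x * x)"
proof -
  obtain G where G: "G \<in> quasi_states J" "0 < G (star x * x)"
    using exists_quasi_state[OF J x] by blast
  obtain F where "extreme_in (quasi_states J) F"
      "\<And>G. G \<in> quasi_states J \<Longrightarrow> G (star x * x) \<le> F (star x * x)"
    using exists_extreme_maximizer[OF compact_quasi_states closed_quasi_states] G(1) by blast
  then show ?thesis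
    using that G by (meson order_less_le_trans)
qed

text \<open>The square root of \<open>\<parallel>x\<parallel>\<^sup>2 - x\<^sup>* x\<close> is only in the unitization, but its product with \<open>a\<close> is in the algebra.\<close>

lemma quasi_state_star_mult_le:
  fixes a x :: "'a::cstar_algebra"
  assumes F: "F \<in> quasi_states J"
  shows "F (star (x * a) * (x * a)) \<le> (norm x)\<^sup>2 * F (star a * a)"
proof -
  have star2: "star (star x * x) = star x * x"
    by (simp add: star_mult star_star)
  have "pos (of_real ((norm x)\<^sup>2) - embed (star x * x))"
    by (rule pos_norm_minus) (auto simp: star2 cstar_identity simp flip: embed_star)
  then obtain z where z: "pos z" "z * z = of_real ((norm x)\<^sup>2) - embed (star x * x)"
    using pos_sqrt by metis
  define w where "w = algebra_part (z * embed a)"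
  have w: "z * embed a = embed w"
    by (auto intro!: unitization.expand simp: w_def)
  have "embed (star w * w) = star (embed a) * (z * z) * embed a"
    unfolding embed_simps embed_star w[symmetric] star_mult pos_star[OF z(1)]
    by (simp add: mult.assoc)
  also have "\<dots> = embed ((norm x)\<^sup>2 *\<^sub>R (star a * a) - star (x * a) * (x * a))"
    unfolding z(2) by (simp add: embed_simps embed_star algebra_simps of_real_def star_mult)
  finally have "star w * w = (norm x)\<^sup>2 *\<^sub>R (star a * a) - star (x * a) * (x * a)"
    using inj_embed by (metis injD)
  then have "star w * w + star (x * a) * (x * a) = (norm x)\<^sup>2 *\<^sub>R (star a * a)"
    by simp
  then have "F (star w * w) + F (star (x * a) * (x * a)) = (norm x)\<^sup>2 * F (star a * a)"
    using F unfolding quasi_states_def mem_Collect_eq by metis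
  moreover have "0 \<le> F (star w * w)"
  proof -
    have "(F w)\<^sup>2 \<le> F (star w * w)"
      using F unfolding quasi_states_def by blast
    then show ?thesis
      using order_trans zero_le_power2 by blast
  qed
  ultimately show ?thesis
    by simp
qed

section \<open>Semi-inner products\<close>

lemma Re_cnj_scaled_self: "Re (cnj (- of_real s * g) * g) = - s * (cmod g)\<^sup>2"
proof -
  have "(cmod g)\<^sup>2 = Re g * Re g + Im g * Im g"
    using cmod_power2[of g] by (simp only: power2_eq_square)
  then show ?thesis
    by (simp only:) (simp add: algebra_simps)
qed

text \<open>The axioms of \<open>complex_hilbert_space\<close> without definiteness and completeness. Both the algebra with the form
  of a functional and the Hilbert space built from it are instances.\<close>

locale semi_inner_product_space =
  fixes V :: "'h set"
    and zeroH :: "'h"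
    and addH :: "'h \<Rightarrow> 'h \<Rightarrow> 'h"
    and scaleH :: "complex \<Rightarrow> 'h \<Rightarrow> 'h"
    and ip :: "'h \<Rightarrow> 'h \<Rightarrow> complex"
  assumes zero_closed: "zeroH \<in> V"
    and add_closed: "x \<in> V \<Longrightarrow> y \<in> V \<Longrightarrow> addH x y \<in> V"
    and scale_closed: "x \<in> V \<Longrightarrow> scaleH c x \<in> V"
    and add_assoc: "x \<in> V \<Longrightarrow> y \<in> V \<Longrightarrow> z \<in> V \<Longrightarrow> addH (addH x y) z = addH x (addH y z)"
    and add_commute: "x \<in> V \<Longrightarrow> y \<in> V \<Longrightarrow> addH x y = addH y x"
    and add_zero: "x \<in> V \<Longrightarrow> addH zeroH x = x"
    and add_neg: "x \<in> V \<Longrightarrow> addH x (scaleH (- 1) x) = zeroH"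
    and scale_one: "x \<in> V \<Longrightarrow> scaleH 1 x = x"
    and scale_scale: "x \<in> V \<Longrightarrow> scaleH c (scaleH d x) = scaleH (c * d) x"
    and scale_add_right: "x \<in> V \<Longrightarrow> y \<in> V \<Longrightarrow> scaleH c (addH x y) = addH (scaleH c x) (scaleH c y)"
    and scale_add_left: "x \<in> V \<Longrightarrow> scaleH (c + d) x = addH (scaleH c x) (scaleH d x)"
    and ip_add: "x \<in> V \<Longrightarrow> y \<in> V \<Longrightarrow> z \<in> V \<Longrightarrow> ip (addH x y) z = ip x z + ip y z"
    and ip_scale: "x \<in> V \<Longrightarrow> y \<in> V \<Longrightarrow> ip (scaleH c x) y = c * ip x y"
    and ip_commute: "x \<in> V \<Longrightarrow> y \<in> V \<Longrightarrow> ip x y = cnj (ip y x)"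
    and ip_nonneg: "x \<in> V \<Longrightarrow> 0 \<le> Re (ip x x)"
begin

definition sq :: "'h \<Rightarrow> real" where
  "sq x = Re (ip x x)"

definition subH :: "'h \<Rightarrow> 'h \<Rightarrow> 'h" where
  "subH x y = addH x (scaleH (- 1) y)"

lemma sq_nonneg: "x \<in> V \<Longrightarrow> 0 \<le> sq x"
  by (simp add: sq_def ip_nonneg)

lemma ip_self: "x \<in> V \<Longrightarrow> ip x x = of_real (sq x)"
  using ip_commute[of x x] by (auto simp: sq_def complex_eq_iff)

lemma ip_add_right: "x \<in> V \<Longrightarrow> y \<in> V \<Longrightarrow> z \<in> V \<Longrightarrow> ip x (addH y z) = ip x y + ip x z"
  by (subst (1 2 3) ip_commute) (auto simp: ip_add add_closed)

lemma ip_scale_right: "x \<in> V \<Longrightarrow> y \<in> V \<Longrightarrow> ip x (scaleH c y) = cnj c * ip x y"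
  by (subst (1 2) ip_commute) (auto simp: ip_scale scale_closed)

lemma subH_closed: "x \<in> V \<Longrightarrow> y \<in> V \<Longrightarrow> subH x y \<in> V"
  by (simp add: subH_def add_closed scale_closed)

lemma ip_sub: "x \<in> V \<Longrightarrow> y \<in> V \<Longrightarrow> z \<in> V \<Longrightarrow> ip (subH x y) z = ip x z - ip y z"
  by (simp add: subH_def ip_add ip_scale scale_closed)

lemma add_sub_cancel: "x \<in> V \<Longrightarrow> y \<in> V \<Longrightarrow> addH y (subH x y) = x"
  by (metis add_assoc add_commute add_neg add_zero scale_closed subH_def subH_closed)

lemma subH_split:
  assumes "x \<in> V" "y \<in> V" "z \<in> V"
  shows "subH x z = addH (subH x y) (subH y z)"
proof -
  have "addH (subH x y) (subH y z) = addH (addH (subH x y) y) (scaleH (- 1) z)"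
    using assms by (simp add: subH_def[of y z] add_assoc subH_closed scale_closed)
  then show ?thesis
    using assms by (simp add: subH_def[of x z] add_commute[of "subH x y" y] add_sub_cancel subH_closed)
qed

lemma subH_eq_zero: "x \<in> V \<Longrightarrow> y \<in> V \<Longrightarrow> subH x y = zeroH \<Longrightarrow> x = y"
  by (metis add_commute add_sub_cancel add_zero zero_closed)

lemma sq_scale:
  assumes "x \<in> V"
  shows "sq (scaleH c x) = (cmod c)\<^sup>2 * sq x"
proof -
  have "ip (scaleH c x) (scaleH c x) = of_real ((cmod c)\<^sup>2) * ip x x"
    unfolding complex_norm_square using assms by (simp add: ip_scale ip_scale_right scale_closed)
  then show ?thesis
    by (simp add: sq_def)
qed

lemma sq_add_scale:
  assumes "x \<in> V" "y \<in> V"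
  shows "sq (addH x (scaleH c y)) = sq x + 2 * Re (cnj c * ip x y) + (cmod c)\<^sup>2 * sq y"
proof -
  have "Re (c * ip y x) = Re (cnj c * ip x y)"
    using ip_commute[OF assms] by simp
  moreover have "ip (addH x (scaleH c y)) (addH x (scaleH c y))
      = ip x x + cnj c * ip x y + c * ip y x + ip (scaleH c y) (scaleH c y)"
    using assms by (simp add: ip_add ip_add_right ip_scale[of y x] ip_scale_right[of x y]
        add_closed scale_closed)
  ultimately show ?thesis
    using sq_scale[OF assms(2), of c] by (simp add: sq_def)
qed

lemma cauchy_schwarz:
  assumes "x \<in> V" "y \<in> V"
  shows "(cmod (ip x y))\<^sup>2 \<le> sq x * sq y"
proof -
  define g where "g = ip x y"
  have quad: "0 \<le> sq x - 2 * s * (cmod g)\<^sup>2 + s\<^sup>2 * (cmod g)\<^sup>2 * sq y" for s :: real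
  proof -
    have re: "Re (cnj (- of_real s * g) * g) = - s * (cmod g)\<^sup>2"
      by (rule Re_cnj_scaled_self)
    have "sq (addH x (scaleH (- of_real s * g) y))
        = sq x - 2 * s * (cmod g)\<^sup>2 + s\<^sup>2 * (cmod g)\<^sup>2 * sq y"
      unfolding sq_add_scale[OF assms] g_def[symmetric] re by (simp add: norm_mult power_mult_distrib)
    then show ?thesis
      using sq_nonneg assms add_closed scale_closed by metis
  qed
  show ?thesis
  proof (cases "sq y = 0")
    case True
    have "(cmod g)\<^sup>2 = 0"
    proof (rule ccontr)
      assume "(cmod g)\<^sup>2 \<noteq> 0"
      then show False
        using quad[of "(sq x + 1) / (cmod g)\<^sup>2"] sq_nonneg[OF assms(1)] by (simp add: True)
    qed
    then show ?thesis
      by (simp add: g_def True)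
  next
    case False
    then have "sq y > 0"
      using sq_nonneg[OF assms(2)] by simp
    then show ?thesis
      using quad[of "1 / sq y"] by (simp add: g_def field_simps power2_eq_square)
  qed
qed

lemma sqrt_sq_add_le:
  assumes "x \<in> V" "y \<in> V"
  shows "sqrt (sq (addH x y)) \<le> sqrt (sq x) + sqrt (sq y)"
proof (rule real_le_lsqrt)
  have "Re (ip x y) \<le> sqrt (sq x * sq y)"
    using cauchy_schwarz[OF assms] complex_Re_le_cmod[of "ip x y"]
    by (meson order_trans real_le_rsqrt)
  moreover have "sq (addH x y) = sq x + 2 * Re (ip x y) + sq y"
    using sq_add_scale[OF assms, of 1] assms by (simp add: scale_one)
  ultimately show "sq (addH x y) \<le> (sqrt (sq x) + sqrt (sq y))\<^sup>2"
    using assms by (simp add: power2_sum sq_nonneg real_sqrt_mult)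
qed (use assms sq_nonneg add_closed in auto)

text \<open>Riesz representation without completeness: a minimizing sequence of the energy
  \<open>\<parallel>w\<parallel>\<^sup>2 - 2 Re \<phi>(w)\<close> on the subspace \<open>W\<close> is a Cauchy sequence, and in the limit it represents \<open>\<phi>\<close>. With
  \<open>\<phi> = \<langle>x, \<cdot>\<rangle>\<close> it approaches the orthogonal projection of \<open>x\<close>.\<close>

lemma riesz_sequence:
  assumes W: "W \<subseteq> V" "zeroH \<in> W" "\<And>x y. x \<in> W \<Longrightarrow> y \<in> W \<Longrightarrow> addH x y \<in> W"
      "\<And>c x. x \<in> W \<Longrightarrow> scaleH c x \<in> W"
    and add: "\<And>x y. x \<in> W \<Longrightarrow> y \<in> W \<Longrightarrow> \<phi> (addH x y) = \<phi> x + \<phi> y"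
    and scale: "\<And>c x. x \<in> W \<Longrightarrow> \<phi> (scaleH c x) = cnj c * \<phi> x"
    and K: "0 \<le> K" "\<And>w. w \<in> W \<Longrightarrow> (cmod (\<phi> w))\<^sup>2 \<le> K * sq w"
  obtains y where "\<And>n. y n \<in> W"
    "\<And>e. 0 < e \<Longrightarrow> \<exists>N. \<forall>m\<ge>N. \<forall>n\<ge>N. sq (subH (y m) (y n)) < e"
    "\<And>w. w \<in> W \<Longrightarrow> (\<lambda>n. ip (y n) w) \<longlonglongrightarrow> \<phi> w"
proof -
  define E where "E w = sq w - 2 * Re (\<phi> w)" for w
  have E_expand: "E (addH y (scaleH c a)) = E y + 2 * Re (cnj c * (ip y a - \<phi> a)) + (cmod c)\<^sup>2 * sq a"
    if "y \<in> W" "a \<in> W" for y a c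
  proof -
    have "y \<in> V" "a \<in> V"
      using that W by auto
    then show ?thesis
      using that by (simp add: E_def sq_add_scale add scale W algebra_simps)
  qed
  have E_lower: "- K \<le> E w" if "w \<in> W" for w
  proof -
    have q: "0 \<le> sq w"
      using that W by (auto intro: sq_nonneg)
    have "(2 * cmod (\<phi> w))\<^sup>2 \<le> 4 * (K * sq w)"
      using K(2)[OF that] by (simp add: power_mult_distrib)
    also have "\<dots> \<le> (K + sq w)\<^sup>2"
      using sum_squares_ge_zero[of "K - sq w" 0] by (simp add: power2_eq_square algebra_simps)
    finally have "2 * cmod (\<phi> w) \<le> K + sq w"
      using K(1) q by (intro power2_le_imp_le[of "2 * cmod (\<phi> w)"]) auto
    then show ?thesis
      using complex_Re_le_cmod[of "\<phi> w"] by (simp add: E_def)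
  qed
  define m where "m = Inf (E ` W)"
  have bdd: "bdd_below (E ` W)"
    using E_lower by (intro bdd_belowI2[where m="- K"])
  have m_le: "m \<le> E w" if "w \<in> W" for w
    unfolding m_def using bdd that by (intro cINF_lower)
  have "\<exists>w\<in>W. E w < m + 1 / real (Suc n)" for n
  proof -
    have "Inf (E ` W) < m + 1 / real (Suc n)"
      by (simp add: m_def)
    then show ?thesis
      using cInf_lessD[of "E ` W"] W(2) by (metis image_iff empty_iff)
  qed
  then obtain y where y: "\<And>n. y n \<in> W" "\<And>n. E (y n) < m + 1 / real (Suc n)"
    by metis
  have close: "sq (subH a b) \<le> 2 * ((E a - m) + (E b - m))" if "a \<in> W" "b \<in> W" for a b
  proof -
    have V: "a \<in> V" "b \<in> V"
      using that W by auto
    define d where "d = subH a b"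
    have d: "d \<in> W"
      using that W by (simp add: d_def subH_def)
    have "E a = E (addH b (scaleH 1 d))"
      using V by (simp add: d_def scale_one subH_closed add_sub_cancel)
    also have "\<dots> = E b + 2 * Re (ip b d - \<phi> d) + sq d"
      by (subst E_expand) (use that d in auto)
    finally have Ea: "E a = E b + 2 * Re (ip b d - \<phi> d) + sq d" .
    have "m \<le> E (addH b (scaleH (1/2) d))"
      using that d W by (intro m_le) auto
    also have "\<dots> = E b + Re (ip b d - \<phi> d) + sq d / 4"
      by (subst E_expand) (use that d in \<open>auto simp: power2_eq_square\<close>)
    finally show ?thesis
      using Ea by (simp add: d_def)
  qed
  have gap: "(cmod (ip a w - \<phi> w))\<^sup>2 \<le> (1 + sq w) * (E a - m)" if "a \<in> W" "w \<in> W" for a w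
  proof -
    define g where "g = ip a w - \<phi> w"
    \<comment> \<open>The step length in direction \<open>- g w\<close>; the energy cannot fall below \<open>m\<close> there.\<close>
    define s where "s = 1 / (1 + sq w)"
    have q: "0 \<le> sq w"
      using that W by (auto intro: sq_nonneg)
    have s: "0 < s" "s * sq w \<le> 1"
      using q by (auto simp: s_def field_simps)
    have re: "Re (cnj (- of_real s * g) * g) = - s * (cmod g)\<^sup>2"
      by (rule Re_cnj_scaled_self)
    have "E (addH a (scaleH (- of_real s * g) w)) = E a - 2 * s * (cmod g)\<^sup>2 + s * (s * sq w) * (cmod g)\<^sup>2"
      unfolding E_expand[OF that] g_def[symmetric] re using s
      by (simp add: norm_mult power_mult_distrib power2_eq_square)
    moreover have "m \<le> E (addH a (scaleH (- of_real s * g) w))"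
      using that W by (intro m_le) auto
    moreover have "s * (s * sq w) * (cmod g)\<^sup>2 \<le> s * 1 * (cmod g)\<^sup>2"
      using s by (intro mult_right_mono mult_left_mono) auto
    ultimately have "s * (cmod g)\<^sup>2 \<le> E a - m"
      by simp
    then show ?thesis
      using q by (simp add: s_def g_def field_simps)
  qed
  show ?thesis
  proof (rule that[OF y(1)])
    fix e :: real
    assume "0 < e"
    then obtain N where N: "4 / e < real N"
      using reals_Archimedean2 by blast
    have small: "E (y n) - m < e / 4" if "N \<le> n" for n
    proof -
      have "4 / e < real (Suc n)"
        using N that by linarith
      then have "1 / real (Suc n) < e / 4"
        using \<open>0 < e\<close> by (simp add: field_simps)
      then show ?thesis
        using y(2)[of n] by simp
    qed
    have "sq (subH (y i) (y j)) < e" if "N \<le> i" "N \<le> j" for i j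
      using close[OF y(1) y(1), of i j] small[OF that(1)] small[OF that(2)] by simp
    then show "\<exists>N. \<forall>m\<ge>N. \<forall>n\<ge>N. sq (subH (y m) (y n)) < e"
      by blast
  next
    fix w
    assume w: "w \<in> W"
    have "(\<lambda>n. (1 + sq w) * (1 / real (Suc n))) \<longlonglongrightarrow> (1 + sq w) * 0"
      by (intro tendsto_mult_left) (rule LIMSEQ_Suc[OF lim_1_over_n])
    moreover have "(cmod (ip (y n) w - \<phi> w))\<^sup>2 \<le> (1 + sq w) * (1 / real (Suc n))" for n
    proof -
      have "0 \<le> sq w"
        using w W by (auto intro: sq_nonneg)
      then show ?thesis
        using gap[OF y(1)[of n] w] mult_left_mono[of "E (y n) - m" "1 / real (Suc n)" "1 + sq w"] y(2)[of n]
        by simp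
    qed
    ultimately have "(\<lambda>n. (cmod (ip (y n) w - \<phi> w))\<^sup>2) \<longlonglongrightarrow> 0"
      by (intro Lim_null_comparison[of "\<lambda>n. (cmod (ip (y n) w - \<phi> w))\<^sup>2"]) auto
    then have "(\<lambda>n. sqrt ((cmod (ip (y n) w - \<phi> w))\<^sup>2)) \<longlonglongrightarrow> sqrt 0"
      by (rule tendsto_real_sqrt)
    then show "(\<lambda>n. ip (y n) w) \<longlonglongrightarrow> \<phi> w"
      by (simp add: tendsto_norm_zero_iff LIM_zero_iff)
  qed
qed

text \<open>A metric space demands symmetry and nonnegativity also off the carrier, where the axioms are silent.\<close>

lemma metric_space:
  assumes definite: "\<And>x. x \<in> V \<Longrightarrow> ip x x = 0 \<Longrightarrow> x = zeroH"
    and nonneg: "\<And>x y. 0 \<le> sq (subH x y)"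
    and symmetric: "\<And>x y. sq (subH x y) = sq (subH y x)"
  shows "Metric_space V (\<lambda>x y. sqrt (sq (subH x y)))"
proof
  fix x y z
  show "0 \<le> sqrt (sq (subH x y))"
    by (simp add: nonneg)
  show "sqrt (sq (subH x y)) = sqrt (sq (subH y x))"
    by (simp add: symmetric)
  show "sqrt (sq (subH x y)) = 0 \<longleftrightarrow> x = y" if "x \<in> V" "y \<in> V"
  proof
    assume "sqrt (sq (subH x y)) = 0"
    then have "ip (subH x y) (subH x y) = 0"
      using that by (simp add: ip_self subH_closed)
    then show "x = y"
      using definite that subH_closed subH_eq_zero by blast
  next
    assume "x = y"
    then have "subH x y = scaleH 0 x"
      using scale_add_left[OF that(1), of 1 "-1"] that by (simp add: subH_def scale_one)
    then show "sqrt (sq (subH x y)) = 0"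
      using that by (simp add: sq_scale)
  qed
  show "sqrt (sq (subH x z)) \<le> sqrt (sq (subH x y)) + sqrt (sq (subH y z))"
    if "x \<in> V" "y \<in> V" "z \<in> V"
    using that by (simp add: subH_split[of x y z] sqrt_sq_add_le subH_closed)
qed

end

section \<open>Orthogonal projections\<close>

sublocale complex_hilbert_space \<subseteq> semi: semi_inner_product_space V zeroH addH scaleH ip
  by unfold_locales
    (auto simp: zero_closed add_closed scale_closed add_assoc add_zero add_neg
      scale_one scale_scale scale_add_right scale_add_left ip_add ip_scale ip_nonneg
      intro: add_commute ip_commute)

context complex_hilbert_space
begin

lemma distH_eq: "distH = (\<lambda>x y. sqrt (semi.sq (semi.subH x y)))"
  by (intro ext) (simp add: distH_def normH_def semi.sq_def semi.subH_def)

lemma mcomplete_distH: "Metric_space.mcomplete V distH"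
  using complete unfolding distH_def[abs_def] normH_def .

text \<open>The limit of the sequence that \<open>riesz_sequence\<close> provides for \<open>\<langle>x, \<cdot>\<rangle>\<close> on \<open>W\<close>. The hypothesis that the
  distance is a metric is a restriction only off the carrier.\<close>

lemma orthogonal_projection:
  assumes metric: "Metric_space V distH" and W: "closed_subspace W" and x: "x \<in> V"
  obtains w where "w \<in> W" "\<And>v. v \<in> W \<Longrightarrow> ip w v = ip x v"
proof -
  interpret M: Metric_space V distH
    by (rule metric)
  have sub: "W \<subseteq> V" and closedW: "closedin M.mtopology W"
    using W by (auto simp: closed_subspace_def)
  obtain y where y: "\<And>n. y n \<in> W"
      "\<And>e. 0 < e \<Longrightarrow> \<exists>N. \<forall>m\<ge>N. \<forall>n\<ge>N. semi.sq (semi.subH (y m) (y n)) < e"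
      "\<And>w. w \<in> W \<Longrightarrow> (\<lambda>n. ip (y n) w) \<longlonglongrightarrow> ip x w"
  proof (rule semi.riesz_sequence[of W "ip x" "semi.sq x"])
    show "0 \<le> semi.sq x"
      by (rule semi.sq_nonneg[OF x])
    show "(cmod (ip x w))\<^sup>2 \<le> semi.sq x * semi.sq w" if "w \<in> W" for w
      using sub that x by (intro semi.cauchy_schwarz) auto
    show "ip x (addH u v) = ip x u + ip x v" if "u \<in> W" "v \<in> W" for u v
      using sub that x by (intro semi.ip_add_right) auto
    show "ip x (scaleH c u) = cnj c * ip x u" if "u \<in> W" for u c
      using sub that x by (intro semi.ip_scale_right) auto
  qed (use W in \<open>auto simp: closed_subspace_def\<close>)
  have "M.MCauchy y"
    unfolding M.MCauchy_def
  proof (intro conjI allI impI)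
    show "range y \<subseteq> V"
      using y(1) sub by auto
  next
    fix e :: real
    assume "0 < e"
    then obtain N where N: "\<forall>m\<ge>N. \<forall>n\<ge>N. semi.sq (semi.subH (y m) (y n)) < e\<^sup>2"
      using y(2)[of "e\<^sup>2"] by auto
    have "distH (y m) (y n) < e" if "N \<le> m" "N \<le> n" for m n
      using N that \<open>0 < e\<close> real_sqrt_less_mono[of _ "e\<^sup>2"] unfolding distH_eq by fastforce
    then show "\<exists>N. \<forall>n n'. N \<le> n \<longrightarrow> N \<le> n' \<longrightarrow> distH (y n) (y n') < e"
      by blast
  qed
  then obtain w where w: "limitin M.mtopology y w sequentially"
    using mcomplete_distH M.mcomplete_def by blast
  then have "w \<in> W"
    using closedW y(1) M.metric_closedin_iff_sequentially_closed by blast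
  moreover have "ip w v = ip x v" if v: "v \<in> W" for v
  proof -
    have wV: "w \<in> V" and vV: "v \<in> V"
      using \<open>w \<in> W\<close> v sub by auto
    have lim: "(\<lambda>n. distH (y n) w) \<longlonglongrightarrow> 0"
    proof (rule LIMSEQ_I)
      fix e :: real
      assume "0 < e"
      then show "\<exists>N. \<forall>n\<ge>N. norm (distH (y n) w - 0) < e"
        using w unfolding M.limit_metric_sequentially by (simp add: M.nonneg) meson
    qed
    have "cmod (ip (y n) v - ip w v) \<le> distH (y n) w * sqrt (semi.sq v)" for n
    proof -
      have yV: "y n \<in> V"
        by (rule subsetD[OF sub y(1)])
      have "(cmod (ip (semi.subH (y n) w) v))\<^sup>2 \<le> semi.sq (semi.subH (y n) w) * semi.sq v"
        using yV wV vV by (intro semi.cauchy_schwarz semi.subH_closed)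
      then have "cmod (ip (semi.subH (y n) w) v) \<le> sqrt (semi.sq (semi.subH (y n) w) * semi.sq v)"
        by (rule real_le_rsqrt)
      then show ?thesis
        using yV wV vV by (simp add: semi.ip_sub distH_eq real_sqrt_mult)
    qed
    then have "\<forall>\<^sub>F n in sequentially. norm (ip (y n) v - ip w v) \<le> distH (y n) w * sqrt (semi.sq v)"
      by (intro always_eventually) blast
    moreover have "(\<lambda>n. distH (y n) w * sqrt (semi.sq v)) \<longlonglongrightarrow> 0"
      using tendsto_mult_right[OF lim, of "sqrt (semi.sq v)"] by simp
    ultimately have "(\<lambda>n. ip (y n) v - ip w v) \<longlonglongrightarrow> 0"
      by (rule Lim_null_comparison)
    then have "(\<lambda>n. ip (y n) v) \<longlonglongrightarrow> ip w v"
      by (rule LIM_zero_cancel)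
    then show ?thesis
      using y(3)[OF v] LIMSEQ_unique by blast
  qed
  ultimately show ?thesis
    using that by blast
qed

end

section \<open>The Hilbert space of bounded conjugate-linear functionals\<close>

text \<open>For a semi-inner product on the algebra, the functionals \<open>\<langle>b, \<cdot>\<rangle>\<close> are dense in the space of all bounded
  conjugate-linear functionals, which is the completion modulo null vectors. Being a space of functions, it needs
  no equivalence classes.\<close>

locale algebra_form = semi_inner_product_space "UNIV :: 'a::cstar_algebra set" 0 "(+)" scaleC B
  for B :: "'a::cstar_algebra \<Rightarrow> 'a \<Rightarrow> complex"
begin

definition dual :: "('a \<Rightarrow> complex) set" where
  "dual = {\<phi>. (\<forall>x y. \<phi> (x + y) = \<phi> x + \<phi> y) \<and> (\<forall>c x. \<phi> (scaleC c x) = cnj c * \<phi> x) \<and>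
     (\<exists>K. \<forall>a. (cmod (\<phi> a))\<^sup>2 \<le> K * sq a)}"

definition represents :: "(nat \<Rightarrow> 'a) \<Rightarrow> ('a \<Rightarrow> complex) \<Rightarrow> bool" where
  "represents y \<phi> \<longleftrightarrow> (\<forall>e>0. \<exists>N. \<forall>m\<ge>N. \<forall>n\<ge>N. sq (y m - y n) < e) \<and>
     (\<forall>a. (\<lambda>n. B (y n) a) \<longlonglongrightarrow> \<phi> a)"

text \<open>The value is \<open>\<langle>\<phi>, \<psi>\<rangle> = lim \<phi>(y\<^sub>n)\<close> for any sequence \<open>y\<close> that represents \<open>\<psi>\<close>. The value \<open>0\<close> off the dual
  makes the induced distance symmetric and nonnegative for all functions.\<close>

definition dual_ip :: "('a \<Rightarrow> complex) \<Rightarrow> ('a \<Rightarrow> complex) \<Rightarrow> complex" where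
  "dual_ip \<phi> \<psi> = (if \<phi> \<in> dual \<and> \<psi> \<in> dual
     then lim (\<lambda>n. \<phi> ((SOME y. represents y \<psi>) n)) else 0)"

definition dual_add :: "('a \<Rightarrow> complex) \<Rightarrow> ('a \<Rightarrow> complex) \<Rightarrow> 'a \<Rightarrow> complex" where
  "dual_add \<phi> \<psi> = (\<lambda>a. \<phi> a + \<psi> a)"

definition dual_scale :: "complex \<Rightarrow> ('a \<Rightarrow> complex) \<Rightarrow> 'a \<Rightarrow> complex" where
  "dual_scale c \<phi> = (\<lambda>a. c * \<phi> a)"

lemma subH_eq: "subH x y = x - y"
  by (simp add: subH_def scaleC_minus_left)

lemma sq_nonneg' [simp]: "0 \<le> sq a"
  by (simp add: sq_nonneg)

lemma dual_add_arg: "\<phi> \<in> dual \<Longrightarrow> \<phi> (x + y) = \<phi> x + \<phi> y"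
  and dual_scale_arg: "\<phi> \<in> dual \<Longrightarrow> \<phi> (scaleC c x) = cnj c * \<phi> x"
  by (auto simp: dual_def)

lemma dual_zero_arg: "\<phi> \<in> dual \<Longrightarrow> \<phi> 0 = 0"
  using dual_scale_arg[of \<phi> 0 0] by simp

lemma dual_diff_arg: "\<phi> \<in> dual \<Longrightarrow> \<phi> (x - y) = \<phi> x - \<phi> y"
  using dual_add_arg[of \<phi> "x - y" y] by simp

lemma dual_bound:
  assumes "\<phi> \<in> dual"
  obtains K where "0 \<le> K" "\<And>a. (cmod (\<phi> a))\<^sup>2 \<le> K * sq a"
proof -
  obtain K where K: "\<And>a. (cmod (\<phi> a))\<^sup>2 \<le> K * sq a"
    using assms by (auto simp: dual_def)
  have "(cmod (\<phi> a))\<^sup>2 \<le> max K 0 * sq a" for a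
    by (rule order_trans[OF K mult_right_mono]) auto
  then show ?thesis
    using that[of "max K 0"] by simp
qed

lemma dualI:
  assumes "\<And>x y. \<phi> (x + y) = \<phi> x + \<phi> y" "\<And>c x. \<phi> (scaleC c x) = cnj c * \<phi> x"
    "\<And>a. (cmod (\<phi> a))\<^sup>2 \<le> K * sq a"
  shows "\<phi> \<in> dual"
  using assms by (auto simp: dual_def)

lemma norm_add_square_le: "(cmod (x + y))\<^sup>2 \<le> 2 * (cmod x)\<^sup>2 + 2 * (cmod y)\<^sup>2"
proof -
  have "(cmod (x + y))\<^sup>2 \<le> (cmod x + cmod y)\<^sup>2"
    by (intro power_mono norm_triangle_ineq) auto
  also have "\<dots> \<le> 2 * (cmod x)\<^sup>2 + 2 * (cmod y)\<^sup>2"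
    using sum_squares_ge_zero[of "cmod x - cmod y" 0] by (simp add: power2_eq_square algebra_simps)
  finally show ?thesis .
qed

lemma zero_in_dual: "(\<lambda>_. 0) \<in> dual"
  by (rule dualI[where K=0]) auto

lemma dual_add_closed:
  assumes "\<phi> \<in> dual" "\<psi> \<in> dual"
  shows "dual_add \<phi> \<psi> \<in> dual"
proof -
  obtain K where K: "\<And>a. (cmod (\<phi> a))\<^sup>2 \<le> K * sq a"
    using dual_bound[OF assms(1)] by blast
  obtain L where L: "\<And>a. (cmod (\<psi> a))\<^sup>2 \<le> L * sq a"
    using dual_bound[OF assms(2)] by blast
  have "(cmod (\<phi> a + \<psi> a))\<^sup>2 \<le> (2 * K + 2 * L) * sq a" for a
    using norm_add_square_le[of "\<phi> a" "\<psi> a"] K[of a] L[of a] by (simp add: algebra_simps)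
  then show ?thesis
    by (intro dualI[where K="2 * K + 2 * L"])
      (auto simp: dual_add_def dual_add_arg dual_scale_arg assms algebra_simps)
qed

lemma dual_scale_closed:
  assumes "\<phi> \<in> dual"
  shows "dual_scale c \<phi> \<in> dual"
proof -
  obtain K where K: "\<And>a. (cmod (\<phi> a))\<^sup>2 \<le> K * sq a"
    using dual_bound[OF assms] by blast
  have "(cmod (c * \<phi> a))\<^sup>2 \<le> ((cmod c)\<^sup>2 * K) * sq a" for a
    using mult_left_mono[OF K[of a], of "(cmod c)\<^sup>2"]
    by (simp add: norm_mult power_mult_distrib mult.assoc)
  then show ?thesis
    by (intro dualI[where K="(cmod c)\<^sup>2 * K"])
      (auto simp: dual_scale_def dual_add_arg dual_scale_arg assms algebra_simps)
qed

lemma form_in_dual: "B b \<in> dual"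
  by (rule dualI[where K="sq b"]) (auto simp: ip_add_right ip_scale_right cauchy_schwarz)

lemma represents_form: "represents (\<lambda>_. b) (B b)"
proof -
  have "sq 0 = 0"
    using sq_scale[of 0 0] by simp
  then show ?thesis
    by (simp add: represents_def)
qed

lemma exists_representing_sequence:
  assumes "\<phi> \<in> dual"
  obtains y where "represents y \<phi>"
proof -
  obtain K where K: "0 \<le> K" "\<And>a. (cmod (\<phi> a))\<^sup>2 \<le> K * sq a"
    using dual_bound[OF assms] by blast
  obtain y where "\<And>e. 0 < e \<Longrightarrow> \<exists>N. \<forall>m\<ge>N. \<forall>n\<ge>N. sq (subH (y m) (y n)) < e"
      "\<And>a. (\<lambda>n. B (y n) a) \<longlonglongrightarrow> \<phi> a"
    by (rule riesz_sequence[of UNIV \<phi> K]) (use K assms in \<open>auto simp: dual_def\<close>)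
  then show ?thesis
    by (intro that[of y]) (simp add: represents_def subH_eq)
qed

lemma convergent_on_representing:
  assumes \<phi>: "\<phi> \<in> dual" and y: "represents y \<psi>"
  shows "convergent (\<lambda>n. \<phi> (y n))"
proof -
  obtain K where K: "0 \<le> K" "\<And>a. (cmod (\<phi> a))\<^sup>2 \<le> K * sq a"
    using dual_bound[OF \<phi>] by blast
  have "Cauchy (\<lambda>n. \<phi> (y n))"
  proof (rule CauchyI)
    fix e :: real
    assume e: "0 < e"
    then have "0 < e\<^sup>2 / (K + 1)"
      using K(1) by simp
    then obtain N where N: "\<And>m n. m \<ge> N \<Longrightarrow> n \<ge> N \<Longrightarrow> sq (y m - y n) < e\<^sup>2 / (K + 1)"
      using y unfolding represents_def by meson
    have "norm (\<phi> (y m) - \<phi> (y n)) < e" if "m \<ge> N" "n \<ge> N" for m n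
    proof -
      have "(cmod (\<phi> (y m) - \<phi> (y n)))\<^sup>2 \<le> K * sq (y m - y n)"
        using K(2)[of "y m - y n"] by (simp add: dual_diff_arg[OF \<phi>])
      also have "\<dots> \<le> (K + 1) * sq (y m - y n)"
        by (intro mult_right_mono) auto
      also have "\<dots> < e\<^sup>2"
        using N[OF that] K(1) by (simp add: field_simps)
      finally show ?thesis
        using e by (simp add: power_less_imp_less_base)
    qed
    then show "\<exists>M. \<forall>m\<ge>M. \<forall>n\<ge>M. norm (\<phi> (y m) - \<phi> (y n)) < e"
      by blast
  qed
  then show ?thesis
    by (simp add: Cauchy_convergent_iff)
qed

text \<open>The convergence in \<open>represents\<close> is uniform on bounded sets, because the sequence is Cauchy.\<close>

lemma representing_tail:
  assumes x: "represents x \<phi>" and e: "0 < e"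
  obtains N where "\<And>n a. n \<ge> N \<Longrightarrow> (cmod (\<phi> a - B (x n) a))\<^sup>2 \<le> e * sq a"
proof -
  obtain N where N: "\<And>m n. m \<ge> N \<Longrightarrow> n \<ge> N \<Longrightarrow> sq (x m - x n) < e"
    using x e unfolding represents_def by meson
  have "(cmod (\<phi> a - B (x n) a))\<^sup>2 \<le> e * sq a" if "n \<ge> N" for n a
  proof (rule LIMSEQ_le_const2)
    have "(\<lambda>m. B (x m) a) \<longlonglongrightarrow> \<phi> a"
      using x by (simp add: represents_def)
    then show "(\<lambda>m. (cmod (B (x m) a - B (x n) a))\<^sup>2) \<longlonglongrightarrow> (cmod (\<phi> a - B (x n) a))\<^sup>2"
      by (intro tendsto_intros)
    have "(cmod (B (x m) a - B (x n) a))\<^sup>2 \<le> e * sq a" if "m \<ge> N" for m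
    proof -
      have "(cmod (B (x m) a - B (x n) a))\<^sup>2 \<le> sq (x m - x n) * sq a"
        using cauchy_schwarz[of "x m - x n" a] ip_sub[of "x m" "x n" a] by (simp add: subH_eq)
      also have "\<dots> \<le> e * sq a"
        using N[OF that \<open>n \<ge> N\<close>] by (intro mult_right_mono) auto
      finally show ?thesis .
    qed
    then show "\<exists>M. \<forall>m\<ge>M. (cmod (B (x m) a - B (x n) a))\<^sup>2 \<le> e * sq a"
      by blast
  qed
  then show ?thesis
    using that by blast
qed

lemma representing_bounded:
  assumes y: "represents y \<psi>"
  obtains M N where "0 < M" "\<And>n. n \<ge> N \<Longrightarrow> sq (y n) \<le> M"
proof -
  obtain N where N: "\<And>m n. m \<ge> N \<Longrightarrow> n \<ge> N \<Longrightarrow> sq (y m - y n) < 1"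
    using y unfolding represents_def by (meson zero_less_one)
  define M where "M = (sqrt (sq (y N)) + 1)\<^sup>2"
  have "sq (y n) \<le> M" if "n \<ge> N" for n
  proof -
    have "sqrt (sq (y n)) \<le> sqrt (sq (y n - y N)) + sqrt (sq (y N))"
      using sqrt_sq_add_le[of "y n - y N" "y N"] by simp
    also have "sqrt (sq (y n - y N)) \<le> 1"
      using N[OF that, of N] by simp
    finally have "(sqrt (sq (y n)))\<^sup>2 \<le> M"
      unfolding M_def by (intro power_mono) auto
    then show ?thesis
      by simp
  qed
  moreover have "0 < M"
    unfolding M_def by (intro zero_less_power add_nonneg_pos) auto
  ultimately show ?thesis
    using that by blast
qed

text \<open>So the two iterated limits of \<open>\<langle>x\<^sub>m, y\<^sub>n\<rangle>\<close> agree with the diagonal one; the symmetry of the inner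
  product and its independence of the representing sequence both follow from this.\<close>

lemma diagonal_difference:
  assumes x: "represents x \<phi>" and y: "represents y \<psi>"
  shows "(\<lambda>n. \<phi> (y n) - B (x n) (y n)) \<longlonglongrightarrow> 0"
proof (rule LIMSEQ_I)
  fix e :: real
  assume e: "0 < e"
  obtain M N where M: "0 < M" "\<And>n. n \<ge> N \<Longrightarrow> sq (y n) \<le> M"
    using representing_bounded[OF y] by blast
  define d where "d = e\<^sup>2 / (2 * M)"
  have "0 < d"
    using e M by (simp add: d_def)
  then obtain N' where N': "\<And>n a. n \<ge> N' \<Longrightarrow> (cmod (\<phi> a - B (x n) a))\<^sup>2 \<le> d * sq a"
    using representing_tail[OF x] by blast
  have "norm (\<phi> (y n) - B (x n) (y n) - 0) < e" if "n \<ge> max N N'" for n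
  proof -
    have "(cmod (\<phi> (y n) - B (x n) (y n)))\<^sup>2 \<le> d * sq (y n)"
      using N' that by simp
    also have "\<dots> \<le> d * M"
      using M that \<open>0 < d\<close> by (intro mult_left_mono) auto
    also have "\<dots> < e\<^sup>2"
      using M e by (simp add: d_def)
    finally show ?thesis
      using e by (simp add: power_less_imp_less_base)
  qed
  then show "\<exists>no. \<forall>n\<ge>no. norm (\<phi> (y n) - B (x n) (y n) - 0) < e"
    by blast
qed

lemma tendsto_dual_ip_choice:
  assumes "\<phi> \<in> dual" "\<psi> \<in> dual"
  obtains y where "represents y \<psi>" "\<And>\<phi>. \<phi> \<in> dual \<Longrightarrow> (\<lambda>n. \<phi> (y n)) \<longlonglongrightarrow> dual_ip \<phi> \<psi>"
proof -
  define y where "y = (SOME y. represents y \<psi>)"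
  have y: "represents y \<psi>"
    unfolding y_def using exists_representing_sequence[OF assms(2)] by (metis someI)
  have "(\<lambda>n. \<phi> (y n)) \<longlonglongrightarrow> dual_ip \<phi> \<psi>" if "\<phi> \<in> dual" for \<phi>
    using convergent_on_representing[OF that y] that assms(2)
    by (simp add: dual_ip_def y_def convergent_LIMSEQ_iff)
  then show ?thesis
    using that y by blast
qed

lemma tendsto_form_representing:
  assumes \<phi>: "\<phi> \<in> dual" and \<psi>: "\<psi> \<in> dual" and x: "represents x \<phi>"
  obtains y where "represents y \<psi>" "(\<lambda>n. B (x n) (y n)) \<longlonglongrightarrow> dual_ip \<phi> \<psi>"
proof -
  obtain y where y: "represents y \<psi>" "\<And>\<phi>. \<phi> \<in> dual \<Longrightarrow> (\<lambda>n. \<phi> (y n)) \<longlonglongrightarrow> dual_ip \<phi> \<psi>"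
    using tendsto_dual_ip_choice[OF \<phi> \<psi>] by blast
  have "(\<lambda>n. B (x n) (y n)) \<longlonglongrightarrow> dual_ip \<phi> \<psi>"
    using tendsto_diff[OF y(2)[OF \<phi>] diagonal_difference[OF x y(1)]] by simp
  then show ?thesis
    using that y(1) by blast
qed

lemma tendsto_cnj_swap:
  assumes "(\<lambda>n. B (x n) (y n)) \<longlonglongrightarrow> L"
  shows "(\<lambda>n. B (y n) (x n)) \<longlonglongrightarrow> cnj L"
proof -
  have "B (y n) (x n) = cnj (B (x n) (y n))" for n
    by (rule ip_commute) auto
  then show ?thesis
    using tendsto_cnj[OF assms] by simp
qed

lemma dual_ip_commute: "dual_ip \<phi> \<psi> = cnj (dual_ip \<psi> \<phi>)"
proof (cases "\<phi> \<in> dual \<and> \<psi> \<in> dual")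
  case True
  then obtain x where x: "represents x \<phi>" "\<And>\<psi>. \<psi> \<in> dual \<Longrightarrow> (\<lambda>n. \<psi> (x n)) \<longlonglongrightarrow> dual_ip \<psi> \<phi>"
    using tendsto_dual_ip_choice by blast
  obtain y where y: "represents y \<psi>" "(\<lambda>n. B (x n) (y n)) \<longlonglongrightarrow> dual_ip \<phi> \<psi>"
    using tendsto_form_representing[OF _ _ x(1)] True by blast
  have "(\<lambda>n. B (y n) (x n)) \<longlonglongrightarrow> dual_ip \<psi> \<phi>"
    using tendsto_diff[OF x(2)[of \<psi>] diagonal_difference[OF y(1) x(1)]] True by simp
  then have "dual_ip \<psi> \<phi> = cnj (dual_ip \<phi> \<psi>)"
    by (rule LIMSEQ_unique[OF _ tendsto_cnj_swap[OF y(2)]])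
  then show ?thesis
    by simp
qed (auto simp: dual_ip_def)

lemma tendsto_dual_ip:
  assumes \<phi>: "\<phi> \<in> dual" and \<psi>: "\<psi> \<in> dual" and y: "represents y \<psi>"
  shows "(\<lambda>n. \<phi> (y n)) \<longlonglongrightarrow> dual_ip \<phi> \<psi>"
proof -
  obtain x where x: "represents x \<phi>" "(\<lambda>n. B (y n) (x n)) \<longlonglongrightarrow> dual_ip \<psi> \<phi>"
    using tendsto_form_representing[OF \<psi> \<phi> y] by blast
  have "(\<lambda>n. B (x n) (y n)) \<longlonglongrightarrow> dual_ip \<phi> \<psi>"
    using tendsto_cnj_swap[OF x(2)] by (simp flip: dual_ip_commute)
  from tendsto_add[OF this diagonal_difference[OF x(1) y]] show ?thesis
    by simp
qed

lemma dual_ip_form: "\<phi> \<in> dual \<Longrightarrow> dual_ip \<phi> (B b) = \<phi> b"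
  using tendsto_dual_ip[OF _ form_in_dual represents_form, of \<phi> b] LIMSEQ_const_iff by metis

lemma dual_ip_add:
  assumes "\<phi> \<in> dual" "\<psi> \<in> dual" "\<rho> \<in> dual"
  shows "dual_ip (dual_add \<phi> \<psi>) \<rho> = dual_ip \<phi> \<rho> + dual_ip \<psi> \<rho>"
proof -
  obtain z where z: "represents z \<rho>"
    using exists_representing_sequence[OF assms(3)] by blast
  have "(\<lambda>n. dual_add \<phi> \<psi> (z n)) \<longlonglongrightarrow> dual_ip \<phi> \<rho> + dual_ip \<psi> \<rho>"
    unfolding dual_add_def using assms z by (intro tendsto_add tendsto_dual_ip)
  then show ?thesis
    using tendsto_dual_ip[OF dual_add_closed[OF assms(1,2)] assms(3) z] LIMSEQ_unique by blast
qed

lemma dual_ip_scale: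
  assumes "\<phi> \<in> dual" "\<rho> \<in> dual"
  shows "dual_ip (dual_scale c \<phi>) \<rho> = c * dual_ip \<phi> \<rho>"
proof -
  obtain z where z: "represents z \<rho>"
    using exists_representing_sequence[OF assms(2)] by blast
  have "(\<lambda>n. dual_scale c \<phi> (z n)) \<longlonglongrightarrow> c * dual_ip \<phi> \<rho>"
    unfolding dual_scale_def using assms z by (intro tendsto_mult_left tendsto_dual_ip)
  then show ?thesis
    using tendsto_dual_ip[OF dual_scale_closed[OF assms(1)] assms(2) z] LIMSEQ_unique by blast
qed

lemma tendsto_sq_representing:
  assumes \<phi>: "\<phi> \<in> dual" and x: "represents x \<phi>"
  shows "(\<lambda>n. of_real (sq (x n))) \<longlonglongrightarrow> dual_ip \<phi> \<phi>"
    and "(\<lambda>n. sq (x n)) \<longlonglongrightarrow> Re (dual_ip \<phi> \<phi>)"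
proof -
  have "(\<lambda>n. \<phi> (x n) - (\<phi> (x n) - B (x n) (x n))) \<longlonglongrightarrow> dual_ip \<phi> \<phi> - 0"
    by (intro tendsto_diff tendsto_dual_ip[OF \<phi> \<phi> x] diagonal_difference[OF x x])
  then show c: "(\<lambda>n. complex_of_real (sq (x n))) \<longlonglongrightarrow> dual_ip \<phi> \<phi>"
    by (simp add: ip_self)
  show "(\<lambda>n. sq (x n)) \<longlonglongrightarrow> Re (dual_ip \<phi> \<phi>)"
    using tendsto_Re[OF c] by simp
qed

lemma dual_ip_nonneg: "0 \<le> Re (dual_ip \<phi> \<phi>)"
proof (cases "\<phi> \<in> dual")
  case True
  then obtain x where "represents x \<phi>"
    using exists_representing_sequence by blast
  then show ?thesis
    by (intro LIMSEQ_le_const[OF tendsto_sq_representing(2)[OF True]]) auto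
qed (simp add: dual_ip_def)

lemma dual_ip_bound:
  assumes \<phi>: "\<phi> \<in> dual"
  shows "(cmod (\<phi> a))\<^sup>2 \<le> Re (dual_ip \<phi> \<phi>) * sq a"
proof -
  obtain x where x: "represents x \<phi>"
    using exists_representing_sequence[OF \<phi>] by blast
  have "(\<lambda>n. (cmod (B (x n) a))\<^sup>2) \<longlonglongrightarrow> (cmod (\<phi> a))\<^sup>2"
    using x unfolding represents_def by (intro tendsto_intros) auto
  moreover have "(\<lambda>n. sq (x n) * sq a) \<longlonglongrightarrow> Re (dual_ip \<phi> \<phi>) * sq a"
    by (intro tendsto_intros tendsto_sq_representing \<phi> x)
  ultimately show ?thesis
    by (rule LIMSEQ_le) (auto intro: cauchy_schwarz)
qed

text \<open>Together with \<open>dual_ip_bound\<close> this identifies the norm of the inner product with the norm of functionals.\<close>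

lemma dual_ip_least:
  assumes \<phi>: "\<phi> \<in> dual" and K: "0 \<le> K" "\<And>a. (cmod (\<phi> a))\<^sup>2 \<le> K * sq a"
  shows "Re (dual_ip \<phi> \<phi>) \<le> K"
proof -
  obtain x where x: "represents x \<phi>"
    using exists_representing_sequence[OF \<phi>] by blast
  let ?r = "Re (dual_ip \<phi> \<phi>)"
  have "(\<lambda>n. (cmod (\<phi> (x n)))\<^sup>2) \<longlonglongrightarrow> (cmod (dual_ip \<phi> \<phi>))\<^sup>2"
    by (intro tendsto_intros tendsto_dual_ip \<phi> x)
  moreover have "(\<lambda>n. K * sq (x n)) \<longlonglongrightarrow> K * ?r"
    by (intro tendsto_intros tendsto_sq_representing \<phi> x)
  ultimately have "(cmod (dual_ip \<phi> \<phi>))\<^sup>2 \<le> K * ?r"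
    by (rule LIMSEQ_le) (auto intro: K)
  moreover have "?r\<^sup>2 \<le> (cmod (dual_ip \<phi> \<phi>))\<^sup>2"
    by (intro power_mono complex_Re_le_cmod dual_ip_nonneg)
  ultimately have "?r * ?r \<le> K * ?r"
    by (simp add: power2_eq_square)
  then show ?thesis
    using dual_ip_nonneg[of \<phi>] K(1) by (cases "?r = 0") (auto simp: mult_le_cancel_right)
qed

sublocale dual: semi_inner_product_space dual "\<lambda>_. 0" dual_add dual_scale dual_ip
proof
  show "dual_ip x y = cnj (dual_ip y x)" for x y
    by (rule dual_ip_commute)
qed (simp_all add: zero_in_dual dual_add_closed dual_scale_closed dual_ip_add dual_ip_scale
    dual_ip_nonneg, auto simp: dual_add_def dual_scale_def algebra_simps)

lemma dual_subH: "dual.subH \<phi> \<psi> = (\<lambda>a. \<phi> a - \<psi> a)"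
  by (simp add: dual.subH_def dual_add_def dual_scale_def)

lemma dual_ip_definite: "\<phi> \<in> dual \<Longrightarrow> dual_ip \<phi> \<phi> = 0 \<Longrightarrow> \<phi> = (\<lambda>_. 0)"
  using dual_ip_bound[of \<phi>] by (intro ext) simp

lemma metric_space_dual: "Metric_space dual (\<lambda>x y. sqrt (dual.sq (dual.subH x y)))"
proof (rule dual.metric_space[OF dual_ip_definite])
  show "0 \<le> dual.sq (dual.subH x y)" for x y
    unfolding dual.sq_def by (rule dual_ip_nonneg)
  have neg: "dual.subH y x = dual_scale (-1) (dual.subH x y)" for x y
    by (simp add: dual_subH dual_scale_def)
  show "dual.sq (dual.subH x y) = dual.sq (dual.subH y x)" for x y
  proof (cases "dual.subH x y \<in> dual")
    case True
    then show ?thesis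
      unfolding neg[of y x] by (simp add: dual.sq_scale)
  next
    case False
    then have "dual.subH y x \<notin> dual"
      using neg[of x y] dual_scale_closed by metis
    then show ?thesis
      using False by (simp add: dual.sq_def dual_ip_def)
  qed
qed

text \<open>A Cauchy sequence of functionals converges pointwise, and uniformly on bounded sets, to a functional.\<close>

lemma mcomplete_dual:
  "Metric_space.mcomplete dual (\<lambda>x y. sqrt (dual.sq (dual.subH x y)))"
proof -
  define d where "d = (\<lambda>x y. sqrt (dual.sq (dual.subH x y)))"
  interpret M: Metric_space dual d
    unfolding d_def by (rule metric_space_dual)
  have pointwise: "(cmod (\<phi> a - \<psi> a))\<^sup>2 \<le> (d \<phi> \<psi>)\<^sup>2 * sq a" if "\<phi> \<in> dual" "\<psi> \<in> dual" for \<phi> \<psi> a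
    using dual_ip_bound[OF dual.subH_closed[OF that], of a] dual.sq_nonneg[OF dual.subH_closed[OF that]]
    by (simp add: d_def dual_subH dual.sq_def)
  have d_le: "d \<phi> \<psi> \<le> e"
    if "\<phi> \<in> dual" "\<psi> \<in> dual" "0 \<le> e" "\<And>a. (cmod (\<phi> a - \<psi> a))\<^sup>2 \<le> e\<^sup>2 * sq a" for \<phi> \<psi> e
  proof -
    have "dual.sq (dual.subH \<phi> \<psi>) \<le> e\<^sup>2"
      unfolding dual.sq_def using that
      by (intro dual_ip_least dual.subH_closed) (auto simp: dual_subH)
    then show ?thesis
      unfolding d_def using that(3) by (intro real_le_lsqrt) (auto simp: dual.sq_def dual_ip_nonneg)
  qed
  have "\<exists>\<phi>. limitin M.mtopology \<sigma> \<phi> sequentially" if \<sigma>: "M.MCauchy \<sigma>" for \<sigma>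
  proof -
    have \<sigma>_dual: "\<sigma> n \<in> dual" for n
      using \<sigma> by (auto simp: M.MCauchy_def)
    have cauchy: "\<exists>N. \<forall>m n. N \<le> m \<longrightarrow> N \<le> n \<longrightarrow> d (\<sigma> m) (\<sigma> n) < e" if "0 < e" for e
      using \<sigma> that unfolding M.MCauchy_def by simp
    have "convergent (\<lambda>n. \<sigma> n a)" for a
    proof -
      have "Cauchy (\<lambda>n. \<sigma> n a)"
      proof (rule CauchyI)
        fix e :: real
        assume e: "0 < e"
        define s where "s = sqrt (sq a) + 1"
        have s: "0 < s" "sq a \<le> s\<^sup>2"
          by (auto simp: s_def add_nonneg_pos power2_sum)
        obtain N where N: "\<And>m n. N \<le> m \<Longrightarrow> N \<le> n \<Longrightarrow> d (\<sigma> m) (\<sigma> n) < e / s"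
          using cauchy[of "e / s"] e s by (meson divide_pos_pos)
        have "norm (\<sigma> m a - \<sigma> n a) < e" if "N \<le> m" "N \<le> n" for m n
        proof -
          have "(cmod (\<sigma> m a - \<sigma> n a))\<^sup>2 \<le> (d (\<sigma> m) (\<sigma> n))\<^sup>2 * s\<^sup>2"
            using pointwise[OF \<sigma>_dual[of m] \<sigma>_dual[of n], of a] s
            by (meson mult_left_mono order_trans zero_le_power2)
          then have "cmod (\<sigma> m a - \<sigma> n a) \<le> d (\<sigma> m) (\<sigma> n) * s"
            using s by (intro power2_le_imp_le[of "cmod (\<sigma> m a - \<sigma> n a)"]) (auto simp: power_mult_distrib)
          also have "\<dots> < e"
            using N[OF that] s by (simp add: field_simps)
          finally show ?thesis
            by simp
        qed
        then show "\<exists>M. \<forall>m\<ge>M. \<forall>n\<ge>M. norm (\<sigma> m a - \<sigma> n a) < e"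
          by blast
      qed
      then show ?thesis
        by (simp add: Cauchy_convergent_iff)
    qed
    then obtain \<phi> where lim: "\<And>a. (\<lambda>n. \<sigma> n a) \<longlonglongrightarrow> \<phi> a"
      unfolding convergent_def by metis
    have tail: "\<exists>N. \<forall>n\<ge>N. \<forall>a. (cmod (\<sigma> n a - \<phi> a))\<^sup>2 \<le> e\<^sup>2 * sq a" if e: "0 < e" for e
    proof -
      obtain N where N: "\<And>m n. N \<le> m \<Longrightarrow> N \<le> n \<Longrightarrow> d (\<sigma> m) (\<sigma> n) < e"
        using cauchy[OF e] by blast
      have "(cmod (\<sigma> n a - \<phi> a))\<^sup>2 \<le> e\<^sup>2 * sq a" if "N \<le> n" for n a
      proof (rule LIMSEQ_le_const2)
        show "(\<lambda>m. (cmod (\<sigma> n a - \<sigma> m a))\<^sup>2) \<longlonglongrightarrow> (cmod (\<sigma> n a - \<phi> a))\<^sup>2"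
          by (intro tendsto_intros lim)
        have "(cmod (\<sigma> n a - \<sigma> m a))\<^sup>2 \<le> e\<^sup>2 * sq a" if "N \<le> m" for m
        proof -
          have "(d (\<sigma> n) (\<sigma> m))\<^sup>2 \<le> e\<^sup>2"
            using N[OF \<open>N \<le> n\<close> that] by (intro power_mono) auto
          then have "(d (\<sigma> n) (\<sigma> m))\<^sup>2 * sq a \<le> e\<^sup>2 * sq a"
            by (intro mult_right_mono) auto
          then show ?thesis
            using pointwise[OF \<sigma>_dual[of n] \<sigma>_dual[of m], of a] by simp
        qed
        then show "\<exists>M. \<forall>m\<ge>M. (cmod (\<sigma> n a - \<sigma> m a))\<^sup>2 \<le> e\<^sup>2 * sq a"
          by blast
      qed
      then show ?thesis
        by blast
    qed
    have "\<phi> \<in> dual"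
    proof -
      obtain N where N: "\<And>a. (cmod (\<sigma> N a - \<phi> a))\<^sup>2 \<le> 1\<^sup>2 * sq a"
        using tail[of 1] by auto
      obtain K where K: "\<And>a. (cmod (\<sigma> N a))\<^sup>2 \<le> K * sq a"
        using dual_bound[OF \<sigma>_dual] by blast
      have bound: "(cmod (\<phi> a))\<^sup>2 \<le> (2 * K + 2) * sq a" for a
        using norm_add_square_le[of "\<sigma> N a" "\<phi> a - \<sigma> N a"] N[of a] K[of a]
        by (simp add: norm_minus_commute algebra_simps)
      show ?thesis
      proof (rule dualI[OF _ _ bound])
        fix x y c
        have "(\<lambda>n. \<sigma> n (x + y)) \<longlonglongrightarrow> \<phi> x + \<phi> y"
          unfolding dual_add_arg[OF \<sigma>_dual] by (intro tendsto_add lim)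
        then show "\<phi> (x + y) = \<phi> x + \<phi> y"
          using lim LIMSEQ_unique by blast
        have "(\<lambda>n. \<sigma> n (scaleC c x)) \<longlonglongrightarrow> cnj c * \<phi> x"
          unfolding dual_scale_arg[OF \<sigma>_dual] by (intro tendsto_mult_left lim)
        then show "\<phi> (scaleC c x) = cnj c * \<phi> x"
          using lim LIMSEQ_unique by blast
      qed
    qed
    have "\<exists>N. \<forall>n\<ge>N. d (\<sigma> n) \<phi> < e" if e: "0 < e" for e
    proof -
      obtain N where N: "\<And>n a. N \<le> n \<Longrightarrow> (cmod (\<sigma> n a - \<phi> a))\<^sup>2 \<le> (e/2)\<^sup>2 * sq a"
        using tail[of "e/2"] e by auto
      have "d (\<sigma> n) \<phi> \<le> e/2" if "N \<le> n" for n
        using N[OF that] e by (intro d_le \<sigma>_dual \<open>\<phi> \<in> dual\<close>) auto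
      then show ?thesis
        using e by (intro exI[of _ N]) force
    qed
    then have "limitin M.mtopology \<sigma> \<phi> sequentially"
      unfolding M.limit_metric_sequentially using \<open>\<phi> \<in> dual\<close> \<sigma>_dual by blast
    then show ?thesis
      by blast
  qed
  then have "M.mcomplete"
    unfolding M.mcomplete_def by blast
  then show ?thesis
    unfolding d_def .
qed

theorem dual_hilbert_space: "complex_hilbert_space dual (\<lambda>_. 0) dual_add dual_scale dual_ip"
proof
  show "Metric_space.mcomplete dual (\<lambda>x y. sqrt (Re (dual_ip (dual_add x (dual_scale (- 1) y))
      (dual_add x (dual_scale (- 1) y)))))"
    using mcomplete_dual unfolding dual.sq_def dual.subH_def .
  show "x = (\<lambda>_. 0)" if "x \<in> dual" "dual_ip x x = 0" for x
    using dual_ip_definite that by blast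
  show "dual_ip x y = cnj (dual_ip y x)" for x y
    by (rule dual_ip_commute)
qed (auto simp: dual.zero_closed dual.add_closed dual.scale_closed dual.add_assoc dual.add_zero
    dual.add_neg dual.scale_one dual.scale_scale dual.scale_add_right dual.scale_add_left
    dual.ip_add dual.ip_scale dual.ip_nonneg intro: dual.add_commute)

end

section \<open>The representation of a quasi-state\<close>

sublocale algebra_form \<subseteq> H: complex_hilbert_space dual "\<lambda>_. 0" dual_add dual_scale dual_ip
  by (rule dual_hilbert_space)

lemma (in algebra_form) metric_space_distH: "Metric_space dual H.distH"
  unfolding H.distH_eq by (rule metric_space_dual)

lemma (in algebra_form) normH_eq: "H.normH \<phi> = sqrt (dual.sq \<phi>)"
  by (simp add: H.normH_def dual.sq_def)

locale gns =
  fixes J :: "'a::cstar_algebra set" and F :: "'a \<Rightarrow> real"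
  assumes J: "closed_ideal J" and F: "F \<in> quasi_states J"
begin

lemma F_add: "F (x + y) = F x + F y"
  and F_scaleR: "F (r *\<^sub>R x) = r * F x"
  and F_star: "F (star x) = F x"
  and F_square: "(F x)\<^sup>2 \<le> F (star x * x)"
  and F_norm: "\<bar>F x\<bar> \<le> norm x"
  and F_ideal: "x \<in> J \<Longrightarrow> star x = x \<Longrightarrow> F x = 0"
  using F by (auto simp: quasi_states_def)

text \<open>The complex-linear functional with real part \<open>F\<close>.\<close>

definition cF :: "'a \<Rightarrow> complex" where
  "cF x = Complex (F x) (- F (scaleC \<i> x))"

definition form :: "'a \<Rightarrow> 'a \<Rightarrow> complex" where
  "form x y = cF (star y * x)"

text \<open>Under \<open>\<eta> \<mapsto> \<langle>\<eta>, \<cdot>\<rangle>\<close> left multiplication by \<open>x\<close> becomes composition with left multiplication by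
  \<open>x\<^sup>*\<close>.\<close>

definition act :: "'a \<Rightarrow> ('a \<Rightarrow> complex) \<Rightarrow> 'a \<Rightarrow> complex" where
  "act x \<phi> = (\<lambda>a. \<phi> (star x * a))"

text \<open>The functional itself, as a vector. It plays the role of the unit, which the algebra need not have:
  \<open>act x cyclic\<close> is \<open>\<langle>x, \<cdot>\<rangle>\<close>.\<close>

definition cyclic :: "'a \<Rightarrow> complex" where
  "cyclic a = cF (star a)"

lemma Re_cF [simp]: "Re (cF x) = F x"
  by (simp add: cF_def)

lemma cF_add: "cF (x + y) = cF x + cF y"
  by (simp add: cF_def F_add scaleC_add_right complex_eq_iff)

lemma cF_scaleC: "cF (scaleC c x) = c * cF x"
proof -
  have F_scaleC: "F (scaleC c x) = Re c * F x + Im c * F (scaleC \<i> x)" for c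
  proof -
    have "c = of_real (Re c) + of_real (Im c) * \<i>"
      by (simp add: complex_eq_iff)
    then have "scaleC c x = scaleC (of_real (Re c) + of_real (Im c) * \<i>) x"
      by (rule arg_cong)
    also have "\<dots> = Re c *\<^sub>R x + Im c *\<^sub>R scaleC \<i> x"
      by (simp only: scaleC_add_left scaleC_of_real flip: scaleC_scaleC)
    finally show ?thesis
      by (simp add: F_add F_scaleR)
  qed
  show ?thesis
    using F_scaleC[of c] F_scaleC[of "\<i> * c"]
    by (simp add: cF_def complex_eq_iff scaleC_scaleC)
qed

lemma cF_star: "cF (star x) = cnj (cF x)"
proof -
  have "F (scaleC \<i> (star x)) = F (star (scaleC (- \<i>) x))"
    by (simp add: star_scaleC)
  also have "\<dots> = - F (scaleC \<i> x)"
    using F_scaleR[of "-1" "scaleC \<i> x"] by (simp add: F_star scaleC_minus_left)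
  finally show ?thesis
    by (simp add: cF_def F_star complex_eq_iff)
qed

sublocale algebra_form form
proof unfold_locales
  show "form x y = cnj (form y x)" for x y
    unfolding form_def by (simp add: star_mult star_star flip: cF_star)
  show "0 \<le> Re (form x x)" for x
    using order_trans[OF zero_le_power2 F_square, of x] by (simp add: form_def)
qed (auto simp: form_def cF_add cF_scaleC scaleC_add_right scaleC_add_left scaleC_scaleC
    mult_scaleC_right distrib_left scaleC_minus_left)

lemma sq_eq: "sq a = F (star a * a)"
  by (simp add: sq_def form_def)

lemma sq_mult_le: "sq (x * a) \<le> (norm x)\<^sup>2 * sq a"
  unfolding sq_eq by (rule quasi_state_star_mult_le[OF F])

lemma sq_le_norm: "sq a \<le> (norm a)\<^sup>2"
  using F_norm[of "star a * a"] by (simp add: sq_eq cstar_identity)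

lemma act_bound:
  assumes "\<phi> \<in> dual"
  shows "(cmod (act x \<phi> a))\<^sup>2 \<le> ((norm x)\<^sup>2 * dual.sq \<phi>) * sq a"
proof -
  have "(cmod (act x \<phi> a))\<^sup>2 \<le> dual.sq \<phi> * sq (star x * a)"
    unfolding act_def dual.sq_def by (rule dual_ip_bound[OF assms])
  also have "\<dots> \<le> dual.sq \<phi> * ((norm x)\<^sup>2 * sq a)"
    using sq_mult_le[of "star x" a] dual.sq_nonneg[OF assms] by (intro mult_left_mono) auto
  finally show ?thesis
    by (simp add: mult_ac)
qed

lemma act_closed:
  assumes "\<phi> \<in> dual"
  shows "act x \<phi> \<in> dual"
  by (rule dualI[OF _ _ act_bound[OF assms]])
    (auto simp: act_def distrib_left mult_scaleC_right dual_add_arg dual_scale_arg assms)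

lemma act_contractive:
  assumes "\<phi> \<in> dual"
  shows "dual.sq (act x \<phi>) \<le> (norm x)\<^sup>2 * dual.sq \<phi>"
  unfolding dual.sq_def[of "act x \<phi>"]
  by (rule dual_ip_least[OF act_closed[OF assms] _ act_bound[OF assms]])
    (simp add: dual.sq_nonneg assms)

lemma act_mult: "act (x * y) \<phi> = act x (act y \<phi>)"
  by (simp add: act_def star_mult mult.assoc)

lemma act_add: "\<phi> \<in> dual \<Longrightarrow> act (x + y) \<phi> = dual_add (act x \<phi>) (act y \<phi>)"
  by (simp add: act_def dual_add_def star_add distrib_right dual_add_arg)

lemma act_scaleC: "\<phi> \<in> dual \<Longrightarrow> act (scaleC c x) \<phi> = dual_scale c (act x \<phi>)"
  by (simp add: act_def dual_scale_def star_scaleC mult_scaleC_left dual_scale_arg)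

lemma act_dual_add: "act x (dual_add \<phi> \<psi>) = dual_add (act x \<phi>) (act x \<psi>)"
  by (simp add: act_def dual_add_def)

lemma act_dual_scale: "act x (dual_scale c \<phi>) = dual_scale c (act x \<phi>)"
  by (simp add: act_def dual_scale_def)

lemma act_adjoint:
  assumes \<phi>: "\<phi> \<in> dual" and \<psi>: "\<psi> \<in> dual"
  shows "dual_ip (act x \<phi>) \<psi> = dual_ip \<phi> (act (star x) \<psi>)"
proof -
  obtain y where y: "represents y \<psi>"
    using exists_representing_sequence[OF \<psi>] by blast
  \<comment> \<open>Multiplication by \<open>x\<^sup>*\<close> turns a sequence that represents \<open>\<psi>\<close> into one that represents \<open>x\<^sup>* \<psi>\<close>.\<close>
  have "represents (\<lambda>n. star x * y n) (act (star x) \<psi>)"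
    unfolding represents_def
  proof (intro conjI allI impI)
    fix e :: real
    assume e: "0 < e"
    have "0 < (norm x)\<^sup>2 + 1"
      by (intro add_nonneg_pos) auto
    then have "0 < e / ((norm x)\<^sup>2 + 1)"
      using e by simp
    then obtain N where N: "\<And>m n. N \<le> m \<Longrightarrow> N \<le> n \<Longrightarrow> sq (y m - y n) < e / ((norm x)\<^sup>2 + 1)"
      using y unfolding represents_def by meson
    have "sq (star x * y m - star x * y n) < e" if "N \<le> m" "N \<le> n" for m n
    proof -
      have "sq (star x * y m - star x * y n) \<le> (norm x)\<^sup>2 * sq (y m - y n)"
        using sq_mult_le[of "star x" "y m - y n"] by (simp add: right_diff_distrib)
      also have "\<dots> \<le> ((norm x)\<^sup>2 + 1) * sq (y m - y n)"
        by (intro mult_right_mono) auto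
      also have "\<dots> < e"
        using N[OF that] \<open>0 < (norm x)\<^sup>2 + 1\<close> by (simp add: field_simps)
      finally show ?thesis .
    qed
    then show "\<exists>N. \<forall>m\<ge>N. \<forall>n\<ge>N. sq (star x * y m - star x * y n) < e"
      by blast
  next
    fix a
    have "form (star x * y n) a = form (y n) (x * a)" for n
      by (simp add: form_def star_mult mult.assoc)
    then show "(\<lambda>n. form (star x * y n) a) \<longlonglongrightarrow> act (star x) \<psi> a"
      using y by (simp add: represents_def act_def star_star)
  qed
  then have "(\<lambda>n. \<phi> (star x * y n)) \<longlonglongrightarrow> dual_ip \<phi> (act (star x) \<psi>)"
    by (intro tendsto_dual_ip \<phi> act_closed \<psi>)
  moreover have "(\<lambda>n. act x \<phi> (y n)) \<longlonglongrightarrow> dual_ip (act x \<phi>) \<psi>"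
    by (intro tendsto_dual_ip act_closed \<phi> \<psi> y)
  ultimately show ?thesis
    unfolding act_def using LIMSEQ_unique by blast
qed

lemma representation_act: "H.representation act"
  unfolding H.representation_def
proof (intro conjI allI ballI)
  show "H.bounded_operator (act x)" for x
    unfolding H.bounded_operator_def
  proof (intro conjI allI ballI exI)
    show "H.normH (act x \<phi>) \<le> norm x * H.normH \<phi>" if "\<phi> \<in> dual" for \<phi>
      using real_sqrt_le_mono[OF act_contractive[OF that, of x]]
      by (simp add: normH_eq real_sqrt_mult)
  qed (auto simp: act_closed act_dual_add act_dual_scale)
qed (auto simp: act_add act_scaleC act_mult act_adjoint)

lemma act_ideal:
  assumes "j \<in> J" "\<phi> \<in> dual"
  shows "act j \<phi> = (\<lambda>_. 0)"
proof
  fix a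
  have "star (star j * a) * (star j * a) = star a * (j * star j) * a"
    by (simp add: star_mult star_star mult.assoc)
  then have "sq (star j * a) = F (star a * (j * star j) * a)"
    by (simp add: sq_eq)
  also have "\<dots> = 0"
    using assms(1) J
    by (intro F_ideal) (auto simp: closed_ideal_simps star_mult star_star mult.assoc)
  finally show "act j \<phi> a = 0"
    using dual_ip_bound[OF assms(2), of "star j * a"] by (simp add: act_def)
qed

text \<open>A scalar of modulus one turns the value of the functional into its real part.\<close>

lemma cmod_cF_le: "(cmod (cF x))\<^sup>2 \<le> F (star x * x)"
proof (cases "cF x = 0")
  case False
  define c where "c = cnj (cF x) / of_real (cmod (cF x))"
  have c: "cmod c = 1"
    using False by (simp add: c_def norm_divide)
  have "c * cF x = of_real (cmod (cF x))"
    using False by (simp add: c_def complex_norm_square[symmetric] power2_eq_square mult.commute)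
  then have "cF (scaleC c x) = of_real (cmod (cF x))"
    by (simp add: cF_scaleC)
  then have "F (scaleC c x) = cmod (cF x)"
    by (metis Re_cF Re_complex_of_real)
  moreover have "star (scaleC c x) * scaleC c x = star x * x"
  proof -
    have "cnj c * c = 1"
      using c by (metis complex_norm_square mult.commute of_real_1 power_one)
    then show ?thesis
      by (simp add: star_scaleC mult_scaleC_left mult_scaleC_right scaleC_scaleC mult.commute)
  qed
  ultimately show ?thesis
    using F_square[of "scaleC c x"] by simp
qed (use order_trans[OF zero_le_power2 F_square] in simp)

lemma cyclic_bound: "(cmod (cyclic a))\<^sup>2 \<le> 1 * sq a"
  using cmod_cF_le[of a] by (simp add: cyclic_def cF_star sq_eq)

lemma cyclic_in_dual: "cyclic \<in> dual"
  by (rule dualI[OF _ _ cyclic_bound]) (auto simp: cyclic_def star_add star_scaleC cF_add cF_scaleC)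

lemma sq_cyclic_le: "dual.sq cyclic \<le> 1"
  unfolding dual.sq_def by (rule dual_ip_least[OF cyclic_in_dual _ cyclic_bound]) simp

lemma act_cyclic: "act x cyclic = form x"
  by (simp add: act_def cyclic_def form_def star_mult star_star fun_eq_iff)

lemma dual_ip_act_cyclic: "dual_ip (act x cyclic) cyclic = cF x"
proof -
  have "dual_ip (act x cyclic) cyclic = cnj (dual_ip cyclic (form x))"
    unfolding act_cyclic by (rule dual_ip_commute)
  also have "\<dots> = cF x"
    by (simp add: dual_ip_form cyclic_in_dual cyclic_def cF_star)
  finally show ?thesis .
qed

lemma dual_ip_zero: "dual_ip (\<lambda>_. 0) \<psi> = 0"
proof (cases "\<psi> \<in> dual")
  case True
  then show ?thesis
    using dual_ip_scale[OF zero_in_dual True, of 0] by (simp add: dual_scale_def)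
qed (simp add: dual_ip_def)

lemma vector_functional_in_quasi_states:
  assumes \<eta>: "\<eta> \<in> dual" and c: "0 < c" "dual.sq \<eta> \<le> c"
  shows "(\<lambda>x. Re (dual_ip (act x \<eta>) \<eta>) / c) \<in> quasi_states J"
proof -
  define g where "g x = Re (dual_ip (act x \<eta>) \<eta>)" for x
  have g_square: "(g x)\<^sup>2 \<le> dual.sq (act x \<eta>) * c" for x
  proof -
    have "(g x)\<^sup>2 \<le> (cmod (dual_ip (act x \<eta>) \<eta>))\<^sup>2"
      unfolding g_def by (rule power2_le_iff_abs_le[THEN iffD2]) (auto simp: abs_Re_le_cmod)
    also have "\<dots> \<le> dual.sq (act x \<eta>) * dual.sq \<eta>"
      by (intro dual.cauchy_schwarz act_closed \<eta>)
    also have "\<dots> \<le> dual.sq (act x \<eta>) * c"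
      by (intro mult_left_mono c dual.sq_nonneg act_closed \<eta>)
    finally show ?thesis .
  qed
  have sq_act: "dual.sq (act x \<eta>) = g (star x * x)" for x
  proof -
    have "dual.sq (act x \<eta>) = Re (dual_ip \<eta> (act (star x) (act x \<eta>)))"
      by (simp add: dual.sq_def act_adjoint act_closed \<eta>)
    also have "\<dots> = Re (cnj (dual_ip (act (star x * x) \<eta>) \<eta>))"
      by (simp add: act_mult flip: dual_ip_commute)
    finally show ?thesis
      by (simp add: g_def)
  qed
  have "g (x + y) = g x + g y" for x y
    by (simp add: g_def act_add dual_ip_add act_closed \<eta>)
  moreover have "g (r *\<^sub>R x) = r * g x" for r x
  proof -
    have "act (r *\<^sub>R x) \<eta> = dual_scale (of_real r) (act x \<eta>)"
      using act_scaleC[OF \<eta>, of "of_real r" x] by (simp add: scaleC_of_real)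
    then show ?thesis
      by (simp add: g_def dual_ip_scale act_closed \<eta>)
  qed
  moreover have "g (star x) = g x" for x
  proof -
    have "dual_ip (act (star x) \<eta>) \<eta> = cnj (dual_ip (act x \<eta>) \<eta>)"
      using act_adjoint[OF \<eta> \<eta>, of "star x"] dual_ip_commute[of \<eta> "act x \<eta>"] by (simp add: star_star)
    then show ?thesis
      by (simp add: g_def)
  qed
  moreover have "(g x / c)\<^sup>2 \<le> g (star x * x) / c" for x
    using g_square[of x] c(1) unfolding sq_act
    by (simp add: power_divide divide_simps power2_eq_square mult_ac)
  moreover have "\<bar>g x / c\<bar> \<le> norm x" for x
  proof -
    have "dual.sq (act x \<eta>) * c \<le> ((norm x)\<^sup>2 * c) * c"
      using order_trans[OF act_contractive[OF \<eta>, of x] mult_left_mono[OF c(2)]] c(1)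
      by (intro mult_right_mono) auto
    then have "(g x)\<^sup>2 \<le> (norm x * c)\<^sup>2"
      using g_square[of x] by (simp add: power_mult_distrib power2_eq_square mult_ac)
    then have "\<bar>g x\<bar> \<le> norm x * c"
      using c(1) by (simp add: power2_le_iff_abs_le)
    then show ?thesis
      using c(1) by (simp add: field_simps)
  qed
  moreover have "g j = 0" if "j \<in> J" for j
    by (simp add: g_def act_ideal that \<eta> dual_ip_zero)
  ultimately show ?thesis
    unfolding quasi_states_def mem_Collect_eq g_def[symmetric]
    by (simp add: add_divide_distrib)
qed

text \<open>The subspace contains all \<open>\<langle>b, \<cdot>\<rangle>\<close>, and pairing with these evaluates a functional at \<open>b\<close>; so nothing is
  orthogonal to it.\<close>

lemma invariant_subspace_containing_cyclic:
  assumes W: "H.closed_subspace W" "\<And>x \<phi>. \<phi> \<in> W \<Longrightarrow> act x \<phi> \<in> W" and "cyclic \<in> W"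
  shows "W = dual"
proof
  show "W \<subseteq> dual"
    using W by (simp add: H.closed_subspace_def)
  show "dual \<subseteq> W"
  proof
    fix \<phi>
    assume \<phi>: "\<phi> \<in> dual"
    obtain w where w: "w \<in> W" "\<And>v. v \<in> W \<Longrightarrow> dual_ip w v = dual_ip \<phi> v"
      using H.orthogonal_projection[OF metric_space_distH W(1) \<phi>] by blast
    have "form b \<in> W" for b
      using W(2)[OF assms(3), of b] by (simp add: act_cyclic)
    then have "w b = \<phi> b" for b
      using w(2)[of "form b"] dual_ip_form w(1) \<phi> \<open>W \<subseteq> dual\<close> by (metis subsetD)
    then show "\<phi> \<in> W"
      using w(1) by (metis ext)
  qed
qed

text \<open>Split the cyclic vector \<open>\<xi>\<close> as \<open>\<eta> + \<zeta>\<close> along \<open>W\<close>. As \<open>W\<close> is invariant, \<open>F\<close> is the sum of the vector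
  functionals of \<open>\<eta>\<close> and \<open>\<zeta>\<close>, which is a convex combination of two quasi-states. If \<open>\<eta>\<close> and \<open>\<zeta>\<close> are nonzero,
  extremality makes the functional of \<open>\<eta>\<close> a multiple \<open>t F\<close>, which forces \<open>\<eta> = t \<xi>\<close>; so \<open>\<xi>\<close> is in \<open>W\<close>. If
  \<open>\<eta> = 0\<close>, then \<open>W\<close> is orthogonal to \<open>A \<xi>\<close> and vanishes.\<close>

lemma invariant_subspace_of_extreme:
  assumes extreme: "extreme_in (quasi_states J) F"
    and W: "H.closed_subspace W" "\<And>x \<phi>. \<phi> \<in> W \<Longrightarrow> act x \<phi> \<in> W"
  shows "W = {\<lambda>_. 0} \<or> W = dual"
proof -
  have W_sub: "W \<subseteq> dual" and W_zero: "(\<lambda>_. 0) \<in> W" and W_scale: "\<And>c \<phi>. \<phi> \<in> W \<Longrightarrow> dual_scale c \<phi> \<in> W"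
    using W(1) by (auto simp: H.closed_subspace_def)
  obtain \<eta> where \<eta>W: "\<eta> \<in> W" and \<eta>: "\<And>v. v \<in> W \<Longrightarrow> dual_ip \<eta> v = dual_ip cyclic v"
    using H.orthogonal_projection[OF metric_space_distH W(1) cyclic_in_dual] by blast
  have \<eta>D: "\<eta> \<in> dual"
    using \<eta>W W_sub by blast
  define \<zeta> where "\<zeta> = dual.subH cyclic \<eta>"
  have \<zeta>D: "\<zeta> \<in> dual"
    unfolding \<zeta>_def by (intro dual.subH_closed cyclic_in_dual \<eta>D)
  have \<zeta>_orth: "dual_ip \<zeta> v = 0" if "v \<in> W" for v
    using that W_sub \<eta> by (simp add: \<zeta>_def dual.ip_sub cyclic_in_dual \<eta>D subset_iff)
  have split: "cyclic = dual_add \<eta> \<zeta>"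
    by (simp add: \<zeta>_def dual_subH dual_add_def)
  define t where "t = dual.sq \<eta>"
  define s where "s = dual.sq \<zeta>"
  have nonneg: "0 \<le> t" "0 \<le> s"
    by (simp_all add: t_def s_def dual.sq_nonneg \<eta>D \<zeta>D)
  have \<eta>_\<zeta>: "dual_ip \<eta> \<zeta> = 0"
    using \<zeta>_orth[OF \<eta>W] dual_ip_commute[of \<eta> \<zeta>] by simp
  have "dual.sq cyclic = t + s"
    using dual.sq_add_scale[OF \<eta>D \<zeta>D, of 1]
    by (simp add: split \<eta>_\<zeta> t_def s_def dual.scale_one \<zeta>D)
  then have ts: "t + s \<le> 1"
    using sq_cyclic_le by simp
  have F_split: "F x = Re (dual_ip (act x \<eta>) \<eta>) + Re (dual_ip (act x \<zeta>) \<zeta>)" for x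
  proof -
    have "dual_ip (act x \<eta>) \<zeta> = 0"
      using \<zeta>_orth[OF W(2)[OF \<eta>W, of x]] dual_ip_commute[of "act x \<eta>" \<zeta>] by simp
    moreover have "dual_ip (act x \<zeta>) \<eta> = 0"
      using \<zeta>_orth[OF W(2)[OF \<eta>W, of "star x"]] by (simp add: act_adjoint \<zeta>D \<eta>D)
    moreover have "F x = Re (dual_ip (act x cyclic) cyclic)"
      by (simp add: dual_ip_act_cyclic)
    ultimately show ?thesis
      by (simp add: split act_dual_add dual.ip_add dual.ip_add_right act_closed dual_add_closed \<eta>D \<zeta>D)
  qed
  consider "t = 0" | "s = 0" | "0 < t" "t < 1"
    using nonneg ts by linarith
  then show ?thesis
  proof cases
    case 1
    then have "\<eta> = (\<lambda>_. 0)"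
      using dual.ip_self[OF \<eta>D] by (intro dual_ip_definite \<eta>D) (simp add: t_def)
    have "w = (\<lambda>_. 0)" if w: "w \<in> W" for w
    proof
      fix a
      have wD: "w \<in> dual"
        using w W_sub by blast
      have "w a = dual_ip w (act a cyclic)"
        by (simp add: act_cyclic dual_ip_form wD)
      also have "\<dots> = dual_ip (act (star a) w) cyclic"
        by (simp add: act_adjoint wD cyclic_in_dual star_star)
      also have "\<dots> = cnj (dual_ip \<eta> (act (star a) w))"
        by (subst dual_ip_commute) (simp add: \<eta> W(2) w)
      finally show "w a = 0"
        by (simp add: \<open>\<eta> = (\<lambda>_. 0)\<close> dual_ip_zero)
    qed
    then show ?thesis
      using W_zero by blast
  next
    case 2
    then have "\<zeta> = (\<lambda>_. 0)"
      using dual.ip_self[OF \<zeta>D] by (intro dual_ip_definite \<zeta>D) (simp add: s_def)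
    then have "cyclic \<in> W"
      using \<eta>W by (simp add: split dual_add_def)
    then show ?thesis
      using invariant_subspace_containing_cyclic W by blast
  next
    case 3
    define G where "G x = Re (dual_ip (act x \<eta>) \<eta>) / t" for x
    \<comment> \<open>Dividing by \<open>1 - t\<close> and not by \<open>s\<close> gives a convex combination even if \<open>t + s < 1\<close>.\<close>
    define G' where "G' x = Re (dual_ip (act x \<zeta>) \<zeta>) / (1 - t)" for x
    have "G \<in> quasi_states J"
      unfolding G_def by (rule vector_functional_in_quasi_states) (use 3 \<eta>D in \<open>auto simp: t_def\<close>)
    moreover have "G' \<in> quasi_states J"
      unfolding G'_def using 3 ts by (intro vector_functional_in_quasi_states \<zeta>D) (auto simp: s_def)
    moreover have "F = (\<lambda>x. t * G x + (1 - t) * G' x)"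
      using 3 by (simp add: G_def G'_def F_split fun_eq_iff)
    ultimately have "G = F"
      using extreme 3 unfolding extreme_in_def by blast
    define \<rho> where "\<rho> = dual.subH \<eta> (dual_scale (of_real t) cyclic)"
    have \<rho>D: "\<rho> \<in> dual"
      unfolding \<rho>_def by (intro dual.subH_closed dual_scale_closed \<eta>D cyclic_in_dual)
    have Re_zero: "Re (\<rho> (star x)) = 0" for x
    proof -
      have "dual_ip (act x \<eta>) cyclic = dual_ip (act x \<eta>) \<eta>"
        using \<eta>[OF W(2)[OF \<eta>W, of x]] dual_ip_commute by metis
      then have "Re (dual_ip (act x \<eta>) cyclic) = t * F x"
        using 3 \<open>G = F\<close> by (auto simp: G_def fun_eq_iff field_simps)
      moreover have "\<eta> (star x) = dual_ip (act x \<eta>) cyclic"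
        by (simp add: act_adjoint act_cyclic dual_ip_form \<eta>D cyclic_in_dual)
      ultimately show ?thesis
        by (simp add: \<rho>_def dual_subH dual_scale_def cyclic_def star_star)
    qed
    have "\<rho> a = 0" for a
    proof -
      have "Im (\<rho> a) = - Re (\<rho> (scaleC (- \<i>) a))"
        by (simp add: dual_scale_arg \<rho>D)
      then show ?thesis
        using Re_zero[of "star a"] Re_zero[of "star (scaleC (- \<i>) a)"]
        by (simp add: star_star complex_eq_iff)
    qed
    then have "\<eta> = dual_scale (of_real t) cyclic"
      by (simp add: \<rho>_def dual_subH fun_eq_iff)
    then have "cyclic = dual_scale (of_real (1/t)) \<eta>"
      using 3 by (simp add: dual_scale_def)
    then have "cyclic \<in> W"
      using W_scale[OF \<eta>W] by metis
    then show ?thesis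
      using invariant_subspace_containing_cyclic W by blast
  qed
qed

lemma closed_ideal_kernel: "closed_ideal (H.kernel act)"
proof -
  have kernel: "x \<in> H.kernel act \<longleftrightarrow> (\<forall>\<phi>\<in>dual. \<forall>a. \<phi> (star x * a) = 0)" for x
    by (auto simp: H.kernel_def act_def fun_eq_iff)
  have lin: "bounded_linear \<phi>" if \<phi>: "\<phi> \<in> dual" for \<phi>
  proof -
    obtain K where K: "0 \<le> K" "\<And>a. (cmod (\<phi> a))\<^sup>2 \<le> K * sq a"
      using dual_bound[OF \<phi>] by blast
    show ?thesis
    proof (rule bounded_linear_intro[where K="sqrt K"])
      show "\<phi> (r *\<^sub>R x) = r *\<^sub>R \<phi> x" for r x
        using dual_scale_arg[OF \<phi>, of "of_real r" x] by (simp add: scaleC_of_real scaleR_conv_of_real)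
      have "(cmod (\<phi> a))\<^sup>2 \<le> K * (norm a)\<^sup>2" for a
        using order_trans[OF K(2) mult_left_mono[OF sq_le_norm K(1)]] .
      then have "cmod (\<phi> a) \<le> sqrt (K * (norm a)\<^sup>2)" for a
        by (rule real_le_rsqrt)
      then show "norm (\<phi> a) \<le> norm a * sqrt K" for a
        by (simp add: real_sqrt_mult mult.commute)
    qed (simp add: dual_add_arg \<phi>)
  qed
  have "closed {x. \<phi> (star x * a) = 0}" if "\<phi> \<in> dual" for \<phi> a
  proof -
    have "bounded_linear (\<lambda>x. \<phi> (star x * a))"
      by (rule bounded_linear_compose[OF lin[OF that]
          bounded_linear_compose[OF bounded_linear_mult_left bounded_linear_star]])
    then show ?thesis
      by (intro closed_Collect_eq linear_continuous_on continuous_on_const)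
  qed
  moreover have "H.kernel act = (\<Inter>\<phi>\<in>dual. \<Inter>a. {x. \<phi> (star x * a) = 0})"
    using kernel by auto
  ultimately have "closed (H.kernel act)"
    by (simp add: closed_INT)
  moreover have "x * b \<in> H.kernel act" if "x \<in> H.kernel act" for x b
    unfolding kernel
  proof (intro ballI allI)
    fix \<phi> a
    assume "\<phi> \<in> dual"
    then have "act b \<phi> (star x * a) = 0"
      using that act_closed unfolding kernel by blast
    then show "\<phi> (star (x * b) * a) = 0"
      by (simp add: act_def star_mult mult.assoc)
  qed
  moreover have "x + y \<in> H.kernel act" if "x \<in> H.kernel act" "y \<in> H.kernel act" for x y
    unfolding kernel
  proof (intro ballI allI)
    fix \<phi> a
    assume \<phi>: "\<phi> \<in> dual"
    then have "\<phi> (star x * a) = 0" "\<phi> (star y * a) = 0"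
      using that kernel by blast+
    then show "\<phi> (star (x + y) * a) = 0"
      by (simp add: star_add distrib_right dual_add_arg \<phi>)
  qed
  ultimately show ?thesis
    unfolding closed_ideal_def
    by (auto simp: kernel star_scaleC mult_scaleC_left dual_scale_arg
        star_mult mult.assoc dual_zero_arg)
qed

end

text \<open>The ideal is the kernel of the representation of an extreme quasi-state that vanishes on \<open>J\<close>
  but not on some \<open>x\<^sup>* x\<close>.\<close>

theorem exists_primitive_ideal:
  fixes J :: "'a::cstar_algebra set"
  assumes J: "closed_ideal J" "J \<noteq> UNIV"
  obtains P where "P \<in> Prim" "closed_ideal P" "J \<subseteq> P" "P \<noteq> UNIV"
proof -
  obtain x where "x \<notin> J"
    using J(2) by blast
  then obtain F where extreme: "extreme_in (quasi_states J) F" and positive: "0 < F (star x * x)"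
    using exists_extreme_quasi_state[OF J(1)] by blast
  interpret gns J F
  proof
    show "closed_ideal J"
      by (rule J(1))
    show "F \<in> quasi_states J"
      using extreme by (simp add: extreme_in_def)
  qed
  let ?P = "H.kernel act"
  have "x \<notin> ?P"
  proof
    assume "x \<in> ?P"
    then have "act x cyclic = (\<lambda>_. 0)"
      using cyclic_in_dual by (simp add: H.kernel_def)
    then have "form x x = 0"
      by (simp add: act_cyclic)
    then show False
      using positive sq_eq[of x] by (simp add: sq_def)
  qed
  then have "H.irreducible_representation act"
    unfolding H.irreducible_representation_def
    using representation_act invariant_subspace_of_extreme[OF extreme] by blast
  then have "?P \<in> Prim"
    unfolding Prim_def using H.complex_hilbert_space_axioms by blast
  moreover have "J \<subseteq> ?P"
    by (auto simp: H.kernel_def act_ideal)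
  ultimately show ?thesis
    using that closed_ideal_kernel \<open>x \<notin> ?P\<close> by blast
qed

section \<open>Actions\<close>

lemma cstar_action_zero:
  assumes "cstar_action \<alpha>"
  shows "\<alpha> 0 = id"
proof -
  have "\<alpha> (0 + 0) = \<alpha> 0 \<circ> \<alpha> 0"
    using assms unfolding cstar_action_def by blast
  then have "\<alpha> 0 (\<alpha> 0 x) = \<alpha> 0 x" for x
    by (metis add_0 comp_apply)
  moreover have "inj (\<alpha> 0)"
    using assms by (simp add: cstar_action_def star_automorphism_def bij_is_inj)
  ultimately show ?thesis
    by (metis eq_id_iff injD)
qed

lemma cstar_action_add: "cstar_action \<alpha> \<Longrightarrow> \<alpha> (g + h) x = \<alpha> g (\<alpha> h x)"
  by (simp add: cstar_action_def)

lemma cstar_action_inverse: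
  assumes "cstar_action \<alpha>"
  shows "\<alpha> g (\<alpha> (- g) x) = x" "\<alpha> (- g) (\<alpha> g x) = x"
proof -
  show "\<alpha> g (\<alpha> (- g) x) = x"
    using cstar_action_add[OF assms, of g "- g" x] by (simp add: cstar_action_zero[OF assms])
  show "\<alpha> (- g) (\<alpha> g x) = x"
    using cstar_action_add[OF assms, of "- g" g x] by (simp add: cstar_action_zero[OF assms])
qed

lemma cstar_action_image: "cstar_action \<alpha> \<Longrightarrow> \<alpha> (g + h) ` I = \<alpha> g ` \<alpha> h ` I"
  by (simp add: cstar_action_def image_comp)

lemma mem_action_image: "cstar_action \<alpha> \<Longrightarrow> x \<in> \<alpha> g ` I \<longleftrightarrow> \<alpha> (- g) x \<in> I"
  by (metis cstar_action_inverse image_iff)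

lemma closed_ideal_action_image:
  assumes \<alpha>: "cstar_action \<alpha>" and I: "closed_ideal I"
  shows "closed_ideal (\<alpha> g ` I)"
proof -
  have aut: "star_automorphism (\<alpha> (- g))"
    using \<alpha> by (simp add: cstar_action_def)
  have eq: "\<alpha> g ` I = \<alpha> (- g) -` I"
    by (intro set_eqI) (simp add: mem_action_image[OF \<alpha>])
  have "bounded_linear (\<alpha> (- g))"
    by (rule bounded_linear_intro[where K=1])
      (use aut in \<open>auto simp: star_automorphism_def star_automorphism_scaleR[OF aut]
        star_automorphism_norm_le[OF aut]\<close>)
  then have "closed (\<alpha> g ` I)"
    unfolding eq by (intro closed_vimage closed_ideal_simps(6)[OF I] linear_continuous_on)
  moreover have "\<alpha> (- g) 0 = 0"
    using star_automorphism_scaleR[OF aut, of 0 0] by simp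
  ultimately show ?thesis
    using aut unfolding closed_ideal_def eq
    by (auto simp: star_automorphism_def closed_ideal_simps[OF I])
qed

lemma closed_ideal_Inter: "(\<And>I. I \<in> \<I> \<Longrightarrow> closed_ideal I) \<Longrightarrow> closed_ideal (\<Inter>\<I>)"
  unfolding closed_ideal_def by (auto intro: closed_Inter)

text \<open>The product of two closed ideals is nonzero by primeness, and it lies in their intersection.\<close>

lemma prime_finite_Inter:
  fixes \<I> :: "'a::cstar_algebra set set"
  assumes prime: "prime_cstar TYPE('a)" and "finite \<I>"
    and "\<And>I. I \<in> \<I> \<Longrightarrow> closed_ideal I \<and> I \<noteq> {0}"
  shows "\<Inter>\<I> \<noteq> {0}"
  using assms(2,3)
proof (induction \<I>)
  case empty
  then show ?case
    using prime by (simp add: prime_cstar_def)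
next
  case (insert I \<I>)
  have I: "closed_ideal I" "I \<noteq> {0}" and K: "closed_ideal (\<Inter>\<I>)" "\<Inter>\<I> \<noteq> {0}"
    using insert by (auto intro: closed_ideal_Inter)
  then obtain x y where xy: "x \<in> I" "y \<in> \<Inter>\<I>" "x * y \<noteq> 0"
    using prime unfolding prime_cstar_def by blast
  then have "x * y \<in> \<Inter>(insert I \<I>)"
    using closed_ideal_simps(5)[OF I(1) xy(1)] closed_ideal_simps(4)[OF K(1) xy(2)] by simp
  then show ?case
    using xy(3) by blast
qed

text \<open>The common element depends only on \<open>a \<in> I\<close>, and \<open>\<alpha>\<^sub>u(a\<^sup>2)\<close> witnesses that it is in \<open>\<alpha>\<^sub>u(I)\<close>.\<close>

lemma nearby_translates_meet:
  fixes \<alpha> :: "'g::topological_group_add \<Rightarrow> 'a::cstar_algebra \<Rightarrow> 'a"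
  assumes \<alpha>: "cstar_action \<alpha>" and I: "closed_ideal I" "I \<noteq> {0}"
  obtains U where "open U" "0 \<in> U" "(\<Inter>u\<in>U. \<alpha> u ` I) \<noteq> {0}"
proof -
  obtain x where x: "x \<in> I" "x \<noteq> 0"
    using I closed_ideal_simps(1) by blast
  define a where "a = (1 / norm (star x * x)) *\<^sub>R (star x * x)"
  have "star x * x \<noteq> 0"
    using x cstar_identity[of x] by auto
  then have a: "star a = a" "norm a = 1" "a \<in> I"
    using x(1) I(1)
    by (auto simp: a_def star_scaleR star_mult star_star closed_ideal_scaleR closed_ideal_simps)
  obtain d where d: "d \<noteq> 0" "\<And>L c. closed_ideal L \<Longrightarrow> c \<in> L \<Longrightarrow> star c = c \<Longrightarrow>
      norm (a * a - c) \<le> 1/2 \<Longrightarrow> d \<in> L"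
    using common_element_of_nearby_ideals[OF a(1,2)] by blast
  define U where "U = {u. norm (a * a - \<alpha> u (a * a)) < 1/2}"
  have "open U"
    unfolding U_def using \<alpha>
    by (intro open_Collect_less continuous_intros) (auto simp: cstar_action_def)
  moreover have "0 \<in> U"
    by (simp add: U_def cstar_action_zero[OF \<alpha>])
  moreover have "d \<in> \<alpha> u ` I" if "u \<in> U" for u
  proof (rule d(2))
    show "closed_ideal (\<alpha> u ` I)"
      by (rule closed_ideal_action_image[OF \<alpha> I(1)])
    show "\<alpha> u (a * a) \<in> \<alpha> u ` I"
      using a(3) closed_ideal_simps(4)[OF I(1)] by blast
    have "\<alpha> u (star (a * a)) = star (\<alpha> u (a * a))"
      using \<alpha> unfolding cstar_action_def star_automorphism_def by blast
    then show "star (\<alpha> u (a * a)) = \<alpha> u (a * a)"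
      by (simp add: star_mult a(1))
    show "norm (a * a - \<alpha> u (a * a)) \<le> 1/2"
      using that by (simp add: U_def)
  qed
  ultimately show ?thesis
    using that[of U] d(1) by blast
qed

text \<open>The image of \<open>g + U\<close> in the coset space is open, since its preimage \<open>g + U + H\<close> is a union of
  right translates of an open set.\<close>

lemma finite_cover_by_translates:
  fixes H :: "'g::topological_group_add set"
  assumes H: "0 \<in> H" "\<And>h. h \<in> H \<Longrightarrow> - h \<in> H" "\<And>h k. h \<in> H \<Longrightarrow> k \<in> H \<Longrightarrow> h + k \<in> H"
    and compact: "compact_space (coset_space H)" and U: "open U" "0 \<in> U"
  obtains T where "finite T" "\<And>x. \<exists>g\<in>T. \<exists>u\<in>U. \<exists>h\<in>H. x = g + u + h"
proof -
  define D where "D g = left_coset H ` ((\<lambda>u. g + u) ` U)" for g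
  have eq: "left_coset H -` D g = (\<Union>h\<in>H. (\<lambda>x. - g + (x + h)) -` U)" for g
  proof (intro set_eqI iffI)
    fix x
    assume "x \<in> left_coset H -` D g"
    then obtain u where u: "u \<in> U" "left_coset H x = left_coset H (g + u)"
      by (auto simp: D_def)
    have "g + u \<in> left_coset H (g + u)"
      unfolding left_coset_def using H(1) by (metis add.right_neutral image_eqI)
    then obtain h where "h \<in> H" "g + u = x + h"
      using u(2) by (auto simp: left_coset_def)
    then have "- g + (x + h) = u"
      by (metis minus_add_cancel)
    then show "x \<in> (\<Union>h\<in>H. (\<lambda>x. - g + (x + h)) -` U)"
      using u(1) \<open>h \<in> H\<close> by blast
  next
    fix x
    assume "x \<in> (\<Union>h\<in>H. (\<lambda>x. - g + (x + h)) -` U)"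
    then obtain h where h: "h \<in> H" "- g + (x + h) \<in> U"
      by blast
    have "left_coset H (x + h) = left_coset H x"
    proof (intro set_eqI iffI)
      fix z
      assume "z \<in> left_coset H (x + h)"
      then obtain k where "k \<in> H" "z = x + (h + k)"
        by (auto simp: left_coset_def add.assoc)
      then show "z \<in> left_coset H x"
        using H(3)[OF h(1)] by (auto simp: left_coset_def)
    next
      fix z
      assume "z \<in> left_coset H x"
      then obtain k where "k \<in> H" "z = x + k"
        by (auto simp: left_coset_def)
      then have "z = x + h + (- h + k)" "- h + k \<in> H"
        using H(2)[OF h(1)] H(3) by (auto simp: add.assoc)
      then show "z \<in> left_coset H (x + h)"
        by (auto simp: left_coset_def)
    qed
    moreover have "x + h = g + (- g + (x + h))"
      by simp
    ultimately show "x \<in> left_coset H -` D g"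
      unfolding D_def using h(2) by (metis image_eqI vimageI2)
  qed
  have "openin (coset_space H) (D g)" for g
  proof -
    have "open ((\<lambda>x. - g + (x + h)) -` U)" for h
      by (intro open_vimage[OF U(1)] continuous_intros)
    then show ?thesis
      unfolding openin_coset_space eq by (auto simp: D_def)
  qed
  moreover have "topspace (coset_space H) \<subseteq> \<Union>(range D)"
    unfolding topspace_coset_space D_def using U(2) by (force intro: image_eqI[of _ _ 0])
  ultimately obtain \<F> where "finite \<F>" "\<F> \<subseteq> range D" "topspace (coset_space H) \<subseteq> \<Union>\<F>"
    using compact unfolding compact_space_alt by (metis (no_types, lifting) rangeE)
  then obtain T where T: "finite T" "topspace (coset_space H) \<subseteq> (\<Union>g\<in>T. D g)"
    by (metis finite_subset_image)
  have "\<exists>g\<in>T. \<exists>u\<in>U. \<exists>h\<in>H. x = g + u + h" for x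
  proof -
    have "left_coset H x \<in> (\<Union>g\<in>T. D g)"
      using T(2) by (auto simp: topspace_coset_space)
    then obtain g u where "g \<in> T" "u \<in> U" "left_coset H x = left_coset H (g + u)"
      by (auto simp: D_def)
    moreover have "x \<in> left_coset H x"
      unfolding left_coset_def using H(1) by (metis add.right_neutral image_eqI)
    ultimately show ?thesis
      by (auto simp: left_coset_def)
  qed
  then show ?thesis
    using that T(1) by blast
qed

lemma Prim_kernel_subgroup:
  assumes \<alpha>: "cstar_action \<alpha>"
  shows "0 \<in> Prim_kernel \<alpha>"
    and "h \<in> Prim_kernel \<alpha> \<Longrightarrow> - h \<in> Prim_kernel \<alpha>"
    and "h \<in> Prim_kernel \<alpha> \<Longrightarrow> k \<in> Prim_kernel \<alpha> \<Longrightarrow> h + k \<in> Prim_kernel \<alpha>"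
proof -
  show "0 \<in> Prim_kernel \<alpha>"
    by (simp add: Prim_kernel_def Prim_map_def cstar_action_zero[OF \<alpha>])
  show "h + k \<in> Prim_kernel \<alpha>" if "h \<in> Prim_kernel \<alpha>" "k \<in> Prim_kernel \<alpha>"
    using that by (simp add: Prim_kernel_def Prim_map_def cstar_action_image[OF \<alpha>])
  show "- h \<in> Prim_kernel \<alpha>" if "h \<in> Prim_kernel \<alpha>"
  proof -
    have "\<alpha> (- h) ` J = J" if "J \<in> Prim" for J
    proof -
      have "\<alpha> h ` J = J"
        using \<open>h \<in> Prim_kernel \<alpha>\<close> that by (auto simp: Prim_kernel_def Prim_map_def)
      then have "\<alpha> (- h) ` J = \<alpha> (- h + h) ` J"
        by (simp only: cstar_action_image[OF \<alpha>])
      then show ?thesis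
        by (simp add: cstar_action_zero[OF \<alpha>])
    qed
    then show ?thesis
      by (simp add: Prim_kernel_def Prim_map_def)
  qed
qed

theorem corollary4p2:
  fixes \<alpha> :: "'g::{topological_group_add, t2_space} \<Rightarrow> 'a::cstar_algebra \<Rightarrow> 'a"
  assumes "cstar_action \<alpha>"
    and "minimal_action \<alpha>"
    and "separable_space (euclidean :: 'a topology)"
    and "prime_cstar TYPE('a)"
    and "compact_space (coset_space (Prim_kernel \<alpha>))"
  shows "simple_cstar TYPE('a)"
  unfolding simple_cstar_def
proof (intro conjI allI impI)
  note \<alpha> = assms(1) and prime = assms(4)
  show "(UNIV :: 'a set) \<noteq> {0}"
    using prime by (simp add: prime_cstar_def)
  fix J :: "'a set"
  assume J: "closed_ideal J"
  show "J = {0} \<or> J = UNIV"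
  proof (rule ccontr)
    assume J_proper: "\<not> (J = {0} \<or> J = UNIV)"
    then obtain P where P: "P \<in> Prim" "closed_ideal P" "J \<subseteq> P" "P \<noteq> UNIV"
      using exists_primitive_ideal[OF J] by blast
    have "P \<noteq> {0}"
      using P(3) J_proper closed_ideal_simps(1)[OF J] by blast
    obtain U where U: "open U" "0 \<in> U" "(\<Inter>u\<in>U. \<alpha> u ` P) \<noteq> {0}"
      by (rule nearby_translates_meet[OF \<alpha> P(2) \<open>P \<noteq> {0}\<close>])
    obtain T where T: "finite T" "\<And>x. \<exists>g\<in>T. \<exists>u\<in>U. \<exists>h\<in>Prim_kernel \<alpha>. x = g + u + h"
      by (rule finite_cover_by_translates[OF Prim_kernel_subgroup[OF \<alpha>] assms(5) U(1,2)])
        (assumption+, rule that)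
    define M where "M = (\<Inter>u\<in>U. \<alpha> u ` P)"
    \<comment> \<open>\<open>K\<close> is invariant and contained in \<open>P\<close>, so it contradicts minimality once it is nonzero.\<close>
    define K where "K = (\<Inter>x. \<alpha> x ` P)"
    have M: "closed_ideal M"
      unfolding M_def by (intro closed_ideal_Inter) (auto intro: closed_ideal_action_image \<alpha> P(2))
    have K: "closed_ideal K"
      unfolding K_def by (intro closed_ideal_Inter) (auto intro: closed_ideal_action_image \<alpha> P(2))
    have "\<alpha> g ` M \<noteq> {0}" for g
    proof
      assume "\<alpha> g ` M = {0}"
      then have "\<alpha> (- g) ` \<alpha> g ` M = {\<alpha> (- g) 0}"
        by simp
      moreover have "\<alpha> (- g) ` \<alpha> g ` M = M"
        by (simp add: image_image cstar_action_inverse[OF \<alpha>])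
      moreover have "0 \<in> M"
        by (rule closed_ideal_simps(1)[OF M])
      ultimately show False
        using U(3) unfolding M_def by auto
    qed
    then have "(\<Inter>g\<in>T. \<alpha> g ` M) \<noteq> {0}"
      using T(1) by (intro prime_finite_Inter[OF prime]) (auto intro: closed_ideal_action_image \<alpha> M)
    moreover have "(\<Inter>g\<in>T. \<alpha> g ` M) \<subseteq> K"
    proof
      fix y
      assume y: "y \<in> (\<Inter>g\<in>T. \<alpha> g ` M)"
      have "y \<in> \<alpha> x ` P" for x
      proof -
        obtain g u h where x: "g \<in> T" "u \<in> U" "h \<in> Prim_kernel \<alpha>" "x = g + u + h"
          using T(2) by blast
        have "\<alpha> h ` P = P"
          using x(3) P(1) by (auto simp: Prim_kernel_def Prim_map_def)
        then have "\<alpha> x ` P = \<alpha> g ` \<alpha> u ` P"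
          unfolding x(4) by (simp only: cstar_action_image[OF \<alpha>])
        moreover have "M \<subseteq> \<alpha> u ` P"
          unfolding M_def by (rule INF_lower[OF x(2)])
        then have "\<alpha> g ` M \<subseteq> \<alpha> g ` \<alpha> u ` P"
          by (rule image_mono)
        moreover have "y \<in> \<alpha> g ` M"
          using y x(1) by (rule INT_D)
        ultimately show ?thesis
          by (simp only: subsetD)
      qed
      then show "y \<in> K"
        by (simp add: K_def)
    qed
    moreover have "0 \<in> (\<Inter>g\<in>T. \<alpha> g ` M)"
      using closed_ideal_simps(1)[OF closed_ideal_action_image[OF \<alpha> M]] by blast
    ultimately have "K \<noteq> {0}"
      by blast
    moreover have "\<alpha> g ` K \<subseteq> K" for g
    proof
      fix y
      assume "y \<in> \<alpha> g ` K"
      then obtain z where z: "z \<in> K" "y = \<alpha> g z"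
        by blast
      have "y \<in> \<alpha> x ` P" for x
      proof -
        have "z \<in> \<alpha> (- g + x) ` P"
          using z(1) by (simp add: K_def)
        then have "y \<in> \<alpha> g ` \<alpha> (- g + x) ` P"
          using z(2) by blast
        then show ?thesis
          by (simp flip: cstar_action_image[OF \<alpha>])
      qed
      then show "y \<in> K"
        by (simp add: K_def)
    qed
    ultimately have "K = UNIV"
      using assms(2) K unfolding minimal_action_def by blast
    then have "\<alpha> 0 ` P = UNIV"
      unfolding K_def by blast
    then show False
      using P(4) by (simp add: cstar_action_zero[OF \<alpha>])
  qed
qed

end
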